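(* Assume $\alpha\ge 5/2$ and $\beta\in[2/3,1]$. Let $u$ be the solution of the turning point problem $-\varepsilon\Delta u+x\,a(x,y)u_x+c(x,y)u=f$ in $\Omega=(-1,1)^2$, $u=0$ on $\partial\Omega$, and let $u_h\in S_h$ be its standard bilinear finite element approximation on the Shishkin mesh described in the context. Then there is a constant $C>0$, independent of $\varepsilon$ and $N$, such that for every mesh point $(x_m,y_n)\in\Omega_c$, $$|(u-u_h)(x_m,y_n)|\le C.$$
   Context: Problem. $\Omega=(-1,1)\times(-1,1)$, $0<\varepsilon\ll 1$, and $a,c,f$ are sufficiently smooth on $\bar\Omega$. Put $b_1(x,y)=x\,a(x,y)$ and assume $|a(x,y)|\ge\alpha>0$, $|c(x,y)|\ge 0$, $c-\frac12\frac{\partial b_1}{\partial x}\ge\gamma>0$ on $\bar\Omega$, with the standing assumption $\alpha\ge 5/2$. Consider $-\varepsilon\Delta u+b_1u_x+cu=f$ in $\Omega$, $u=0$ on $\partial\Omega$. With $(\cdot,\cdot)$ the $L^2(\Omega)$ inner product, $B(u,v)=\varepsilon(\nabla u,\nabla v)+(b_1u_x,v)+(cu,v)$; the weak solution $u\in H^1_0(\Omega)$ satisfies $B(u,v)=(f,v)$ for all $v\in H_0^1(\Omega)$. Solution decomposition (standing). $f\in C^{3,\beta}(\bar\Omega)$ with $\beta\in[2/3,1]$, $f(-1,-1)=f(1,1)=f(1,-1)=f(-1,1)=0$, and $u=R+F_1+F_2+F_{12}$ where, with $E(y)=e^{-\frac{\beta}{\sqrt\varepsilon}(1+y)}+e^{-\frac{\beta}{\sqrt\varepsilon}(1-y)}$,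 for all $(x,y)\in\bar\Omega$ and $0\le i+j\le 2$: $|\partial_x^i\partial_y^jR|\le C$, $|\partial_x^i\partial_y^jF_1|\le C\varepsilon^{-i}e^{-\alpha|x|/\varepsilon}$, $|\partial_x^i\partial_y^jF_2|\le C\varepsilon^{-j/2}E(y)$, $|\partial_x^i\partial_y^jF_{12}|\le C\varepsilon^{-i-j/2}e^{-\alpha|x|/\varepsilon}E(y)$. Mesh. $N\ge4$ is an even integer (divisible by 4 so that the indices below are integers), $\lambda_x=\min\left(\frac{2\varepsilon}{\alpha}\log\frac1\varepsilon,\frac12\right)$, $\lambda_y=\min\left(2\sqrt{\frac{\varepsilon}{\beta}}\log\frac{1}{\varepsilon^{3/2}},\frac14\right)$. In $x$, each of $[0,\lambda_x]$ and $[\lambda_x,1]$ is divided uniformly into $N/2$ intervals, and this is reflected to $[-1,0]$. In $y$, $[-1,-1+\lambda_y]$, $[-1+\lambda_y,1-\lambda_y]$, $[1-\lambda_y,1]$ are divided uniformly into $N/4$, $N/2$, $N/4$ intervals. The mesh consists of the tensor-product rectangles. Coarse subregion (of the half $x\ge0$, by symmetry): $\Omega_c=[\lambda_x,1]\times[-1+\lambda_y,1-\lambda_y]$. Discretization. $S_h$ is the space of continuous functions on $\bar\Omega$ vanishing on $\partial\Omega$ that are bilinear on each mesh rectangle; $u_h\in S_h$ is defined by $B(u_h,v_h)=(f,v_h)$ for all $v_h\in S_h$. *)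

theory Defs
  imports "HOL-Analysis.Analysis"
begin

definition Omega :: "(real \<times> real) set" where
  "Omega = {-1<..<1} \<times> {-1<..<1}"

abbreviation Omega_bar :: "(real \<times> real) set" where
  "Omega_bar \<equiv> {-1..1} \<times> {-1..1}"


subsection \<open>Classical derivatives on the closed square\<close>

text \<open>Derivatives are taken within the closed square: two-sided at points of
  \<^const>\<open>Omega\<close>, one-sided across an edge.\<close>

definition pdx :: "(real \<times> real \<Rightarrow> real) \<Rightarrow> real \<times> real \<Rightarrow> real" where
  "pdx g z = vector_derivative (\<lambda>t. g (t, snd z)) (at (fst z) within {-1..1})"

definition pdy :: "(real \<times> real \<Rightarrow> real) \<Rightarrow> real \<times> real \<Rightarrow> real" where
  "pdy g z = vector_derivative (\<lambda>t. g (fst z, t)) (at (snd z) within {-1..1})"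

definition pd :: "nat \<Rightarrow> nat \<Rightarrow> (real \<times> real \<Rightarrow> real) \<Rightarrow> real \<times> real \<Rightarrow> real" where
  "pd i j g = (pdx ^^ i) ((pdy ^^ j) g)"

text \<open>The space of \<open>k\<close> times continuously differentiable functions on the closed square.\<close>

primrec C_k :: "nat \<Rightarrow> (real \<times> real \<Rightarrow> real) \<Rightarrow> bool" where
  "C_k 0 g \<longleftrightarrow> continuous_on Omega_bar g"
| "C_k (Suc k) g \<longleftrightarrow> continuous_on Omega_bar g \<and>
     (\<forall>x\<in>{-1..1}. \<forall>y\<in>{-1..1}.
        (\<lambda>t. g (t, y)) differentiable (at x within {-1..1}) \<and>
        (\<lambda>t. g (x, t)) differentiable (at y within {-1..1})) \<and>
     C_k k (pdx g) \<and> C_k k (pdy g)"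

definition C_k_hoelder :: "nat \<Rightarrow> real \<Rightarrow> (real \<times> real \<Rightarrow> real) \<Rightarrow> bool" where
  "C_k_hoelder k \<beta> g \<longleftrightarrow> C_k k g \<and>
     (\<forall>i j. i + j = k \<longrightarrow>
        (\<exists>K. \<forall>z\<in>Omega_bar. \<forall>w\<in>Omega_bar.
           \<bar>pd i j g z - pd i j g w\<bar> \<le> K * dist z w powr \<beta>))"


subsection \<open>Sobolev spaces on the open square\<close>

definition test_functions :: "(real \<times> real \<Rightarrow> real) set" where
  "test_functions = {\<phi>. (\<forall>k. C_k k \<phi>) \<and>
     (\<exists>K. compact K \<and> K \<subseteq> Omega \<and> (\<forall>z. z \<notin> K \<longrightarrow> \<phi> z = 0))}"

definition L2 :: "(real \<times> real \<Rightarrow> real) set" where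
  "L2 = {g. g \<in> borel_measurable (lebesgue_on Omega) \<and>
            integrable (lebesgue_on Omega) (\<lambda>z. (g z)\<^sup>2)}"

definition ip :: "(real \<times> real \<Rightarrow> real) \<Rightarrow> (real \<times> real \<Rightarrow> real) \<Rightarrow> real" where
  "ip g h = (LINT z|lebesgue_on Omega. g z * h z)"

definition weak_dx :: "(real \<times> real \<Rightarrow> real) \<Rightarrow> (real \<times> real \<Rightarrow> real) \<Rightarrow> bool" where
  "weak_dx v g \<longleftrightarrow> g \<in> L2 \<and> (\<forall>\<phi>\<in>test_functions. ip v (pdx \<phi>) = - ip g \<phi>)"

definition weak_dy :: "(real \<times> real \<Rightarrow> real) \<Rightarrow> (real \<times> real \<Rightarrow> real) \<Rightarrow> bool" where
  "weak_dy v g \<longleftrightarrow> g \<in> L2 \<and> (\<forall>\<phi>\<in>test_functions. ip v (pdy \<phi>) = - ip g \<phi>)"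

definition H1 :: "(real \<times> real \<Rightarrow> real) set" where
  "H1 = {v \<in> L2. (\<exists>g. weak_dx v g) \<and> (\<exists>g. weak_dy v g)}"

text \<open>The weak derivatives are unique up to null sets, so the choice of representative
  does not affect any integral below.\<close>

definition wdx :: "(real \<times> real \<Rightarrow> real) \<Rightarrow> real \<times> real \<Rightarrow> real" where
  "wdx v = (SOME g. weak_dx v g)"

definition wdy :: "(real \<times> real \<Rightarrow> real) \<Rightarrow> real \<times> real \<Rightarrow> real" where
  "wdy v = (SOME g. weak_dy v g)"

definition H1_norm :: "(real \<times> real \<Rightarrow> real) \<Rightarrow> real" where
  "H1_norm v = sqrt (ip v v + ip (wdx v) (wdx v) + ip (wdy v) (wdy v))"

definition H10 :: "(real \<times> real \<Rightarrow> real) set" where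
  "H10 = {v \<in> H1. \<exists>\<phi>. (\<forall>n. \<phi> n \<in> test_functions) \<and>
            (\<lambda>n::nat. H1_norm (\<lambda>z. v z - \<phi> n z)) \<longlonglongrightarrow> 0}"


subsection \<open>The turning point problem\<close>

definition b1 :: "(real \<times> real \<Rightarrow> real) \<Rightarrow> real \<times> real \<Rightarrow> real" where
  "b1 a z = fst z * a z"

definition B_form :: "real \<Rightarrow> (real \<times> real \<Rightarrow> real) \<Rightarrow> (real \<times> real \<Rightarrow> real) \<Rightarrow>
    (real \<times> real \<Rightarrow> real) \<Rightarrow> (real \<times> real \<Rightarrow> real) \<Rightarrow> real" where
  "B_form \<epsilon> a c u v =
     \<epsilon> * (ip (wdx u) (wdx v) + ip (wdy u) (wdy v))
     + ip (\<lambda>z. b1 a z * wdx u z) v + ip (\<lambda>z. c z * u z) v"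

definition weak_solution :: "real \<Rightarrow> (real \<times> real \<Rightarrow> real) \<Rightarrow> (real \<times> real \<Rightarrow> real) \<Rightarrow>
    (real \<times> real \<Rightarrow> real) \<Rightarrow> (real \<times> real \<Rightarrow> real) \<Rightarrow> bool" where
  "weak_solution \<epsilon> a c f u \<longleftrightarrow> u \<in> H10 \<and> (\<forall>v\<in>H10. B_form \<epsilon> a c u v = ip f v)"

definition layer_y :: "real \<Rightarrow> real \<Rightarrow> real \<Rightarrow> real" where
  "layer_y \<epsilon> \<beta> y = exp (- (\<beta> / sqrt \<epsilon>) * (1 + y)) + exp (- (\<beta> / sqrt \<epsilon>) * (1 - y))"

text \<open>The constant \<open>C\<^sub>0\<close> is an explicit parameter, so that it can be fixed before
  \<open>\<epsilon>\<close> is chosen.\<close>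

definition solution_decomposition ::
    "real \<Rightarrow> real \<Rightarrow> real \<Rightarrow> real \<Rightarrow> (real \<times> real \<Rightarrow> real) \<Rightarrow> bool" where
  "solution_decomposition C\<^sub>0 \<alpha> \<beta> \<epsilon> u \<longleftrightarrow>
     (\<exists>R F\<^sub>1 F\<^sub>2 F\<^sub>1\<^sub>2. C_k 2 R \<and> C_k 2 F\<^sub>1 \<and> C_k 2 F\<^sub>2 \<and> C_k 2 F\<^sub>1\<^sub>2 \<and>
       (\<forall>z\<in>Omega_bar. u z = R z + F\<^sub>1 z + F\<^sub>2 z + F\<^sub>1\<^sub>2 z) \<and>
       (\<forall>x\<in>{-1..1}. \<forall>y\<in>{-1..1}. \<forall>i j. i + j \<le> 2 \<longrightarrow>
          \<bar>pd i j R (x, y)\<bar> \<le> C\<^sub>0 \<and>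
          \<bar>pd i j F\<^sub>1 (x, y)\<bar> \<le> C\<^sub>0 * \<epsilon> powr (- real i) * exp (- \<alpha> * \<bar>x\<bar> / \<epsilon>) \<and>
          \<bar>pd i j F\<^sub>2 (x, y)\<bar> \<le> C\<^sub>0 * \<epsilon> powr (- real j / 2) * layer_y \<epsilon> \<beta> y \<and>
          \<bar>pd i j F\<^sub>1\<^sub>2 (x, y)\<bar> \<le> C\<^sub>0 * \<epsilon> powr (- real i - real j / 2)
                                * exp (- \<alpha> * \<bar>x\<bar> / \<epsilon>) * layer_y \<epsilon> \<beta> y))"


subsection \<open>Shishkin mesh and discretization\<close>

definition lambda_x :: "real \<Rightarrow> real \<Rightarrow> real" where
  "lambda_x \<alpha> \<epsilon> = min (2 * \<epsilon> / \<alpha> * ln (1 / \<epsilon>)) (1 / 2)"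

definition lambda_y :: "real \<Rightarrow> real \<Rightarrow> real" where
  "lambda_y \<beta> \<epsilon> = min (2 * sqrt (\<epsilon> / \<beta>) * ln (1 / \<epsilon> powr (3 / 2))) (1 / 4)"

text \<open>Nodes in \<open>x\<close> are indexed by \<open>m = -N, \<dots>, N\<close> (there are \<open>N\<close> intervals
  in \<open>[0, 1]\<close>), nodes in \<open>y\<close> by \<open>n = 0, \<dots>, N\<close>.\<close>

definition x_node_pos :: "nat \<Rightarrow> real \<Rightarrow> real \<Rightarrow> real" where
  "x_node_pos N lam i =
     (if i \<le> real N / 2 then i * (lam / (real N / 2))
      else lam + (i - real N / 2) * ((1 - lam) / (real N / 2)))"

definition x_node :: "nat \<Rightarrow> real \<Rightarrow> int \<Rightarrow> real" where
  "x_node N lam m = of_int (sgn m) * x_node_pos N lam (of_int \<bar>m\<bar>)"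

definition y_node :: "nat \<Rightarrow> real \<Rightarrow> nat \<Rightarrow> real" where
  "y_node N lam n =
     (if real n \<le> real N / 4 then -1 + real n * (lam / (real N / 4))
      else if real n \<le> 3 * real N / 4
        then -1 + lam + (real n - real N / 4) * ((2 - 2 * lam) / (real N / 2))
      else 1 - lam + (real n - 3 * real N / 4) * (lam / (real N / 4)))"

definition FE_space :: "nat \<Rightarrow> real \<Rightarrow> real \<Rightarrow> (real \<times> real \<Rightarrow> real) set" where
  "FE_space N lx ly =
     {v. continuous_on Omega_bar v \<and> (\<forall>z\<in>frontier Omega. v z = 0) \<and>
         (\<forall>m\<in>{- int N..<int N}. \<forall>n\<in>{0..<N}. \<exists>p q r s.
            \<forall>x\<in>{x_node N lx m..x_node N lx (m + 1)}.
            \<forall>y\<in>{y_node N ly n..y_node N ly (n + 1)}.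
              v (x, y) = p + q * x + r * y + s * x * y)}"

definition FE_solution :: "nat \<Rightarrow> real \<Rightarrow> real \<Rightarrow> real \<Rightarrow> (real \<times> real \<Rightarrow> real) \<Rightarrow>
    (real \<times> real \<Rightarrow> real) \<Rightarrow> (real \<times> real \<Rightarrow> real) \<Rightarrow> (real \<times> real \<Rightarrow> real) \<Rightarrow> bool" where
  "FE_solution N lx ly \<epsilon> a c f uh \<longleftrightarrow> uh \<in> FE_space N lx ly \<and>
     (\<forall>v\<in>FE_space N lx ly. B_form \<epsilon> a c uh v = ip f v)"

definition Omega_c :: "real \<Rightarrow> real \<Rightarrow> (real \<times> real) set" where
  "Omega_c lx ly = {lx..1} \<times> {-1 + ly..1 - ly}"

end

theory Submission
  imports Defs
begin

text \<open>
  The decomposition makes \<open>u\<close> twice continuously differentiable on the closed square, so the weak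
  equation holds classically and may be tested with finite element functions by integrating by parts
  along lines; the inclusion of the finite element space in \<open>H\<^sub>0\<^sup>1\<close> is not needed. Let \<open>w\<close> be the
  bilinear interpolant of \<open>u\<close> and \<open>\<xi> = w - u\<^sub>h\<close>. Galerkin orthogonality and coercivity bound
  \<open>\<gamma> \<parallel>\<xi>\<parallel>\<^sup>2\<close> by interpolation errors. In the diffusion terms, \<open>\<xi>\<^sub>x\<close> is constant in \<open>x\<close> on each
  cell, so only the error of interpolation in \<open>y\<close> enters there, and symmetrically; this is what
  keeps powers of \<open>ln (1/\<epsilon>)\<close> out of the final bound. In the remaining terms the logarithms
  are absorbed by the small widths \<open>\<lambda>\<^sub>x\<close> and \<open>\<lambda>\<^sub>y\<close> of the layers. The result is \<open>\<parallel>\<xi>\<parallel> \<le> C/N\<close>, and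
  since the cells of the coarse region have area at least \<open>3/N\<^sup>2\<close>, the nodal values of \<open>\<xi>\<close> there
  are bounded.
\<close>

section \<open>Bounded Borel functions and integration over the square\<close>

text \<open>Two obstacles precede the error analysis. \<open>wdx\<close> and \<open>wdy\<close> are
  arbitrary choices among weak derivatives, so \<open>B_form\<close> can be evaluated only after
  weak derivatives are shown to be unique almost everywhere; and \<open>H10\<close> is defined by
  approximation, so the boundary values of \<open>u\<close>, without which the interpolant would not
  lie in the finite element space, have to be extracted from it. Two points decide the final
  estimate. In \<epsilon> times the squared error of \<open>pdx u\<close>, replacing the layer
  function exp(-\<alpha>|x|/\<epsilon>)/\<epsilon> by its maximum 1/\<epsilon> on a strip of width
  about \<epsilon> ln(1/\<epsilon>) would leave a logarithm, whereas its square integrates to a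
  multiple of 1/\<epsilon>; so in this term the exponential is kept as a function of
  \<open>x\<close>. In the convection term the turning point helps: |x| is at most of order
  \<epsilon> ln(1/\<epsilon>) on the fine cells, so \<open>b1 a\<close> times a derivative of size
  1/\<epsilon> is only logarithmic there.\<close>

definition BM :: "(real \<times> real \<Rightarrow> real) \<Rightarrow> bool" where
  "BM F \<longleftrightarrow> (\<lambda>z. indicator Omega z * F z) \<in> borel_measurable borel \<and> (\<exists>K. \<forall>z\<in>Omega. \<bar>F z\<bar> \<le> K)"

text \<open>\<open>J\<close> is meant for \<open>BM\<close> functions. They are integrable and
  closed under sums and products, so products raise no integrability questions; and they are Borel
  rather than Lebesgue measurable because Fubini and the exchange of coordinates take place over
  \<open>lborel\<close>, not over its completion.\<close>

definition J :: "(real \<times> real \<Rightarrow> real) \<Rightarrow> real" where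
  "J F = (LINT z|lebesgue_on Omega. F z)"

lemma ip_eq_J: "ip g h = J (\<lambda>z. g z * h z)" by (simp add: ip_def J_def)

lemma Omega_box: "Omega = box (-1, -1) (1, 1)" by (auto simp: Omega_def box_def Basis_prod_def)

lemma open_Omega: "open Omega"
  unfolding Omega_box by (rule open_box)

lemma Omega_sets [measurable, simp]: "Omega \<in> sets borel" by (simp add: Omega_box)

lemma Omega_sets_lebesgue [measurable, simp]: "Omega \<in> sets lebesgue" by (simp add: Omega_box)

lemma space_lebesgue_on_Omega [simp]: "space (lebesgue_on Omega) = Omega" by simp

lemma mem_Omega [simp]: "(x, y) \<in> Omega \<longleftrightarrow> -1 < x \<and> x < 1 \<and> -1 < y \<and> y < 1"
  by (auto simp: Omega_def)

lemma Omega_subset_bar: "Omega \<subseteq> Omega_bar" by (auto simp: Omega_def)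

lemma measure_Omega: "measure lebesgue Omega = 4"
proof -
  have B: "(Basis :: (real \<times> real) set) = {(1, 0), (0, 1)}" by (auto simp: Basis_prod_def)
  show ?thesis
    unfolding Omega_box by (subst measure_completion, simp, subst measure_lborel_box_eq) (simp add: B)
qed

lemma finite_measure_Omega: "finite_measure (lebesgue_on Omega)"
proof (rule finite_measureI)
  show "emeasure (lebesgue_on Omega) (space (lebesgue_on Omega)) \<noteq> \<infinity>"
    unfolding Omega_box by (subst emeasure_restrict_space) (auto simp: emeasure_lborel_box_eq)
qed

lemma BM_measurable: "BM F \<Longrightarrow> F \<in> borel_measurable (lebesgue_on Omega)"
  unfolding BM_def
  by (subst borel_measurable_restrict_space_iff) (auto intro: measurable_completion)

lemma BM_integrable: "BM F \<Longrightarrow> integrable (lebesgue_on Omega) F"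
proof -
  assume F: "BM F"
  then obtain K where "\<forall>z\<in>Omega. \<bar>F z\<bar> \<le> K" by (auto simp: BM_def)
  then have "AE z in lebesgue_on Omega. norm (F z) \<le> K" by (intro AE_I2) simp
  then show "integrable (lebesgue_on Omega) F"
    by (rule finite_measure.integrable_const_bound[OF finite_measure_Omega _ BM_measurable[OF F]])
qed

lemma BM_const [intro, simp]: "BM (\<lambda>z. k)"
  unfolding BM_def by auto

lemma BM_add [intro]: "BM F \<Longrightarrow> BM G \<Longrightarrow> BM (\<lambda>z. F z + G z)"
proof -
  assume "BM F" "BM G"
  then obtain K L where "\<And>z. z \<in> Omega \<Longrightarrow> \<bar>F z\<bar> \<le> K" "\<And>z. z \<in> Omega \<Longrightarrow> \<bar>G z\<bar> \<le> L"
    by (auto simp: BM_def)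
  then have "\<forall>z\<in>Omega. \<bar>F z + G z\<bar> \<le> K + L"
    by (meson abs_triangle_ineq add_mono order_trans)
  moreover have "(\<lambda>z. indicator Omega z * F z + indicator Omega z * G z) \<in> borel_measurable borel"
    using \<open>BM F\<close> \<open>BM G\<close> unfolding BM_def by (intro borel_measurable_add) auto
  ultimately show ?thesis
    unfolding BM_def by (auto simp: distrib_left)
qed

lemma BM_mult [intro]: "BM F \<Longrightarrow> BM G \<Longrightarrow> BM (\<lambda>z. F z * G z)"
proof -
  assume "BM F" "BM G"
  then obtain K L where *: "\<And>z. z \<in> Omega \<Longrightarrow> \<bar>F z\<bar> \<le> K" "\<And>z. z \<in> Omega \<Longrightarrow> \<bar>G z\<bar> \<le> L"
    by (auto simp: BM_def)
  have "\<forall>z\<in>Omega. \<bar>F z * G z\<bar> \<le> K * L"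
    unfolding abs_mult by (intro ballI mult_mono' *) auto
  moreover have "(\<lambda>z. (indicator Omega z * F z) * (indicator Omega z * G z)) \<in> borel_measurable borel"
    using \<open>BM F\<close> \<open>BM G\<close> unfolding BM_def by (elim conjE) (rule borel_measurable_times)
  moreover have "(\<lambda>z. (indicator Omega z * F z) * (indicator Omega z * G z))
      = (\<lambda>z. indicator Omega z * (F z * G z))" by (auto simp: indicator_def)
  ultimately show ?thesis
    unfolding BM_def by auto
qed

lemma BM_uminus [intro]: "BM F \<Longrightarrow> BM (\<lambda>z. - F z)"
  using BM_mult[of "\<lambda>_. -1" F] by simp

lemma BM_diff [intro]: "BM F \<Longrightarrow> BM G \<Longrightarrow> BM (\<lambda>z. F z - G z)"
  using BM_add[of F "\<lambda>z. - G z"] BM_uminus[of G] by simp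

lemma BM_power [intro]: "BM F \<Longrightarrow> BM (\<lambda>z. F z ^ n)" by (induction n) auto

lemma BM_sum [intro]: "(\<And>i. i \<in> I \<Longrightarrow> BM (F i)) \<Longrightarrow> BM (\<lambda>z. \<Sum>i\<in>I. F i z)"
  by (induction I rule: infinite_finite_induct) auto

lemma BM_continuous:
  assumes "continuous_on Omega_bar F"
  shows "BM F"
proof -
  have "compact (Omega_bar)" by (simp add: compact_Times)
  then have "bounded (F ` Omega_bar)"
    using assms compact_continuous_image compact_imp_bounded by blast
  then obtain K where "\<forall>z\<in>Omega_bar. \<bar>F z\<bar> \<le> K"
    by (auto simp: bounded_iff)
  then have "\<forall>z\<in>Omega. \<bar>F z\<bar> \<le> K" using Omega_subset_bar by blast
  moreover have "(\<lambda>z. indicator Omega z *\<^sub>R F z) \<in> borel_measurable borel"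
    using assms Omega_subset_bar
    by (intro borel_measurable_continuous_on_indicator) (auto intro: continuous_on_subset)
  ultimately show ?thesis
    unfolding BM_def by auto
qed

lemma BM_fst: "g \<in> borel_measurable borel \<Longrightarrow> (\<And>t. \<bar>t\<bar> < 1 \<Longrightarrow> \<bar>g t\<bar> \<le> K) \<Longrightarrow> BM (\<lambda>z. g (fst z))"
proof -
  assume "g \<in> borel_measurable borel" and *: "\<And>t. \<bar>t\<bar> < 1 \<Longrightarrow> \<bar>g t\<bar> \<le> K"
  then have "(\<lambda>z::real \<times> real. g (fst z)) \<in> borel_measurable borel"
    by (intro measurable_compose[of fst borel borel g])
       (auto intro!: borel_measurable_continuous_onI continuous_intros)
  then have "(\<lambda>z. indicator Omega z * g (fst z)) \<in> borel_measurable borel"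
    by (intro borel_measurable_times borel_measurable_indicator) auto
  moreover have "\<forall>z\<in>Omega. \<bar>g (fst z)\<bar> \<le> K"
    using * by (auto simp: Omega_def)
  ultimately show ?thesis
    unfolding BM_def by auto
qed

lemma BM_snd: "g \<in> borel_measurable borel \<Longrightarrow> (\<And>t. \<bar>t\<bar> < 1 \<Longrightarrow> \<bar>g t\<bar> \<le> K) \<Longrightarrow> BM (\<lambda>z. g (snd z))"
proof -
  assume "g \<in> borel_measurable borel" and *: "\<And>t. \<bar>t\<bar> < 1 \<Longrightarrow> \<bar>g t\<bar> \<le> K"
  then have "(\<lambda>z::real \<times> real. g (snd z)) \<in> borel_measurable borel"
    by (intro measurable_compose[of snd borel borel g])
       (auto intro!: borel_measurable_continuous_onI continuous_intros)
  then have "(\<lambda>z. indicator Omega z * g (snd z)) \<in> borel_measurable borel"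
    by (intro borel_measurable_times borel_measurable_indicator) auto
  moreover have "\<forall>z\<in>Omega. \<bar>g (snd z)\<bar> \<le> K"
    using * by (auto simp: Omega_def)
  ultimately show ?thesis
    unfolding BM_def by auto
qed

lemma J_cong: "(\<And>z. z \<in> Omega \<Longrightarrow> F z = G z) \<Longrightarrow> J F = J G"
  unfolding J_def by (rule Bochner_Integration.integral_cong) auto

lemma J_add: "BM F \<Longrightarrow> BM G \<Longrightarrow> J (\<lambda>z. F z + G z) = J F + J G"
  unfolding J_def by (simp add: BM_integrable)

lemma J_diff: "BM F \<Longrightarrow> BM G \<Longrightarrow> J (\<lambda>z. F z - G z) = J F - J G"
  unfolding J_def by (simp add: BM_integrable)

lemma J_cmult: "J (\<lambda>z. k * F z) = k * J F"
  unfolding J_def by simp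

lemma J_uminus: "J (\<lambda>z. - F z) = - J F"
  unfolding J_def by simp

lemma J_const: "J (\<lambda>z. k) = 4 * k"
  unfolding J_def using measure_Omega by (simp add: measure_restrict_space)

lemma J_mono: "BM F \<Longrightarrow> BM G \<Longrightarrow> (\<And>z. z \<in> Omega \<Longrightarrow> F z \<le> G z) \<Longrightarrow> J F \<le> J G"
  unfolding J_def by (rule integral_mono) (auto simp: BM_integrable)

lemma J_nonneg: "(\<And>z. z \<in> Omega \<Longrightarrow> 0 \<le> F z) \<Longrightarrow> 0 \<le> J F"
  unfolding J_def by (rule integral_nonneg_AE) (auto simp: AE_restrict_space_iff)

text \<open>Young's inequality takes the place of Cauchy--Schwarz.\<close>

lemma J_young:
  assumes "BM F" "BM G" "r > 0"
  shows "J (\<lambda>z. F z * G z) \<le> r / 2 * J (\<lambda>z. (F z)\<^sup>2) + 1 / (2 * r) * J (\<lambda>z. (G z)\<^sup>2)"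
proof -
  have "F z * G z \<le> r / 2 * (F z)\<^sup>2 + 1 / (2 * r) * (G z)\<^sup>2" for z
  proof -
    have "0 \<le> (r * F z - G z)\<^sup>2 / (2 * r)" using assms by simp
    also have "\<dots> = r / 2 * (F z)\<^sup>2 + 1 / (2 * r) * (G z)\<^sup>2 - F z * G z"
      using assms(3) by (simp add: power2_eq_square field_simps)
    finally show ?thesis by simp
  qed
  then have "J (\<lambda>z. F z * G z) \<le> J (\<lambda>z. r / 2 * (F z)\<^sup>2 + 1 / (2 * r) * (G z)\<^sup>2)"
    using assms by (intro J_mono BM_mult BM_add BM_power BM_const)
  also have "\<dots> = r / 2 * J (\<lambda>z. (F z)\<^sup>2) + 1 / (2 * r) * J (\<lambda>z. (G z)\<^sup>2)"
    using assms by (subst J_add) (auto simp only: J_cmult intro!: BM_mult BM_power BM_const)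
  finally show ?thesis .
qed

section \<open>Exchange of coordinates and iterated integrals\<close>

definition swap :: "(real \<times> real \<Rightarrow> real) \<Rightarrow> real \<times> real \<Rightarrow> real" where
  "swap F z = F (snd z, fst z)"

lemma swap_swap [simp]: "swap (swap F) = F" by (auto simp: swap_def)

lemma swap_pair [simp]: "swap F (x, y) = F (y, x)" by (auto simp: swap_def)

lemma swap_mult: "swap (\<lambda>z. F z * G z) = (\<lambda>z. swap F z * swap G z)"
  by (auto simp: swap_def)

lemma J_lborel:
  assumes "BM F"
  shows "J F = (LINT z|lborel. indicator Omega z * F z)"
  using assms unfolding J_def BM_def
  by (subst integral_restrict_space) (auto simp: integral_completion)

lemma BM_integrable_lborel:
  assumes "BM F"
  shows "integrable lborel (\<lambda>z. indicator Omega z * F z)"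
proof -
  have "integrable lebesgue (\<lambda>z. indicator Omega z *\<^sub>R F z)"
    using BM_integrable[OF assms] by (subst (asm) integrable_restrict_space) auto
  then show ?thesis using assms unfolding BM_def by (subst (asm) integrable_completion) auto
qed

lemma BM_swap [intro]:
  assumes "BM F"
  shows "BM (swap F)"
proof -
  have "(\<lambda>z. indicator Omega (snd z, fst z) * F (snd z, fst z)) \<in> borel_measurable borel"
    using assms unfolding BM_def
    by (intro measurable_compose[of "\<lambda>z. (snd z, fst z)" borel borel "\<lambda>z. indicator Omega z * F z"])
       (auto intro!: borel_measurable_continuous_onI continuous_intros)
  moreover have "(\<lambda>z. indicator Omega (snd z, fst z) * F (snd z, fst z)) = (\<lambda>z. indicator Omega z * swap F z)"
    by (auto simp: swap_def indicator_def)
  moreover from assms obtain K where "\<forall>z\<in>Omega. \<bar>F z\<bar> \<le> K"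
    by (auto simp: BM_def)
  then have "\<forall>z\<in>Omega. \<bar>swap F z\<bar> \<le> K" by (auto simp: Omega_def)
  ultimately show ?thesis
    unfolding BM_def by auto
qed

text \<open>The square is symmetric in the diagonal, so an integral identity in one variable yields
  its counterpart in the other through \<open>swap\<close>; most facts are therefore proved in one
  variable only.\<close>

lemma J_swap:
  assumes "BM F"
  shows "J (swap F) = J F"
proof -
  let ?f = "\<lambda>z. indicator Omega z * F z"
  have m: "?f \<in> borel_measurable (lborel \<Otimes>\<^sub>M lborel)"
    using assms by (simp add: BM_def lborel_prod)
  have "J (swap F) = (LINT z|lborel. indicator Omega z * swap F z)"
    by (rule J_lborel) (use assms in auto)
  also have "(\<lambda>z. indicator Omega z * swap F z) = (\<lambda>(x, y). ?f (y, x))"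
    by (auto simp: indicator_def)
  also have "(LINT z|lborel. (\<lambda>(x, y). ?f (y, x)) z) = integral\<^sup>L (lborel \<Otimes>\<^sub>M lborel) ?f"
    using lborel_pair.integral_product_swap[OF m] by (simp only: lborel_prod)
  also have "\<dots> = J F" using assms by (simp add: lborel_prod J_lborel)
  finally show ?thesis .
qed

text \<open>Fubini in the form used throughout: a sign of the line integrals passes to
  \<open>J\<close>. The lines carry gauge integrals (\<open>has_integral\<close>), so that the
  fundamental theorem of calculus can supply \<open>i\<close>; equalities and upper bounds for
  \<open>J\<close> come from applying this to differences.\<close>

lemma J_nonneg_y:
  assumes F: "BM F"
    and i: "\<And>x. \<bar>x\<bar> < 1 \<Longrightarrow> \<exists>i\<ge>0. ((\<lambda>y. F (x, y)) has_integral i) {-1..1}"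
  shows "0 \<le> J F"
proof -
  let ?f = "\<lambda>z. indicator Omega z * F z"
  have "J F = integral\<^sup>L (lborel \<Otimes>\<^sub>M lborel) ?f"
    using F by (simp add: J_lborel lborel_prod)
  also have "\<dots> = (LINT x|lborel. LINT y|lborel. ?f (x, y))"
    using BM_integrable_lborel[OF F]
    by (intro lborel_pair.integral_fst'[symmetric]) (simp add: lborel_prod)
  also have "\<dots> \<ge> 0"
  proof (rule integral_nonneg_AE, rule AE_I2)
    fix x :: real
    show "0 \<le> (LINT y|lborel. ?f (x, y))"
    proof (cases "\<bar>x\<bar> < 1")
      case False
      then have "(x, y) \<notin> Omega" for y by (simp add: abs_less_iff)
      then have "(\<lambda>y. ?f (x, y)) = (\<lambda>y. 0)" by simp
      then show ?thesis by simp
    next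
      case True
      from F obtain K where K: "\<forall>z\<in>Omega. \<bar>F z\<bar> \<le> K"
        by (auto simp: BM_def)
      have "?f \<in> borel_measurable borel" using F by (simp add: BM_def)
      then have m: "(\<lambda>y. ?f (x, y)) \<in> borel_measurable borel"
        by (intro measurable_compose[of "\<lambda>y. (x, y)" borel borel ?f])
           (auto intro!: borel_measurable_continuous_onI continuous_intros)
      \<comment> \<open>A bounded measurable slice is Lebesgue integrable, so its Lebesgue integral
        is also its gauge integral and equals the given \<open>i\<close> by uniqueness.\<close>
      have "integrable lborel (\<lambda>y. indicator {-1<..<1} y *\<^sub>R ?f (x, y))"
      proof (rule integrableI_bounded_set_indicator)
        show "(\<lambda>y. ?f (x, y)) \<in> borel_measurable lborel" using m by simp
        show "AE y in lborel. y \<in> {-1<..<1} \<longrightarrow> norm (?f (x, y)) \<le> K"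
          using K True by (intro AE_I2) (simp add: abs_less_iff)
      qed auto
      moreover have "(\<lambda>y. indicator {-1<..<1} y *\<^sub>R ?f (x, y)) = (\<lambda>y. ?f (x, y))"
        by (auto simp: indicator_def)
      ultimately have "integrable lborel (\<lambda>y. ?f (x, y))" by simp
      then have 1: "((\<lambda>y. ?f (x, y)) has_integral (LINT y|lborel. ?f (x, y))) UNIV"
        by (rule has_integral_integral_lborel)
      obtain i where "i \<ge> 0" and "((\<lambda>y. F (x, y)) has_integral i) {-1..1}"
        using i[OF True] by auto
      then have "((\<lambda>y. F (x, y)) has_integral i) {-1<..<1}"
        by (simp add: has_integral_Icc_iff_Ioo)
      then have "((\<lambda>y. if y \<in> {-1<..<1} then F (x, y) else 0) has_integral i) UNIV"
        by (simp only: has_integral_restrict_UNIV)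
      moreover have "(\<lambda>y. if y \<in> {-1<..<1} then F (x, y) else 0) = (\<lambda>y. ?f (x, y))"
        using True by (auto simp: indicator_def abs_less_iff fun_eq_iff)
      ultimately have "((\<lambda>y. ?f (x, y)) has_integral i) UNIV" by (simp only:)
      with 1 have "(LINT y|lborel. ?f (x, y)) = i" by (rule has_integral_unique)
      with \<open>i \<ge> 0\<close> show ?thesis by (simp only:)
    qed
  qed
  finally show ?thesis .
qed

lemma J_nonneg_x:
  assumes F: "BM F"
    and i: "\<And>y. \<bar>y\<bar> < 1 \<Longrightarrow> \<exists>i\<ge>0. ((\<lambda>x. F (x, y)) has_integral i) {-1..1}"
  shows "0 \<le> J F" using J_nonneg_y[of "swap F"] assms by (auto simp: J_swap)

lemma J_zero_x:
  assumes F: "BM F"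
    and i: "\<And>y. \<bar>y\<bar> < 1 \<Longrightarrow> ((\<lambda>x. F (x, y)) has_integral 0) {-1..1}"
  shows "J F = 0"
proof (rule antisym)
  have "0 \<le> J (\<lambda>z. - F z)"
    using F has_integral_neg[OF i] by (intro J_nonneg_x) (auto intro!: exI[of _ 0])
  then show "J F \<le> 0" by (simp add: J_uminus)
  show "0 \<le> J F" using assms by (intro J_nonneg_x) (auto intro!: exI[of _ 0])
qed

text \<open>\<open>A\<close> and \<open>B\<close> bound the mean values of the factors over an
  interval of length 2, and 4 is the area of the square. The integration is done in \<open>x\<close>
  first, where the sign of \<open>\<psi>\<close> matters, and then in \<open>y\<close>, where the
  sign of \<open>A\<close> does.\<close>

lemma J_product_le:
  assumes \<phi>: "BM (\<lambda>z. \<phi> (fst z))" and \<psi>: "BM (\<lambda>z. \<psi> (snd z))"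
    and nonneg: "\<And>t. \<bar>t\<bar> < 1 \<Longrightarrow> 0 \<le> \<psi> t" "0 \<le> A"
    and int: "(\<phi> has_integral i) {-1..1}" "i \<le> 2 * A" "(\<psi> has_integral j) {-1..1}" "j \<le> 2 * B"
  shows "J (\<lambda>z. \<phi> (fst z) * \<psi> (snd z)) \<le> 4 * A * B"
proof -
  have bm: "BM (\<lambda>z. \<phi> (fst z) * \<psi> (snd z))" "BM (\<lambda>z. A * \<psi> (snd z))"
    using \<phi> \<psi> by auto
  have "0 \<le> J (\<lambda>z. A * \<psi> (snd z) - \<phi> (fst z) * \<psi> (snd z))"
  proof (rule J_nonneg_x)
    show "BM (\<lambda>z. A * \<psi> (snd z) - \<phi> (fst z) * \<psi> (snd z))"
      using bm by (rule BM_diff[rotated])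
    fix y :: real assume "\<bar>y\<bar> < 1"
    have "((\<lambda>x::real. A) has_integral 2 * A) {-1..1}"
      using has_integral_const_real[of A "-1" 1] by simp
    from has_integral_mult_left[OF has_integral_diff[OF this int(1)], of "\<psi> y"]
    have "((\<lambda>x. A * \<psi> y - \<phi> x * \<psi> y) has_integral (2 * A - i) * \<psi> y) {-1..1}"
      by (simp add: algebra_simps)
    moreover have "0 \<le> (2 * A - i) * \<psi> y"
      using nonneg \<open>\<bar>y\<bar> < 1\<close> int by simp
    ultimately show "\<exists>i\<ge>0. ((\<lambda>x. A * \<psi> (snd (x, y)) - \<phi> (fst (x, y)) * \<psi> (snd (x, y))) has_integral i) {-1..1}"
      by auto
  qed
  then have "J (\<lambda>z. \<phi> (fst z) * \<psi> (snd z)) \<le> A * J (\<lambda>z. \<psi> (snd z))"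
    using bm by (simp add: J_diff J_cmult)
  moreover have "0 \<le> J (\<lambda>z. B - \<psi> (snd z))"
  proof (rule J_nonneg_y)
    show "BM (\<lambda>z. B - \<psi> (snd z))" using \<psi> by auto
    have "((\<lambda>x::real. B) has_integral 2 * B) {-1..1}"
      using has_integral_const_real[of B "-1" 1] by simp
    from has_integral_diff[OF this int(3)] int(4)
    show "\<exists>i\<ge>0. ((\<lambda>y. B - \<psi> (snd (x, y))) has_integral i) {-1..1}" for x :: real
      by (intro exI[of _ "2 * B - j"]) auto
  qed
  then have "J (\<lambda>z. \<psi> (snd z)) \<le> 4 * B" using \<psi> by (simp add: J_diff J_const)
  then have "A * J (\<lambda>z. \<psi> (snd z)) \<le> A * (4 * B)"
    using nonneg by (intro mult_left_mono)
  ultimately show ?thesis by simp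
qed


section \<open>Piecewise differentiable functions\<close>

text \<open>One notion covers continuously differentiable functions (\<open>S\<close> empty) and
  finite element functions (kinks on the vertical mesh lines, the same for every \<open>y\<close>).
  Continuity across the exceptional points is what allows integration by parts over a whole line
  without jump terms.\<close>

definition X1 :: "(real \<times> real \<Rightarrow> real) \<Rightarrow> (real \<times> real \<Rightarrow> real) \<Rightarrow> bool" where
  "X1 g g' \<longleftrightarrow> BM g \<and> BM g' \<and> (\<exists>S. finite S \<and> (\<forall>y. \<bar>y\<bar> < 1 \<longrightarrow>
     continuous_on {-1..1} (\<lambda>x. g (x, y)) \<and>
     (\<forall>x\<in>{-1<..<1} - S. ((\<lambda>x. g (x, y)) has_real_derivative g' (x, y)) (at x))))"

definition Y1 :: "(real \<times> real \<Rightarrow> real) \<Rightarrow> (real \<times> real \<Rightarrow> real) \<Rightarrow> bool" where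
  "Y1 g g' \<longleftrightarrow> X1 (swap g) (swap g')"

lemma X1_BM: "X1 g g' \<Longrightarrow> BM g" "X1 g g' \<Longrightarrow> BM g'"
  by (auto simp: X1_def)

lemma Y1_BM: "Y1 g g' \<Longrightarrow> BM g" "Y1 g g' \<Longrightarrow> BM g'"
  unfolding Y1_def using X1_BM BM_swap swap_swap by metis+

lemma X1_mult:
  assumes "X1 g g'" "X1 h h'"
  shows "X1 (\<lambda>z. g z * h z) (\<lambda>z. g' z * h z + g z * h' z)"
proof -
  obtain S where S: "finite S" "\<And>y. \<bar>y\<bar> < 1 \<Longrightarrow> continuous_on {-1..1} (\<lambda>x. g (x, y))"
    "\<And>x y. \<bar>y\<bar> < 1 \<Longrightarrow> x\<in>{-1<..<1} - S \<Longrightarrow> ((\<lambda>x. g (x, y)) has_real_derivative g' (x, y)) (at x)"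
    using assms(1) by (auto simp: X1_def)
  obtain T where T: "finite T" "\<And>y. \<bar>y\<bar> < 1 \<Longrightarrow> continuous_on {-1..1} (\<lambda>x. h (x, y))"
    "\<And>x y. \<bar>y\<bar> < 1 \<Longrightarrow> x\<in>{-1<..<1} - T \<Longrightarrow> ((\<lambda>x. h (x, y)) has_real_derivative h' (x, y)) (at x)"
    using assms(2) by (auto simp: X1_def)
  have "BM (\<lambda>z. g z * h z)" "BM (\<lambda>z. g' z * h z + g z * h' z)"
    using X1_BM[OF assms(1)] X1_BM[OF assms(2)] by - (intro BM_add BM_mult; assumption)+
  moreover have "\<forall>y. \<bar>y\<bar> < 1 \<longrightarrow>
     continuous_on {-1..1} (\<lambda>x. g (x, y) * h (x, y)) \<and>
     (\<forall>x\<in>{-1<..<1} - (S \<union> T). ((\<lambda>x. g (x, y) * h (x, y)) has_real_derivative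
        g' (x, y) * h (x, y) + g (x, y) * h' (x, y)) (at x))"
  proof (intro allI impI conjI ballI)
    fix y :: real assume y: "\<bar>y\<bar> < 1"
    show "continuous_on {-1..1} (\<lambda>x. g (x, y) * h (x, y))"
      using S(2) T(2) y by (intro continuous_on_mult)
    fix x assume "x \<in> {-1<..<1} - (S \<union> T)"
    then show "((\<lambda>x. g (x, y) * h (x, y)) has_real_derivative
        g' (x, y) * h (x, y) + g (x, y) * h' (x, y)) (at x)"
      using DERIV_mult[OF S(3)[OF y, of x] T(3)[OF y, of x]] by (simp add: mult.commute)
  qed
  ultimately show ?thesis
    unfolding X1_def using S(1) T(1) by (intro conjI exI[of _ "S \<union> T"]) auto
qed

lemma X1_J_zero:
  assumes "X1 G F" and "\<And>y. \<bar>y\<bar> < 1 \<Longrightarrow> G (-1, y) = 0 \<and> G (1, y) = 0"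
  shows "J F = 0"
proof (rule J_zero_x)
  show "BM F" using assms X1_BM by blast
  fix y :: real assume y: "\<bar>y\<bar> < 1"
  obtain S where S: "finite S" "continuous_on {-1..1} (\<lambda>x. G (x, y))"
    "\<And>x. x\<in>{-1<..<1} - S \<Longrightarrow> ((\<lambda>x. G (x, y)) has_real_derivative F (x, y)) (at x)"
    using assms(1) y by (auto simp: X1_def)
  have "((\<lambda>x. F (x, y)) has_integral G (1, y) - G (-1, y)) {-1..1}"
    by (rule fundamental_theorem_of_calculus_interior_strong[OF S(1)])
       (use S in \<open>auto simp: has_real_derivative_iff_has_vector_derivative\<close>)
  then show "((\<lambda>x. F (x, y)) has_integral 0) {-1..1}" using assms(2)[OF y] by simp
qed

lemma X1_parts:
  assumes "X1 g g'" "X1 h h'"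
    and "\<And>y. \<bar>y\<bar> < 1 \<Longrightarrow> g (-1, y) * h (-1, y) = 0 \<and> g (1, y) * h (1, y) = 0"
  shows "J (\<lambda>z. g' z * h z) = - J (\<lambda>z. g z * h' z)"
proof -
  have "J (\<lambda>z. g' z * h z + g z * h' z) = 0"
    by (rule X1_J_zero[OF X1_mult[OF assms(1,2)]]) (use assms(3) in auto)
  moreover have "BM (\<lambda>z. g' z * h z)" "BM (\<lambda>z. g z * h' z)"
    using assms X1_BM by blast+
  ultimately show ?thesis by (simp add: J_add)
qed

lemma Y1_parts:
  assumes "Y1 g g'" "Y1 h h'"
    and "\<And>x. \<bar>x\<bar> < 1 \<Longrightarrow> g (x, -1) * h (x, -1) = 0 \<and> g (x, 1) * h (x, 1) = 0"
  shows "J (\<lambda>z. g' z * h z) = - J (\<lambda>z. g z * h' z)"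
proof -
  have "J (swap (\<lambda>z. g' z * h z)) = - J (swap (\<lambda>z. g z * h' z))"
    unfolding swap_mult using assms unfolding Y1_def by (intro X1_parts) auto
  moreover have "BM (\<lambda>z. g' z * h z)" "BM (\<lambda>z. g z * h' z)"
    using assms Y1_BM by blast+
  ultimately show ?thesis by (simp add: J_swap)
qed


section \<open>Classical derivatives on the closed square\<close>

text \<open>The derivative is taken within the closed interval, so it sees nothing outside the
  closed square. This matters because the decomposition of \<open>u\<close> is only known
  there.\<close>

lemma pdx_cong:
  assumes "\<And>z. z \<in> Omega_bar \<Longrightarrow> g z = h z" "z \<in> Omega_bar"
  shows "pdx g z = pdx h z"
proof -
  have *: "((\<lambda>t. k (t, snd z)) has_vector_derivative d) (at (fst z) within {-1..1})"
    if "((\<lambda>t. l (t, snd z)) has_vector_derivative d) (at (fst z) within {-1..1})"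
      and "\<And>z. z \<in> Omega_bar \<Longrightarrow> k z = l z" for k l :: "real \<times> real \<Rightarrow> real" and d
    using assms(2) that by (intro has_vector_derivative_transform[OF _ _ that(1)]) auto
  have "((\<lambda>t. g (t, snd z)) has_vector_derivative d) (at (fst z) within {-1..1}) \<longleftrightarrow>
      ((\<lambda>t. h (t, snd z)) has_vector_derivative d) (at (fst z) within {-1..1})" for d
    using *[of h d g] *[of g d h] assms(1) by metis
  then show ?thesis by (simp add: pdx_def vector_derivative_def)
qed

lemma pdx_swap: "pdx (swap g) = swap (pdy g)" by (auto simp: pdx_def pdy_def swap_def)

lemma pdy_swap: "pdy (swap g) = swap (pdx g)" by (auto simp: pdx_def pdy_def swap_def)

lemma pdy_cong:
  assumes "\<And>z. z \<in> Omega_bar \<Longrightarrow> g z = h z" "z \<in> Omega_bar"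
  shows "pdy g z = pdy h z"
proof -
  have "pdx (swap g) (snd z, fst z) = pdx (swap h) (snd z, fst z)"
    by (rule pdx_cong) (use assms in \<open>auto simp: swap_def\<close>)
  then show ?thesis by (simp add: pdx_swap)
qed

lemma C_k_cong:
  assumes "C_k k g" "\<And>z. z \<in> Omega_bar \<Longrightarrow> g z = h z"
  shows "C_k k h"
  using assms
proof (induction k arbitrary: g h)
  case 0
  then show ?case using continuous_on_cong[OF refl, of Omega_bar g h] by (simp del: mem_Times_iff)
next
  case (Suc k)
  have "continuous_on Omega_bar h"
    using Suc.prems continuous_on_cong[OF refl, of Omega_bar g h] by (simp del: mem_Times_iff)
  moreover have "(\<lambda>t. h (t, y)) differentiable (at x within {-1..1})"
      "(\<lambda>t. h (x, t)) differentiable (at y within {-1..1})"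
    if xy: "x \<in> {-1..1}" "y \<in> {-1..1}" for x y
  proof -
    obtain D E where "((\<lambda>t. g (t, y)) has_derivative D) (at x within {-1..1})"
      "((\<lambda>t. g (x, t)) has_derivative E) (at y within {-1..1})"
      using Suc.prems(1) xy unfolding C_k.simps differentiable_def by blast
    then have "((\<lambda>t. h (t, y)) has_derivative D) (at x within {-1..1})"
      "((\<lambda>t. h (x, t)) has_derivative E) (at y within {-1..1})"
      using Suc.prems(2) xy by (auto intro!: has_derivative_transform[of x "{-1..1}" "\<lambda>t. h (t, y)" "\<lambda>t. g (t, y)"]
          has_derivative_transform[of y "{-1..1}" "\<lambda>t. h (x, t)" "\<lambda>t. g (x, t)"])
    then show "(\<lambda>t. h (t, y)) differentiable (at x within {-1..1})"
      "(\<lambda>t. h (x, t)) differentiable (at y within {-1..1})"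
      unfolding differentiable_def by blast+
  qed
  moreover have "C_k k (pdx h)" "C_k k (pdy h)"
    using Suc.IH[of "pdx g" "pdx h"] Suc.IH[of "pdy g" "pdy h"] Suc.prems pdx_cong pdy_cong
    by (metis C_k.simps(2))+
  ultimately show ?case by simp
qed

lemma C_k_continuous: "C_k k g \<Longrightarrow> continuous_on Omega_bar g" by (cases k) auto

lemma C_k_swap: "C_k k g \<Longrightarrow> C_k k (swap g)"
proof (induction k arbitrary: g)
  case 0
  have "continuous_on Omega_bar (\<lambda>z. g (snd z, fst z))"
    by (rule continuous_on_compose2[of Omega_bar g])
       (use 0 in \<open>auto intro!: continuous_intros\<close>)
  then show ?case by (simp add: swap_def)
next
  case (Suc k)
  have "continuous_on Omega_bar (\<lambda>z. g (snd z, fst z))"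
    by (rule continuous_on_compose2[of Omega_bar g])
       (use Suc.prems in \<open>auto intro!: continuous_intros\<close>)
  then have "continuous_on Omega_bar (swap g)" by (simp add: swap_def)
  then show ?case using Suc by (auto simp: pdx_swap pdy_swap)
qed

lemma pdx_deriv:
  assumes "C_k (Suc k) g" "x \<in> {-1..1}" "y \<in> {-1..1}"
  shows "((\<lambda>t. g (t, y)) has_real_derivative pdx g (x, y)) (at x within {-1..1})"
proof -
  have "(\<lambda>t. g (t, y)) differentiable (at x within {-1..1})" using assms by auto
  then show ?thesis
    by (simp add: pdx_def has_real_derivative_iff_has_vector_derivative vector_derivative_works)
qed

lemma pdy_deriv:
  assumes "C_k (Suc k) g" "x \<in> {-1..1}" "y \<in> {-1..1}"
  shows "((\<lambda>t. g (x, t)) has_real_derivative pdy g (x, y)) (at y within {-1..1})"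
  using pdx_deriv[OF C_k_swap[OF assms(1)] assms(3,2)] by (simp add: pdx_swap)

lemma pdx_eqI:
  assumes "((\<lambda>t. g (t, y)) has_real_derivative d) (at x within {-1..1})" "x \<in> {-1..1}"
  shows "pdx g (x, y) = d"
  using assms unfolding pdx_def
  by (auto intro!: vector_derivative_within_closed_interval
      simp: has_real_derivative_iff_has_vector_derivative)

lemma pdy_eqI:
  assumes "((\<lambda>t. g (x, t)) has_real_derivative d) (at y within {-1..1})" "y \<in> {-1..1}"
  shows "pdy g (x, y) = d" using pdx_eqI[of "swap g" x d y] assms by (simp add: pdx_swap)

lemma pdx_lin:
  assumes "C_k (Suc k) g" "C_k (Suc k) h" "z \<in> Omega_bar"
  shows "pdx (\<lambda>z. r * g z + s * h z) z = r * pdx g z + s * pdx h z"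
proof -
  obtain x y where z: "z = (x, y)" "x \<in> {-1..1}" "y \<in> {-1..1}"
    using assms(3) by (cases z) auto
  show ?thesis
    unfolding z(1)
    by (rule pdx_eqI) (use assms z in \<open>auto intro!: derivative_eq_intros pdx_deriv simp del: C_k.simps\<close>)
qed

lemma pdy_lin:
  assumes "C_k (Suc k) g" "C_k (Suc k) h" "z \<in> Omega_bar"
  shows "pdy (\<lambda>z. r * g z + s * h z) z = r * pdy g z + s * pdy h z"
proof -
  obtain x y where z: "z = (x, y)" "x \<in> {-1..1}" "y \<in> {-1..1}"
    using assms(3) by (cases z) auto
  show ?thesis
    unfolding z(1)
    by (rule pdy_eqI) (use assms z in \<open>auto intro!: derivative_eq_intros pdy_deriv simp del: C_k.simps\<close>)
qed

lemma C_k_lin: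
  assumes "C_k k g" "C_k k h"
  shows "C_k k (\<lambda>z. r * g z + s * h z)"
  using assms
proof (induction k arbitrary: g h)
  case 0
  then show ?case by (auto intro!: continuous_intros)
next
  case (Suc k)
  have "continuous_on Omega_bar (\<lambda>z. r * g z + s * h z)"
    using Suc.prems[THEN C_k_continuous] by (auto intro!: continuous_intros)
  moreover have "(\<lambda>t. r * g (t, y) + s * h (t, y)) differentiable (at x within {-1..1})"
      "(\<lambda>t. r * g (x, t) + s * h (x, t)) differentiable (at y within {-1..1})"
    if "x \<in> {-1..1}" "y \<in> {-1..1}" for x y
    using that Suc.prems by (auto intro!: derivative_intros)
  moreover have "C_k k (pdx (\<lambda>z. r * g z + s * h z))"
    by (rule C_k_cong[OF Suc.IH[of "pdx g" "pdx h"]])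
       (use Suc.prems pdx_lin[OF Suc.prems] in auto)
  moreover have "C_k k (pdy (\<lambda>z. r * g z + s * h z))"
    by (rule C_k_cong[OF Suc.IH[of "pdy g" "pdy h"]])
       (use Suc.prems pdy_lin[OF Suc.prems] in auto)
  ultimately show ?case by simp
qed

lemma X1_C_k:
  assumes "C_k (Suc k) g"
  shows "X1 g (pdx g)"
proof -
  have "continuous_on {-1..1} (\<lambda>x. g (x, y))" if "\<bar>y\<bar> < 1" for y
    by (rule continuous_on_compose2[OF C_k_continuous[OF assms], of "{-1..1}" "\<lambda>x. (x, y)"])
       (use that in \<open>auto intro!: continuous_intros simp: abs_less_iff\<close>)
  moreover have "((\<lambda>x. g (x, y)) has_real_derivative pdx g (x, y)) (at x)"
    if "\<bar>y\<bar> < 1" "x \<in> {-1<..<1}" for x y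
    using pdx_deriv[OF assms, of x y] that by (simp add: at_within_Icc_at abs_less_iff)
  moreover have "BM g" by (rule BM_continuous[OF C_k_continuous[OF assms]])
  moreover have "BM (pdx g)" using assms by (intro BM_continuous[OF C_k_continuous[of k]]) simp
  ultimately show ?thesis
    unfolding X1_def by (intro conjI exI[of _ "{}"]) auto
qed

lemma Y1_C_k:
  assumes "C_k (Suc k) g"
  shows "Y1 g (pdy g)" using X1_C_k[OF C_k_swap[OF assms]] by (simp add: Y1_def pdx_swap)


section \<open>Test functions\<close>

text \<open>The class of \<open>k\<close> times continuously differentiable functions on the whole
  line, so that each closure property is an induction on \<open>k\<close>; smoothness proper is
  \<open>smooth k\<close> for every \<open>k\<close>.\<close>

primrec smooth :: "nat \<Rightarrow> (real \<Rightarrow> real) \<Rightarrow> bool" where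
  "smooth 0 f \<longleftrightarrow> continuous_on UNIV f"
| "smooth (Suc k) f \<longleftrightarrow> (\<exists>f'. (\<forall>t. (f has_real_derivative f' t) (at t)) \<and> smooth k f')"

lemma smooth_continuous: "smooth k f \<Longrightarrow> continuous_on UNIV f"
  by (cases k) (auto intro!: continuous_at_imp_continuous_on intro: DERIV_isCont)

lemma smooth_Suc_D: "smooth (Suc k) f \<Longrightarrow> smooth k f"
proof (induction k arbitrary: f)
  case 0
  then show ?case using smooth_continuous by (simp del: smooth.simps(2))
next
  case (Suc k)
  from Suc.prems obtain f' where "\<forall>t. (f has_real_derivative f' t) (at t)" "smooth (Suc k) f'"
    by (subst (asm) smooth.simps) blast
  then show ?case using Suc.IH by (subst smooth.simps) blast
qed

lemma smooth_add: "smooth k f \<Longrightarrow> smooth k g \<Longrightarrow> smooth k (\<lambda>t. f t + g t)"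
proof (induction k arbitrary: f g)
  case (Suc k)
  then obtain f' g' where "\<forall>t. (f has_real_derivative f' t) (at t)" "smooth k f'"
    "\<forall>t. (g has_real_derivative g' t) (at t)" "smooth k g'" by auto
  then show ?case
    using Suc.IH[of f' g'] by (auto intro!: exI[of _ "\<lambda>t. f' t + g' t"] derivative_eq_intros)
qed (auto intro!: continuous_intros)

lemma smooth_mult: "smooth k f \<Longrightarrow> smooth k g \<Longrightarrow> smooth k (\<lambda>t. f t * g t)"
proof (induction k arbitrary: f g)
  case (Suc k)
  then obtain f' g' where *: "\<forall>t. (f has_real_derivative f' t) (at t)" "smooth k f'"
    "\<forall>t. (g has_real_derivative g' t) (at t)" "smooth k g'" by auto
  have "smooth k f" "smooth k g"
    using Suc.prems by (auto intro: smooth_Suc_D simp del: smooth.simps)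
  then have "smooth k (\<lambda>t. f' t * g t + g' t * f t)" using * by (intro smooth_add Suc.IH)
  moreover have "\<forall>t. ((\<lambda>t. f t * g t) has_real_derivative f' t * g t + g' t * f t) (at t)"
    using * by (auto intro!: DERIV_mult)
  ultimately show ?case by auto
qed (auto intro!: continuous_intros)

lemma smooth_const: "smooth k (\<lambda>t. r)"
proof (induction k arbitrary: r)
  case (Suc k)
  show ?case using Suc[of 0] by (auto intro!: exI[of _ "\<lambda>t. 0"])
qed auto

lemma smooth_affine: "smooth k f \<Longrightarrow> smooth k (\<lambda>t. f (r * t + s))"
proof (induction k arbitrary: f)
  case 0
  then show ?case by (auto intro!: continuous_intros continuous_on_compose2[of UNIV f])
next
  case (Suc k)
  then obtain f' where *: "\<forall>t. (f has_real_derivative f' t) (at t)" "smooth k f'" by auto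
  have "((\<lambda>t. f (r * t + s)) has_real_derivative f' (r * t + s) * r) (at t)" for t
    by (rule DERIV_chain2[of f]) (use * in \<open>auto intro!: derivative_eq_intros\<close>)
  moreover have "smooth k (\<lambda>t. f' (r * t + s) * r)"
    using Suc.IH[OF *(2)] by (intro smooth_mult smooth_const)
  ultimately show ?case by (auto intro!: exI[of _ "\<lambda>t. f' (r * t + s) * r"])
qed

lemma C_k_tensor:
  assumes "smooth k A" "smooth k B"
  shows "C_k k (\<lambda>z. A (fst z) * B (snd z))"
  using assms
proof (induction k arbitrary: A B)
  case 0
  then show ?case
    by (auto intro!: continuous_intros continuous_on_compose2[of UNIV A] continuous_on_compose2[of UNIV B])
next
  case (Suc k)
  then obtain A' B' where *: "\<And>t. (A has_real_derivative A' t) (at t)" "smooth k A'"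
    "\<And>t. (B has_real_derivative B' t) (at t)" "smooth k B'" by auto
  let ?g = "\<lambda>z. A (fst z) * B (snd z)"
  have dx: "((\<lambda>t. ?g (t, y)) has_real_derivative A' x * B y) (at x within S)" for x y S
    using DERIV_cmult_right[OF has_field_derivative_at_within[OF *(1)], of "B y"] by simp
  have dy: "((\<lambda>t. ?g (x, t)) has_real_derivative A x * B' y) (at y within S)" for x y S
    using DERIV_cmult[OF has_field_derivative_at_within[OF *(3)], of "A x"] by simp
  have "continuous_on Omega_bar ?g"
    using Suc.prems[THEN smooth_continuous]
    by (auto intro!: continuous_intros continuous_on_compose2[of UNIV A] continuous_on_compose2[of UNIV B])
  moreover have "C_k k (pdx ?g)"
  proof (rule C_k_cong[OF Suc.IH[of A' B]])
    show "smooth k A'" "smooth k B" using * Suc.prems smooth_Suc_D by blast+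
    show "A' (fst z) * B (snd z) = pdx ?g z" if "z \<in> Omega_bar" for z
      using pdx_eqI[OF dx] that by (cases z) auto
  qed
  moreover have "C_k k (pdy ?g)"
  proof (rule C_k_cong[OF Suc.IH[of A B']])
    show "smooth k B'" "smooth k A" using * Suc.prems smooth_Suc_D by blast+
    show "A (fst z) * B' (snd z) = pdy ?g z" if "z \<in> Omega_bar" for z
      using pdy_eqI[OF dy] that by (cases z) auto
  qed
  moreover have "(\<lambda>t. ?g (t, y)) differentiable (at x within {-1..1})"
     "(\<lambda>t. ?g (x, t)) differentiable (at y within {-1..1})" for x y
    using dx dy real_differentiable_def by blast+
  ultimately show ?case by simp
qed

text \<open>The functions \<open>p(1/t) e\<^sup>-\<^sup>1\<^sup>/\<^sup>t\<close>, extended by \<open>0\<close>, with a polynomial \<open>p\<close>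
  form a class closed under differentiation.\<close>

definition flat :: "real poly \<Rightarrow> real \<Rightarrow> real" where
  "flat p t = (if t \<le> 0 then 0 else poly p (inverse t) * exp (- inverse t))"

lemma poly_exp_tendsto_0: "((\<lambda>s. poly p s * exp (- s)) \<longlongrightarrow> 0) (at_top :: real filter)"
proof -
  have "((\<lambda>s. \<Sum>i\<le>degree p. coeff p i * (s ^ i / exp s)) \<longlongrightarrow> (\<Sum>i\<le>degree p. coeff p i * 0)) (at_top :: real filter)"
    by (intro tendsto_sum tendsto_mult tendsto_const tendsto_power_div_exp_0)
  then show ?thesis
    by (simp add: poly_altdef sum_divide_distrib exp_minus divide_inverse[symmetric])
qed

text \<open>With s = 1/t one has d/dt = -s^2 d/ds, and p(s) e^(-s) has the derivative (p' - p)(s)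
  e^(-s); hence the new polynomial s^2 (p - p'). At t = 0 both one-sided difference quotients tend
  to 0.\<close>

lemma flat_deriv: "(flat p has_real_derivative flat ([:0, 0, 1:] * (p - pderiv p)) t) (at t)"
proof -
  consider "t < 0" | "t = 0" | "t > 0" by linarith
  then show ?thesis
  proof cases
    case 1
    have "((\<lambda>t. 0) has_real_derivative 0) (at t)" by simp
    then have "(flat p has_real_derivative 0) (at t)"
      by (rule has_field_derivative_transform_within_open[of _ _ _ "{..<0}"])
         (use 1 in \<open>auto simp: flat_def\<close>)
    then show ?thesis using 1 by (simp add: flat_def)
  next
    case 2
    have "((\<lambda>h. flat p h / h) \<longlongrightarrow> 0) (at_left 0)"
      by (rule tendsto_eventually) (auto simp: flat_def eventually_at_filter)
    moreover have "((\<lambda>h. flat p h / h) \<longlongrightarrow> 0) (at_right 0)"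
      unfolding filterlim_at_right_to_top
    proof (rule Lim_transform_eventually)
      \<comment> \<open>For h = 1/s > 0 the quotient \<open>flat p h / h\<close> is s p(s) e^(-s),
        and \<open>pCons 0 p\<close> is the polynomial s p(s).\<close>
      show "((\<lambda>s. poly (pCons 0 p) s * exp (- s)) \<longlongrightarrow> 0) (at_top :: real filter)"
        by (rule poly_exp_tendsto_0)
      show "\<forall>\<^sub>F s in at_top. poly (pCons 0 p) s * exp (- s) = flat p (inverse s) / inverse s"
        using eventually_gt_at_top[of "0::real"]
        by eventually_elim (simp add: flat_def divide_inverse)
    qed
    ultimately have "((\<lambda>h. flat p h / h) \<longlongrightarrow> 0) (at 0)"
      by (rule filterlim_split_at)
    then show ?thesis using 2 by (simp add: DERIV_def flat_def)
  next
    case 3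
    have "((\<lambda>t. poly p (inverse t) * exp (- inverse t)) has_real_derivative
        flat ([:0, 0, 1:] * (p - pderiv p)) t) (at t)"
      using 3 by (auto intro!: derivative_eq_intros DERIV_chain2[OF poly_DERIV]
          simp: flat_def power2_eq_square algebra_simps)
    then show ?thesis by (rule has_field_derivative_transform_within_open[of _ _ _ "{0<..}"])
         (use 3 in \<open>auto simp: flat_def\<close>)
  qed
qed

lemma smooth_flat: "smooth k (flat p)"
proof (induction k arbitrary: p)
  case 0
  have "continuous_on UNIV (flat p)" using flat_deriv by (auto intro!: DERIV_continuous_on)
  then show ?case by simp
next
  case (Suc k)
  then show ?case using flat_deriv[of p] by auto
qed

text \<open>The arguments are (n + 1)(t - a) - 1 and (n + 1)(b - t) - 1, expanded to the form
  treated by \<open>smooth_affine\<close>. The support stays 1/(n + 1) away from both ends, hence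
  compact inside the open square even for a = -1 or b = 1.\<close>

definition bump :: "real \<Rightarrow> real \<Rightarrow> nat \<Rightarrow> real \<Rightarrow> real" where
  "bump a b n t = flat 1 (real (Suc n) * t + (- real (Suc n) * a - 1)) *
                  flat 1 (- real (Suc n) * t + (real (Suc n) * b - 1))"

lemma smooth_bump: "smooth k (bump a b n)"
  unfolding bump_def by (intro smooth_mult smooth_affine smooth_flat)

lemma flat_bounds: "0 \<le> flat 1 t" "flat 1 t \<le> 1" by (auto simp: flat_def)

lemma bump_bounds: "0 \<le> bump a b n t" "bump a b n t \<le> 1"
  unfolding bump_def using flat_bounds by (auto intro!: mult_le_one)

lemma bump_eq_0: "t \<notin> {a + inverse (Suc n)..b - inverse (Suc n)} \<Longrightarrow> bump a b n t = 0"
  unfolding bump_def flat_def by (auto simp: field_simps)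

lemma bump_tendsto: "(\<lambda>n. bump a b n t) \<longlonglongrightarrow> indicator {a<..<b} t"
proof (cases "t \<in> {a<..<b}")
  case True
  have *: "(\<lambda>n. flat 1 (real (Suc n) * d - 1)) \<longlonglongrightarrow> 1" if "d > 0" for d
  proof -
    have lim: "filterlim (\<lambda>n. real (Suc n) * d - 1) at_top sequentially"
      using that by real_asymp
    have "(\<lambda>n. exp (- inverse (real (Suc n) * d - 1))) \<longlonglongrightarrow> exp (- 0)"
      by (intro tendsto_intros tendsto_inverse_0_at_top lim)
    moreover have "\<forall>\<^sub>F n in sequentially. exp (- inverse (real (Suc n) * d - 1)) = flat 1 (real (Suc n) * d - 1)"
      using lim[unfolded filterlim_at_top_dense, rule_format, of 0]
      by eventually_elim (simp add: flat_def)
    ultimately show ?thesis using Lim_transform_eventually by force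
  qed
  have "(\<lambda>n. flat 1 (real (Suc n) * (t - a) - 1) * flat 1 (real (Suc n) * (b - t) - 1)) \<longlonglongrightarrow> 1 * 1"
    using True by (intro tendsto_mult *) auto
  moreover have "flat 1 (real (Suc n) * (t - a) - 1) * flat 1 (real (Suc n) * (b - t) - 1) = bump a b n t" for n
    unfolding bump_def by (rule arg_cong2[of _ _ _ _ "(*)"]; rule arg_cong[of _ _ "flat 1"]) (auto simp: algebra_simps)
  ultimately show ?thesis using True by simp
next
  case False
  have "bump a b n t = 0" for n
  proof (rule bump_eq_0)
    have "inverse (real (Suc n)) > 0" by simp
    then show "t \<notin> {a + inverse (Suc n)..b - inverse (Suc n)}"
      using False unfolding atLeastAtMost_iff greaterThanLessThan_iff by linarith
  qed
  then show ?thesis using False by simp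
qed

lemma bump_test_function:
  assumes "-1 \<le> a" "b \<le> 1" "-1 \<le> a'" "b' \<le> 1"
  shows "(\<lambda>z. bump a b n (fst z) * bump a' b' n (snd z)) \<in> test_functions"
proof -
  define i where "i = inverse (real (Suc n))"
  have "i > 0" by (simp add: i_def)
  let ?K = "{a + i..b - i} \<times> {a' + i..b' - i}"
  have "compact ?K" by (intro compact_Times compact_Icc)
  moreover have "?K \<subseteq> Omega"
    using assms \<open>i > 0\<close> unfolding Omega_def by (intro Sigma_mono) auto
  moreover have "\<forall>z. z \<notin> ?K \<longrightarrow> bump a b n (fst z) * bump a' b' n (snd z) = 0"
    using bump_eq_0 unfolding i_def by (metis mem_Times_iff mult_eq_0_iff)
  ultimately show ?thesis
    unfolding test_functions_def by (blast intro: C_k_tensor smooth_bump)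
qed


section \<open>Uniqueness of weak derivatives\<close>

lemma L2_measurable: "g \<in> L2 \<Longrightarrow> g \<in> borel_measurable (lebesgue_on Omega)"
  by (simp add: L2_def)

lemma BM_L2: "BM F \<Longrightarrow> F \<in> L2"
  using BM_measurable BM_integrable[OF BM_power[of F 2]] by (auto simp: L2_def)

lemma L2_integrable:
  assumes "g \<in> L2"
  shows "integrable (lebesgue_on Omega) g"
proof (rule Bochner_Integration.integrable_bound)
  show "integrable (lebesgue_on Omega) (\<lambda>z. 1 + (g z)\<^sup>2)"
    using assms BM_integrable[OF BM_const[of 1]] unfolding L2_def
    by (intro Bochner_Integration.integrable_add) auto
  have "\<bar>t\<bar> \<le> 1 + t\<^sup>2" for t :: real
    using sum_squares_bound[of "\<bar>t\<bar>" 1] by (simp add: power2_eq_square)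
  then show "AE z in lebesgue_on Omega. norm (g z) \<le> norm (1 + (g z)\<^sup>2)"
    by (intro AE_I2) (simp add: abs_of_nonneg)
qed (use assms in \<open>simp add: L2_measurable\<close>)

lemma L2_diff:
  assumes "g \<in> L2" "h \<in> L2"
  shows "(\<lambda>z. g z - h z) \<in> L2"
proof -
  have m: "(\<lambda>z. g z - h z) \<in> borel_measurable (lebesgue_on Omega)"
    using assms by (intro borel_measurable_diff L2_measurable)
  have "integrable (lebesgue_on Omega) (\<lambda>z. (g z - h z)\<^sup>2)"
  proof (rule Bochner_Integration.integrable_bound)
    show "integrable (lebesgue_on Omega) (\<lambda>z. 2 * (g z)\<^sup>2 + 2 * (h z)\<^sup>2)"
      using assms unfolding L2_def by auto
    have "(s - t)\<^sup>2 \<le> 2 * s\<^sup>2 + 2 * t\<^sup>2" for s t :: real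
      using zero_le_power2[of "s + t"] by (simp add: power2_eq_square algebra_simps)
    then show "AE z in lebesgue_on Omega. norm ((g z - h z)\<^sup>2) \<le> norm (2 * (g z)\<^sup>2 + 2 * (h z)\<^sup>2)"
      by (intro AE_I2) simp
  qed (intro borel_measurable_power m)
  with m show ?thesis by (simp add: L2_def)
qed

lemma integrable_mult_BM:
  assumes "integrable (lebesgue_on Omega) g" "BM \<phi>"
  shows "integrable (lebesgue_on Omega) (\<lambda>z. g z * \<phi> z)"
proof -
  obtain K where K: "\<forall>z\<in>Omega. \<bar>\<phi> z\<bar> \<le> K"
    using assms(2) by (auto simp: BM_def)
  show ?thesis
  proof (rule Bochner_Integration.integrable_bound)
    show "integrable (lebesgue_on Omega) (\<lambda>z. K * g z)" using assms by simp
    have "\<bar>g z * \<phi> z\<bar> \<le> \<bar>K * g z\<bar>" if "z \<in> Omega" for z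
      using K that by (auto simp: abs_mult mult.commute[of _ "\<bar>g z\<bar>"] intro!: mult_left_mono)
    then show "AE z in lebesgue_on Omega. norm (g z * \<phi> z) \<le> norm (K * g z)"
      by (intro AE_I2) simp
    show "(\<lambda>z. g z * \<phi> z) \<in> borel_measurable (lebesgue_on Omega)"
      using assms BM_measurable by (intro borel_measurable_times) auto
  qed
qed

lemma test_C_k: "\<phi> \<in> test_functions \<Longrightarrow> C_k k \<phi>"
  by (simp add: test_functions_def)

lemma test_zero: "\<phi> \<in> test_functions \<Longrightarrow> z \<notin> Omega \<Longrightarrow> \<phi> z = 0"
  unfolding test_functions_def by blast

lemma test_BM: "\<phi> \<in> test_functions \<Longrightarrow> BM \<phi>"
  using BM_continuous[OF C_k_continuous] test_C_k by blast

text \<open>The bump functions reduce the claim to open boxes, which generate the Borel sets.\<close>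

lemma L2_test_zero:
  assumes g: "g \<in> L2" and zero: "\<And>\<phi>. \<phi> \<in> test_functions \<Longrightarrow> ip g \<phi> = 0"
  shows "AE z in lebesgue_on Omega. g z = 0"
proof -
  define G where "G = (\<lambda>z. indicator Omega z * g z)"
  have "integrable lebesgue (\<lambda>z. indicator Omega z *\<^sub>R g z)"
    using L2_integrable[OF g] by (subst (asm) integrable_restrict_space) auto
  then have G: "integrable lebesgue G" by (simp add: G_def)
  \<comment> \<open>\<open>g\<close> is merely Lebesgue measurable, while the argument with
    generating boxes runs over Borel sets; hence the passage to a Borel representative, cut off
    outside \<open>Omega\<close> as \<open>H\<close>.\<close>
  then obtain G' where G': "G' \<in> borel_measurable lborel" "AE z in lborel. G z = G' z"
    using completion_ex_borel_measurable_real[of G lborel] by auto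
  define H where "H = (\<lambda>z. indicator Omega z * G' z)"
  have H_meas [measurable]: "H \<in> borel_measurable borel"
    using G'(1) unfolding H_def by (intro borel_measurable_times borel_measurable_indicator) auto
  then have H_leb: "H \<in> borel_measurable lebesgue" by (auto intro: measurable_completion)
  have "AE z in lborel. G z = H z"
    using G'(2) by eventually_elim (auto simp: G_def H_def indicator_def)
  then have GH: "AE z in lebesgue. G z = H z" by (rule AE_completion)
  have "integrable lebesgue H" using G GH H_leb integrable_cong_AE[of G lebesgue H] by auto
  then have H_int: "integrable lborel H" using integrable_completion[of H lborel] by simp
  have eq0: "(LINT z|lborel. H z * \<phi> z) = 0" if \<phi>: "\<phi> \<in> test_functions" for \<phi>
  proof -
    let ?\<phi> = "\<lambda>z. indicator Omega z * \<phi> z"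
    have m: "?\<phi> \<in> borel_measurable borel" using test_BM[OF \<phi>] by (simp add: BM_def)
    then have m': "?\<phi> \<in> borel_measurable lebesgue" by (auto intro: measurable_completion)
    have "0 = (LINT z|lebesgue. indicator Omega z *\<^sub>R (g z * \<phi> z))"
      using zero[OF \<phi>] unfolding ip_def by (subst (asm) integral_restrict_space) auto
    also have "\<dots> = (LINT z|lebesgue. G z * ?\<phi> z)"
      by (intro Bochner_Integration.integral_cong) (auto simp: G_def indicator_def)
    also have "\<dots> = (LINT z|lebesgue. H z * ?\<phi> z)"
    proof (rule integral_cong_AE)
      show "AE z in lebesgue. G z * ?\<phi> z = H z * ?\<phi> z" using GH by eventually_elim simp
    qed (use G H_leb m' in \<open>auto intro!: borel_measurable_times\<close>)
    also have "\<dots> = (LINT z|lborel. H z * ?\<phi> z)"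
      using m by (intro integral_completion) auto
    also have "(\<lambda>z. H z * ?\<phi> z) = (\<lambda>z. H z * \<phi> z)"
      by (auto simp: H_def indicator_def)
    finally show ?thesis by simp
  qed
  have box: "(LINT z|lborel. indicator (box p q) z * H z) = 0" for p q :: "real \<times> real"
  proof -
    \<comment> \<open>Clipping the box to the square keeps the supports inside \<open>Omega\<close>
      and loses nothing, since \<open>H\<close> vanishes outside.\<close>
    define \<phi> where "\<phi> n z = bump (max (-1) (fst p)) (min 1 (fst q)) n (fst z) *
      bump (max (-1) (snd p)) (min 1 (snd q)) n (snd z)" for n z
    have \<phi>: "\<phi> n \<in> test_functions" for n
      unfolding \<phi>_def[abs_def] by (rule bump_test_function) auto
    have "continuous_on UNIV (\<phi> n)" for n
      unfolding \<phi>_def[abs_def]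
      by (intro continuous_on_mult continuous_on_compose2[OF smooth_continuous[OF smooth_bump]] continuous_intros) auto
    then have [measurable]: "\<phi> n \<in> borel_measurable borel" for n
      by (rule borel_measurable_continuous_onI)
    have "(\<lambda>n. LINT z|lborel. H z * \<phi> n z) \<longlonglongrightarrow> (LINT z|lborel. indicator (box p q) z * H z)"
    proof (rule integral_dominated_convergence[where w = "\<lambda>z. norm (H z)"])
      show "AE z in lborel. (\<lambda>n. H z * \<phi> n z) \<longlonglongrightarrow> indicator (box p q) z * H z"
      proof (rule AE_I2)
        fix z
        have "(\<lambda>n. H z * \<phi> n z) \<longlonglongrightarrow> H z * (indicator {max (-1) (fst p)<..<min 1 (fst q)} (fst z) *
          indicator {max (-1) (snd p)<..<min 1 (snd q)} (snd z))"
          unfolding \<phi>_def by (intro tendsto_intros bump_tendsto)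
        moreover have "H z * (indicator {max (-1) (fst p)<..<min 1 (fst q)} (fst z) *
          indicator {max (-1) (snd p)<..<min 1 (snd q)} (snd z)) = indicator (box p q) z * H z"
          by (cases z, cases p, cases q) (auto simp: H_def box_def Basis_prod_def indicator_def)
        ultimately show "(\<lambda>n. H z * \<phi> n z) \<longlonglongrightarrow> indicator (box p q) z * H z"
          by simp
      qed
      show "AE z in lborel. norm (H z * \<phi> n z) \<le> norm (H z)" for n
        using bump_bounds unfolding \<phi>_def
        by (intro AE_I2) (auto simp: abs_mult intro!: mult_left_le mult_le_one)
    qed (use H_int in auto)
    moreover have "(LINT z|lborel. H z * \<phi> n z) = 0" for n by (rule eq0[OF \<phi>])
    ultimately show ?thesis by (simp add: LIMSEQ_const_iff)
  qed
  have "(\<integral>z\<in>A. H z \<partial>lborel) = 0" if "A \<in> sets lborel" for A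
  proof -
    let ?G = "range (\<lambda>(a, b). box a b :: (real \<times> real) set)"
    have mem: "box p q \<in> ?G" for p q by (rule range_eqI[of _ _ "(p, q)"]) simp
    \<comment> \<open>Boxes are stable under intersection and generate the Borel sets, so it remains
      to see that the sets over which \<open>H\<close> integrates to 0 are closed under complements
      and countable disjoint unions.\<close>
    have "Int_stable ?G"
    proof (rule Int_stableI)
      fix U V assume "U \<in> ?G" "V \<in> ?G"
      then obtain p q p' q' where "U = box p q" "V = box p' q'" by auto
      then show "U \<inter> V \<in> ?G" using mem by (simp only: box_Int_box)
    qed
    moreover have "?G \<subseteq> Pow UNIV" by auto
    moreover have "A \<in> sigma_sets UNIV ?G" using that by (simp add: borel_eq_box)
    ultimately show ?thesis
    proof (induction rule: sigma_sets_induct_disjoint)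
      case (basic A)
      then show ?case using box by (auto simp: set_lebesgue_integral_def)
    next
      case empty
      then show ?case by (simp add: set_lebesgue_integral_def)
    next
      case (compl A)
      have A: "A \<in> sets borel" using compl(1) by (simp add: borel_eq_box)
      \<comment> \<open>A complement reduces to the integral over the whole plane, which is the
        integral over \<open>Omega\<close>, itself a box.\<close>
      have "H z = indicator (box (-1, -1) (1, 1)) z * H z" for z
        unfolding Omega_box[symmetric] by (auto simp: H_def indicator_def)
      then have "(LINT z|lborel. H z) = 0" using box[of "(-1, -1)" "(1, 1)"] by presburger
      moreover have "(LINT z|lborel. indicator (UNIV - A) z *\<^sub>R H z) =
        (LINT z|lborel. H z - indicator A z *\<^sub>R H z)"
        by (intro Bochner_Integration.integral_cong) (auto simp: indicator_def)
      moreover have "integrable lborel (\<lambda>z. indicator A z *\<^sub>R H z)"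
        using A H_int by (intro integrable_mult_indicator) auto
      ultimately show ?case using compl(2) H_int unfolding set_lebesgue_integral_def by simp
    next
      case (union A)
      have A: "A i \<in> sets lborel" for i using union(2) by (auto simp: borel_eq_box)
      have "(\<integral>z\<in>(\<Union>i. A i). H z \<partial>lborel) = (\<Sum>i. \<integral>z\<in>A i. H z \<partial>lborel)"
      proof (rule lebesgue_integral_countable_add)
        show "A i \<inter> A j = {}" if "i \<noteq> j" for i j
          using union(1) that by (auto simp: disjoint_family_on_def)
        show "set_integrable lborel (\<Union>i. A i) H"
          unfolding set_integrable_def using A H_int by (intro integrable_mult_indicator) auto
      qed (rule A)
      then show ?case using union(3) by simp
    qed
  qed
  then have "AE z in lborel. H z = 0"
    by (rule sigma_finite_measure.density_zero[OF sigma_finite_lborel H_int])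
  then have "AE z in lebesgue. H z = 0" by (rule AE_completion)
  with GH have "AE z in lebesgue. z \<in> Omega \<longrightarrow> g z = 0"
    by eventually_elim (auto simp: G_def)
  then show ?thesis by (subst AE_restrict_space_iff) auto
qed

lemma L2_test_unique:
  assumes "g \<in> L2" "h \<in> L2" "\<And>\<phi>. \<phi> \<in> test_functions \<Longrightarrow> ip g \<phi> = ip h \<phi>"
  shows "AE z in lebesgue_on Omega. g z = h z"
proof -
  have "ip (\<lambda>z. g z - h z) \<phi> = 0" if "\<phi> \<in> test_functions" for \<phi>
    using assms(3)[OF that] integrable_mult_BM[OF L2_integrable[OF assms(1)] test_BM[OF that]]
      integrable_mult_BM[OF L2_integrable[OF assms(2)] test_BM[OF that]]
    by (simp add: ip_def left_diff_distrib)
  then have "AE z in lebesgue_on Omega. g z - h z = 0"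
    by (rule L2_test_zero[OF L2_diff[OF assms(1,2)]])
  then show ?thesis by simp
qed

lemma weak_dx_X1:
  assumes "X1 v v'"
  shows "weak_dx v v'"
proof -
  have "ip v (pdx \<phi>) = - ip v' \<phi>" if "\<phi> \<in> test_functions" for \<phi>
    using X1_parts[OF assms X1_C_k[OF test_C_k[OF that, of "Suc 0"]]] test_zero[OF that]
    by (simp add: ip_eq_J)
  then show ?thesis using assms by (auto simp: weak_dx_def intro: BM_L2 X1_BM)
qed

lemma weak_dy_Y1:
  assumes "Y1 v v'"
  shows "weak_dy v v'"
proof -
  have "ip v (pdy \<phi>) = - ip v' \<phi>" if "\<phi> \<in> test_functions" for \<phi>
    using Y1_parts[OF assms Y1_C_k[OF test_C_k[OF that, of "Suc 0"]]] test_zero[OF that]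
    by (simp add: ip_eq_J)
  then show ?thesis using assms by (auto simp: weak_dy_def intro: BM_L2 Y1_BM)
qed

text \<open>\<open>wdx v\<close> comes from a choice operator, so nothing is known of it pointwise;
  uniqueness identifies it almost everywhere with the derivative along lines. This makes
  \<open>B_form\<close> computable both for \<open>u\<close> and for finite element
  functions.\<close>

lemma wdx_X1:
  assumes "X1 v v'"
  shows "wdx v \<in> borel_measurable (lebesgue_on Omega)" "AE z in lebesgue_on Omega. wdx v z = v' z"
proof -
  have w: "weak_dx v (wdx v)"
    unfolding wdx_def by (rule someI[of "weak_dx v"]) (rule weak_dx_X1[OF assms])
  then show "wdx v \<in> borel_measurable (lebesgue_on Omega)"
    by (auto simp: weak_dx_def L2_measurable)
  show "AE z in lebesgue_on Omega. wdx v z = v' z"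
    using w weak_dx_X1[OF assms] by (intro L2_test_unique) (auto simp: weak_dx_def)
qed

lemma wdy_Y1:
  assumes "Y1 v v'"
  shows "wdy v \<in> borel_measurable (lebesgue_on Omega)" "AE z in lebesgue_on Omega. wdy v z = v' z"
proof -
  have w: "weak_dy v (wdy v)"
    unfolding wdy_def by (rule someI[of "weak_dy v"]) (rule weak_dy_Y1[OF assms])
  then show "wdy v \<in> borel_measurable (lebesgue_on Omega)"
    by (auto simp: weak_dy_def L2_measurable)
  show "AE z in lebesgue_on Omega. wdy v z = v' z"
    using w weak_dy_Y1[OF assms] by (intro L2_test_unique) (auto simp: weak_dy_def)
qed

lemma ip_cong_AE:
  assumes "g \<in> borel_measurable (lebesgue_on Omega)" "AE z in lebesgue_on Omega. g z = g' z" "BM g'"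
    and "h \<in> borel_measurable (lebesgue_on Omega)" "AE z in lebesgue_on Omega. h z = h' z" "BM h'"
  shows "ip g h = J (\<lambda>z. g' z * h' z)"
  unfolding ip_def J_def
proof (rule integral_cong_AE)
  show "AE z in lebesgue_on Omega. g z * h z = g' z * h' z" using assms(2,5) by eventually_elim simp
qed (use assms BM_measurable in \<open>auto intro!: borel_measurable_times\<close>)

lemma B_form_eq:
  assumes "X1 u ux" "Y1 u uy" "X1 v vx" "Y1 v vy" "BM (b1 a)" "BM c"
  shows "B_form \<epsilon> a c u v = \<epsilon> * (J (\<lambda>z. ux z * vx z) + J (\<lambda>z. uy z * vy z))
     + J (\<lambda>z. b1 a z * ux z * v z) + J (\<lambda>z. c z * u z * v z)"
proof -
  note bm = X1_BM[OF assms(1)] X1_BM[OF assms(3)] Y1_BM[OF assms(2)] Y1_BM[OF assms(4)]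
  have "ip (wdx u) (wdx v) = J (\<lambda>z. ux z * vx z)"
    by (rule ip_cong_AE[OF wdx_X1[OF assms(1)] bm(2) wdx_X1[OF assms(3)] bm(4)])
  moreover have "ip (wdy u) (wdy v) = J (\<lambda>z. uy z * vy z)"
    by (rule ip_cong_AE[OF wdy_Y1[OF assms(2)] bm(6) wdy_Y1[OF assms(4)] bm(8)])
  moreover have "ip (\<lambda>z. b1 a z * wdx u z) v = J (\<lambda>z. b1 a z * ux z * v z)"
  proof (rule ip_cong_AE)
    show "(\<lambda>z. b1 a z * wdx u z) \<in> borel_measurable (lebesgue_on Omega)"
      by (intro borel_measurable_times wdx_X1[OF assms(1)] BM_measurable assms)
    show "AE z in lebesgue_on Omega. b1 a z * wdx u z = b1 a z * ux z"
      using wdx_X1(2)[OF assms(1)] by eventually_elim simp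
  qed (use bm assms in \<open>auto simp: BM_measurable intro: BM_mult\<close>)
  ultimately show ?thesis by (simp add: B_form_def ip_eq_J)
qed


section \<open>The differential equation and the boundary values\<close>

lemma H1_norm_eq:
  assumes "X1 d dx" "Y1 d dy"
  shows "H1_norm d = sqrt (J (\<lambda>z. (d z)\<^sup>2) + J (\<lambda>z. (dx z)\<^sup>2) + J (\<lambda>z. (dy z)\<^sup>2))"
proof -
  have "ip (wdx d) (wdx d) = J (\<lambda>z. dx z * dx z)"
    by (rule ip_cong_AE[OF wdx_X1[OF assms(1)] X1_BM(2)[OF assms(1)] wdx_X1[OF assms(1)] X1_BM(2)[OF assms(1)]])
  moreover have "ip (wdy d) (wdy d) = J (\<lambda>z. dy z * dy z)"
    by (rule ip_cong_AE[OF wdy_Y1[OF assms(2)] Y1_BM(2)[OF assms(2)] wdy_Y1[OF assms(2)] Y1_BM(2)[OF assms(2)]])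
  ultimately show ?thesis by (simp add: H1_norm_def ip_eq_J power2_eq_square)
qed

lemma test_H10:
  assumes "\<phi> \<in> test_functions"
  shows "\<phi> \<in> H10"
proof -
  have "X1 \<phi> (pdx \<phi>)" "Y1 \<phi> (pdy \<phi>)"
    by (rule X1_C_k[OF test_C_k[OF assms, of "Suc 0"]], rule Y1_C_k[OF test_C_k[OF assms, of "Suc 0"]])
  then have "\<phi> \<in> H1"
    unfolding H1_def using weak_dx_X1 weak_dy_Y1 BM_L2 X1_BM by blast
  moreover have "X1 (\<lambda>z. 0) (\<lambda>z. 0)" "Y1 (\<lambda>z. 0) (\<lambda>z. 0)"
    unfolding X1_def Y1_def swap_def by (auto intro!: exI[of _ "{}"])
  then have "H1_norm (\<lambda>z. 0) = 0" by (subst H1_norm_eq) (auto simp: J_const)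
  ultimately show ?thesis
    unfolding H10_def using assms by (auto intro!: exI[of _ "\<lambda>n. \<phi>"])
qed

text \<open>A linear functional that is bounded in the \<open>H1\<close> norm and vanishes on test
  functions vanishes on \<open>H10\<close>. Boundedness enters through Young's inequality, whose
  parameter is chosen after the limit in \<open>n\<close>. Differentiability of \<open>u\<close>
  allows classical derivatives in place of weak ones.\<close>

lemma H10_functional:
  assumes u: "u \<in> H10" "C_k (Suc k) u" and bm: "BM p" "BM q" "BM r"
    and zero: "\<And>\<phi>. \<phi> \<in> test_functions \<Longrightarrow> J (\<lambda>z. p z * \<phi> z + q z * pdx \<phi> z + r z * pdy \<phi> z) = 0"
  shows "J (\<lambda>z. p z * u z + q z * pdx u z + r z * pdy u z) = 0"
proof -
  have le: "J (\<lambda>z. p z * u z + q z * pdx u z + r z * pdy u z) \<le> 0"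
    if bm: "BM p" "BM q" "BM r"
    and zero: "\<And>\<phi>. \<phi> \<in> test_functions \<Longrightarrow> J (\<lambda>z. p z * \<phi> z + q z * pdx \<phi> z + r z * pdy \<phi> z) = 0"
    for p q r
  proof -
    define X where "X = J (\<lambda>z. p z * u z + q z * pdx u z + r z * pdy u z)"
    define W where "W = J (\<lambda>z. (p z)\<^sup>2) + J (\<lambda>z. (q z)\<^sup>2) + J (\<lambda>z. (r z)\<^sup>2)"
    have "W \<ge> 0"
      unfolding W_def by (intro add_nonneg_nonneg J_nonneg) auto
    obtain \<phi> where \<phi>: "\<And>n::nat. \<phi> n \<in> test_functions" "(\<lambda>n. H1_norm (\<lambda>z. u z - \<phi> n z)) \<longlonglongrightarrow> 0"
      using u(1) by (auto simp: H10_def)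
    have *: "X \<le> t / 2 * W + 1 / (2 * t) * (H1_norm (\<lambda>z. u z - \<phi> n z))\<^sup>2" if "t > 0" for t n
    proof -
      define d where "d = (\<lambda>z. u z - \<phi> n z)"
      have C: "C_k (Suc k) (\<phi> n)" using \<phi>(1) by (rule test_C_k)
      have d: "C_k (Suc k) d"
        using C_k_lin[OF u(2) C, of 1 "-1"] by (simp add: d_def del: C_k.simps)
      have dxd: "pdx d z = pdx u z - pdx (\<phi> n) z" if "z \<in> Omega" for z
        using pdx_lin[OF u(2) C, of z 1 "-1"] that Omega_subset_bar by (auto simp: d_def)
      have dyd: "pdy d z = pdy u z - pdy (\<phi> n) z" if "z \<in> Omega" for z
        using pdy_lin[OF u(2) C, of z 1 "-1"] that Omega_subset_bar by (auto simp: d_def)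
      note bmu = X1_BM[OF X1_C_k[OF u(2)]] Y1_BM[OF Y1_C_k[OF u(2)]]
      note bmp = X1_BM[OF X1_C_k[OF C]] Y1_BM[OF Y1_C_k[OF C]]
      note bmd = X1_BM[OF X1_C_k[OF d]] Y1_BM[OF Y1_C_k[OF d]]
      have "X = J (\<lambda>z. p z * u z + q z * pdx u z + r z * pdy u z)
        - J (\<lambda>z. p z * \<phi> n z + q z * pdx (\<phi> n) z + r z * pdy (\<phi> n) z)"
        using zero[OF \<phi>(1)] by (simp add: X_def)
      also have "\<dots> = J (\<lambda>z. (p z * u z + q z * pdx u z + r z * pdy u z)
        - (p z * \<phi> n z + q z * pdx (\<phi> n) z + r z * pdy (\<phi> n) z))"
        using bm bmu bmp by (intro J_diff[symmetric] BM_add BM_mult)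
      also have "\<dots> = J (\<lambda>z. p z * d z + q z * pdx d z + r z * pdy d z)"
        by (rule J_cong) (simp add: dxd dyd, simp add: d_def algebra_simps)
      also have "\<dots> = J (\<lambda>z. p z * d z) + J (\<lambda>z. q z * pdx d z) + J (\<lambda>z. r z * pdy d z)"
        using bm bmd by (simp add: J_add BM_add BM_mult)
      also have "\<dots> \<le> (t / 2 * J (\<lambda>z. (p z)\<^sup>2) + 1 / (2 * t) * J (\<lambda>z. (d z)\<^sup>2))
          + (t / 2 * J (\<lambda>z. (q z)\<^sup>2) + 1 / (2 * t) * J (\<lambda>z. (pdx d z)\<^sup>2))
          + (t / 2 * J (\<lambda>z. (r z)\<^sup>2) + 1 / (2 * t) * J (\<lambda>z. (pdy d z)\<^sup>2))"
        using that bm bmd by (intro add_mono J_young)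
      also have "\<dots> = t / 2 * W + 1 / (2 * t) *
          (J (\<lambda>z. (d z)\<^sup>2) + J (\<lambda>z. (pdx d z)\<^sup>2) + J (\<lambda>z. (pdy d z)\<^sup>2))"
        by (simp add: W_def algebra_simps)
      also have "J (\<lambda>z. (d z)\<^sup>2) + J (\<lambda>z. (pdx d z)\<^sup>2) + J (\<lambda>z. (pdy d z)\<^sup>2) = (H1_norm d)\<^sup>2"
        unfolding H1_norm_eq[OF X1_C_k[OF d] Y1_C_k[OF d]]
        by (subst real_sqrt_pow2) (auto intro!: add_nonneg_nonneg J_nonneg)
      finally show ?thesis by (simp add: d_def)
    qed
    have **: "X \<le> t / 2 * W" if "t > 0" for t
    proof (rule LIMSEQ_le_const)
      have "(\<lambda>n. t / 2 * W + 1 / (2 * t) * (H1_norm (\<lambda>z. u z - \<phi> n z))\<^sup>2) \<longlonglongrightarrow> t / 2 * W + 1 / (2 * t) * 0\<^sup>2"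
        by (intro tendsto_intros \<phi>(2))
      then show "(\<lambda>n. t / 2 * W + 1 / (2 * t) * (H1_norm (\<lambda>z. u z - \<phi> n z))\<^sup>2) \<longlonglongrightarrow> t / 2 * W"
        by simp
    qed (use *[OF that] in auto)
    show ?thesis
    proof (rule ccontr)
      assume "\<not> ?thesis"
      then have "X > 0" by (simp add: X_def)
      \<comment> \<open>The choice \<open>t = X / (W + 1)\<close> makes the right side smaller than
        X / 2 and avoids a division by \<open>W\<close>, which may be 0.\<close>
      then have "X \<le> X / (W + 1) / 2 * W"
        using **[of "X / (W + 1)"] \<open>W \<ge> 0\<close> by simp
      then have "X * (W + 1) * 2 \<le> X * W"
        using \<open>W \<ge> 0\<close> by (simp add: field_simps)
      moreover have "0 < X * W + X * 2"
        using \<open>X > 0\<close> \<open>W \<ge> 0\<close> by (intro add_nonneg_pos) auto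
      then have "X * W < X * (W + 1) * 2" by (simp add: algebra_simps)
      ultimately show False by simp
    qed
  qed
  \<comment> \<open>The one-sided bound for the negated coefficients is the opposite
    inequality.\<close>
  have "J (\<lambda>z. - p z * u z + - q z * pdx u z + - r z * pdy u z) \<le> 0"
  proof (rule le)
    fix \<phi> assume "\<phi> \<in> test_functions"
    from zero[OF this] J_uminus[of "\<lambda>z. p z * \<phi> z + q z * pdx \<phi> z + r z * pdy \<phi> z"]
    show "J (\<lambda>z. - p z * \<phi> z + - q z * pdx \<phi> z + - r z * pdy \<phi> z) = 0"
      by (simp add: algebra_simps)
  qed (use bm in auto)
  moreover have "J (\<lambda>z. - p z * u z + - q z * pdx u z + - r z * pdy u z) =
      - J (\<lambda>z. p z * u z + q z * pdx u z + r z * pdy u z)"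
    unfolding J_uminus[symmetric] by (simp add: algebra_simps)
  ultimately show ?thesis using le[OF bm zero] by simp
qed

section \<open>Boundary values of differentiable functions in \<open>H10\<close>\<close>

lemma J_zero_imp_zero:
  assumes "continuous_on Omega_bar h" "\<And>z. z \<in> Omega \<Longrightarrow> 0 \<le> h z" "J h = 0" "z \<in> Omega"
  shows "h z = 0"
proof (rule ccontr)
  assume "h z \<noteq> 0"
  let ?S = "Omega \<inter> h -` (- {0})"
  have "open ?S"
    using assms(1) Omega_subset_bar open_Omega
    by (intro continuous_open_preimage) (auto intro: continuous_on_subset)
  moreover have "z \<in> ?S" using assms(4) \<open>h z \<noteq> 0\<close> by simp
  ultimately have "\<not> negligible ?S" using open_not_negligible by blast
  moreover have "AE z in lebesgue_on Omega. h z = 0"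
    using assms(3) BM_integrable[OF BM_continuous[OF assms(1)]] unfolding J_def
    by (subst (asm) integral_nonneg_eq_0_iff_AE) (auto intro!: AE_I2 assms(2))
  then have "AE z in lebesgue. z \<in> Omega \<longrightarrow> h z = 0"
    by (subst (asm) AE_restrict_space_iff) auto
  then have "AE z in lebesgue. z \<notin> ?S" by eventually_elim auto
  then have "?S \<in> null_sets lebesgue"
    using \<open>open ?S\<close> by (subst (asm) AE_iff_null_sets[symmetric]) auto
  then have "negligible ?S" by (simp add: negligible_iff_null_sets)
  ultimately show False by simp
qed

lemma X1_snd:
  assumes "continuous_on {-1..1} h"
  shows "X1 (\<lambda>z. h (snd z)) (\<lambda>z. 0)"
proof -
  have "continuous_on Omega_bar (\<lambda>z. h (snd z))"
    by (rule continuous_on_compose2[OF assms]) (auto intro!: continuous_intros)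
  then show ?thesis
    unfolding X1_def by (auto intro!: BM_continuous exI[of _ "{}"])
qed

lemma X1_affine: "X1 (\<lambda>z. r + s * fst z) (\<lambda>z. s)"
  unfolding X1_def
  by (auto intro!: BM_continuous exI[of _ "{}"] continuous_intros derivative_eq_intros)

lemma X1_diff:
  assumes "X1 g g'" "X1 h h'"
  shows "X1 (\<lambda>z. g z - h z) (\<lambda>z. g' z - h' z)"
proof -
  obtain S where S: "finite S" "\<And>y. \<bar>y\<bar> < 1 \<Longrightarrow> continuous_on {-1..1} (\<lambda>x. g (x, y))"
    "\<And>x y. \<bar>y\<bar> < 1 \<Longrightarrow> x\<in>{-1<..<1} - S \<Longrightarrow> ((\<lambda>x. g (x, y)) has_real_derivative g' (x, y)) (at x)"
    using assms(1) by (auto simp: X1_def)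
  obtain T where T: "finite T" "\<And>y. \<bar>y\<bar> < 1 \<Longrightarrow> continuous_on {-1..1} (\<lambda>x. h (x, y))"
    "\<And>x y. \<bar>y\<bar> < 1 \<Longrightarrow> x\<in>{-1<..<1} - T \<Longrightarrow> ((\<lambda>x. h (x, y)) has_real_derivative h' (x, y)) (at x)"
    using assms(2) by (auto simp: X1_def)
  have "BM (\<lambda>z. g z - h z)" "BM (\<lambda>z. g' z - h' z)"
    using X1_BM[OF assms(1)] X1_BM[OF assms(2)] by (auto intro: BM_diff)
  moreover have "\<forall>y. \<bar>y\<bar> < 1 \<longrightarrow>
     continuous_on {-1..1} (\<lambda>x. g (x, y) - h (x, y)) \<and>
     (\<forall>x\<in>{-1<..<1} - (S \<union> T). ((\<lambda>x. g (x, y) - h (x, y)) has_real_derivative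
        g' (x, y) - h' (x, y)) (at x))"
    using S T by (intro allI impI conjI ballI continuous_on_diff DERIV_diff) auto
  ultimately show ?thesis
    unfolding X1_def using S(1) T(1) by (intro conjI exI[of _ "S \<union> T"]) auto
qed

text \<open>With \<open>w = (1 \<plusminus> x) u\<close> as test function, \<open>\<integral> (u w)\<^sub>x = 0\<close> becomes
  \<open>\<integral> u(\<plusminus>1, y)\<^sup>2 dy = 0\<close>.\<close>

lemma edge_zero:
  assumes u: "C_k (Suc k) u" and w: "\<And>w w'. X1 w w' \<Longrightarrow> J (\<lambda>z. w' z * u z + w z * pdx u z) = 0"
    and s: "s = 1 \<or> s = -1" and y: "\<bar>y\<bar> < 1"
  shows "u (s, y) = 0"
proof -
  note X = X1_C_k[OF u]
  note W = X1_mult[OF X1_affine[of 1 s] X]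
  have cont: "continuous_on {-1..1} (\<lambda>y. (u (s, y))\<^sup>2)"
    by (intro continuous_intros continuous_on_compose2[OF C_k_continuous[OF u]]) (use s in auto)
  \<comment> \<open>The difference u^2 - u(s, y)^2 vanishes at x = s and the factor 1 + s x vanishes
    at x = -s, so their product has zero boundary values. Subtracting its identity from the one for
    \<open>w\<close> leaves s u(s, y)^2 alone.\<close>
  note D = X1_diff[OF X1_mult[OF X X] X1_snd[OF cont]]
  note Z = X1_mult[OF X1_affine[of 1 s] D]
  have "J (\<lambda>z. s * (u z * u z - (u (s, snd z))\<^sup>2) +
      (1 + s * fst z) * (pdx u z * u z + u z * pdx u z - 0)) = 0"
    by (rule X1_J_zero[OF Z]) (use s in \<open>auto simp: power2_eq_square\<close>)
  moreover have "J (\<lambda>z. (s * u z + (1 + s * fst z) * pdx u z) * u z + (1 + s * fst z) * u z * pdx u z) = 0"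
    by (rule w[OF W])
  ultimately have "J (\<lambda>z. ((s * u z + (1 + s * fst z) * pdx u z) * u z + (1 + s * fst z) * u z * pdx u z)
    - (s * (u z * u z - (u (s, snd z))\<^sup>2) + (1 + s * fst z) * (pdx u z * u z + u z * pdx u z - 0))) = 0"
    using X1_BM[OF Z] X1_BM[OF W] X1_BM[OF X] by (subst J_diff) (auto intro!: BM_add BM_mult)
  also have "(\<lambda>z. ((s * u z + (1 + s * fst z) * pdx u z) * u z + (1 + s * fst z) * u z * pdx u z)
    - (s * (u z * u z - (u (s, snd z))\<^sup>2) + (1 + s * fst z) * (pdx u z * u z + u z * pdx u z - 0)))
    = (\<lambda>z. s * (u (s, snd z))\<^sup>2)" by (auto simp: algebra_simps)
  finally have "J (\<lambda>z. (u (s, snd z))\<^sup>2) = 0" using s by (auto simp: J_cmult)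
  moreover have "continuous_on Omega_bar (\<lambda>z. (u (s, snd z))\<^sup>2)"
    by (rule continuous_on_compose2[OF cont]) (auto intro!: continuous_intros)
  ultimately have "(u (s, snd (0::real, y)))\<^sup>2 = 0"
    using y by (intro J_zero_imp_zero[of "\<lambda>z. (u (s, snd z))\<^sup>2" "(0, y)"]) (auto simp: abs_less_iff)
  then show ?thesis by simp
qed

lemma frontier_Omega: "frontier Omega = Omega_bar - Omega"
  unfolding frontier_def interior_open[OF open_Omega] by (simp add: Omega_def closure_Times)

text \<open>For a test function \<open>\<phi>\<close> and any \<open>w\<close> differentiable along
  lines, the x-derivative of their product has integral 0. The integral is a bounded functional of
  \<open>\<phi>\<close> in the \<open>H1\<close> norm, so the identity survives the limit to
  \<open>u\<close>, and \<open>edge_zero\<close> turns it into a pointwise statement.\<close>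

lemma H10_boundary:
  assumes u: "u \<in> H10" "C_k (Suc k) u" and z: "z \<in> frontier Omega"
  shows "u z = 0"
proof -
  have "J (\<lambda>z. w' z * u z + w z * pdx u z) = 0" if "X1 w w'" for w w'
  proof -
    have "J (\<lambda>z. w' z * \<phi> z + w z * pdx \<phi> z + 0 * pdy \<phi> z) = 0" if "\<phi> \<in> test_functions" for \<phi>
    proof -
      have "J (\<lambda>z. w' z * \<phi> z + w z * pdx \<phi> z) = 0"
        by (rule X1_J_zero[OF X1_mult[OF \<open>X1 w w'\<close> X1_C_k[OF test_C_k[OF that, of "Suc 0"]]]])
           (use test_zero[OF that] in auto)
      then show ?thesis by simp
    qed
    from H10_functional[OF u X1_BM(2)[OF that] X1_BM(1)[OF that] BM_const this]
    show ?thesis by simp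
  qed
  then have x: "u (s, y) = 0" if "s = 1 \<or> s = -1" "\<bar>y\<bar> < 1" for s y
    using edge_zero[OF u(2)] that by blast
  have "J (\<lambda>z. w' z * swap u z + w z * pdx (swap u) z) = 0" if "X1 w w'" for w w'
  proof -
    have Y: "Y1 (swap w) (swap w')" using that by (simp add: Y1_def)
    have "J (\<lambda>z. swap w' z * \<phi> z + 0 * pdx \<phi> z + swap w z * pdy \<phi> z) = 0" if "\<phi> \<in> test_functions" for \<phi>
    proof -
      note P = Y1_C_k[OF test_C_k[OF that, of "Suc 0"]]
      have "J (\<lambda>z. swap w' z * \<phi> z) = - J (\<lambda>z. swap w z * pdy \<phi> z)"
        by (rule Y1_parts[OF Y P]) (use test_zero[OF that] in auto)
      moreover have "BM (\<lambda>z. swap w' z * \<phi> z)" "BM (\<lambda>z. swap w z * pdy \<phi> z)"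
        using Y1_BM[OF Y] Y1_BM[OF P] by auto
      ultimately show ?thesis by (simp add: J_add)
    qed
    from H10_functional[OF u Y1_BM(2)[OF Y] BM_const Y1_BM(1)[OF Y] this]
    have "J (\<lambda>z. swap w' z * u z + swap w z * pdy u z) = 0" by simp
    moreover have "(\<lambda>z. swap w' z * u z + swap w z * pdy u z) =
        swap (\<lambda>z. w' z * swap u z + w z * pdx (swap u) z)" by (auto simp: swap_def pdx_swap)
    moreover have "BM (\<lambda>z. w' z * swap u z + w z * pdx (swap u) z)"
      using X1_BM[OF that] X1_BM[OF X1_C_k[OF C_k_swap[OF u(2)]]] by auto
    ultimately show ?thesis by (simp add: J_swap)
  qed
  then have y: "u (x, s) = 0" if "s = 1 \<or> s = -1" "\<bar>x\<bar> < 1" for s x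
    using edge_zero[OF C_k_swap[OF u(2)], of s x] that by simp
  \<comment> \<open>The edges were reached without their end points; continuity adds the
    corners.\<close>
  have x': "u (s, y) = 0" if s: "s = 1 \<or> s = -1" and y: "y \<in> {-1..1}" for s y
  proof (rule continuous_constant_on_closure[of "{-1<..<1}" "\<lambda>y. u (s, y)"])
    show "continuous_on (closure {-1<..<1}) (\<lambda>y. u (s, y))"
      by (rule continuous_on_compose2[OF C_k_continuous[OF u(2)]])
         (use s in \<open>auto intro!: continuous_intros\<close>)
  qed (use x s y in \<open>auto simp: abs_less_iff\<close>)
  obtain x0 y0 where "z = (x0, y0)" by (cases z) auto
  with z x'[of x0 y0] y[of y0 x0] show ?thesis
    unfolding frontier_Omega by (cases "x0 = 1"; cases "x0 = -1"; auto simp: abs_less_iff)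
qed

section \<open>The strong form of the equation, tested with piecewise differentiable
  functions\<close>

lemma weak_solution_galerkin:
  assumes ws: "weak_solution \<epsilon> a c f u" and u: "C_k (Suc (Suc k)) u"
    and bm: "BM (b1 a)" "BM c" "BM f"
    and v: "X1 v vx" "Y1 v vy" "\<And>z. z \<in> frontier Omega \<Longrightarrow> v z = 0"
  shows "\<epsilon> * (J (\<lambda>z. pdx u z * vx z) + J (\<lambda>z. pdy u z * vy z))
     + J (\<lambda>z. b1 a z * pdx u z * v z) + J (\<lambda>z. c z * u z * v z) = J (\<lambda>z. f z * v z)"
proof -
  \<comment> \<open>\<open>r\<close> is the strong residual. The identity \<open>rw\<close> is used
    twice: with test functions, where the weak equation makes it zero and so forces r = 0 almost
    everywhere, and then with \<open>v\<close>.\<close>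
  define r where "r = (\<lambda>z. - \<epsilon> * pdx (pdx u) z - \<epsilon> * pdy (pdy u) z + b1 a z * pdx u z + c z * u z - f z)"
  have ux: "C_k (Suc k) (pdx u)" and uy: "C_k (Suc k) (pdy u)" using u by simp_all
  note bmu = X1_BM[OF X1_C_k[OF u]] Y1_BM[OF Y1_C_k[OF u]] X1_BM[OF X1_C_k[OF ux]] Y1_BM[OF Y1_C_k[OF uy]]
  have bmr: "BM r"
    unfolding r_def using bm bmu by (intro BM_add BM_diff BM_mult BM_const)
  have rw: "J (\<lambda>z. r z * w z) = \<epsilon> * (J (\<lambda>z. pdx u z * wx z) + J (\<lambda>z. pdy u z * wy z))
     + J (\<lambda>z. b1 a z * pdx u z * w z) + J (\<lambda>z. c z * u z * w z) - J (\<lambda>z. f z * w z)"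
    if w: "X1 w wx" "Y1 w wy" "\<And>z. z \<in> frontier Omega \<Longrightarrow> w z = 0" for w wx wy
  proof -
    have [simp]: "w (-1, y) = 0" "w (1, y) = 0" "w (y, -1) = 0" "w (y, 1) = 0" if "\<bar>y\<bar> < 1" for y
      using w(3) that by (auto simp: frontier_Omega abs_less_iff)
    have 1: "J (\<lambda>z. pdx (pdx u) z * w z) = - J (\<lambda>z. pdx u z * wx z)"
      by (rule X1_parts[OF X1_C_k[OF ux] w(1)]) simp
    have 2: "J (\<lambda>z. pdy (pdy u) z * w z) = - J (\<lambda>z. pdy u z * wy z)"
      by (rule Y1_parts[OF Y1_C_k[OF uy] w(2)]) simp
    have [simp]: "BM (\<lambda>z. pdx (pdx u) z * w z)" "BM (\<lambda>z. pdy (pdy u) z * w z)"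
        "BM (\<lambda>z. b1 a z * pdx u z * w z)" "BM (\<lambda>z. c z * u z * w z)" "BM (\<lambda>z. f z * w z)"
      using bm bmu X1_BM[OF w(1)] by (auto intro!: BM_mult)
    have "J (\<lambda>z. r z * w z) = J (\<lambda>z. b1 a z * pdx u z * w z + c z * u z * w z - f z * w z
        - \<epsilon> * (pdx (pdx u) z * w z) - \<epsilon> * (pdy (pdy u) z * w z))"
      by (rule J_cong) (simp add: r_def algebra_simps)
    also have "\<dots> = J (\<lambda>z. b1 a z * pdx u z * w z) + J (\<lambda>z. c z * u z * w z) - J (\<lambda>z. f z * w z)
        - \<epsilon> * J (\<lambda>z. pdx (pdx u) z * w z) - \<epsilon> * J (\<lambda>z. pdy (pdy u) z * w z)"
      by (simp add: J_add J_diff J_cmult BM_add BM_diff BM_mult)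
    finally show ?thesis
      unfolding 1 2 by (simp add: algebra_simps)
  qed
  have "AE z in lebesgue_on Omega. r z = 0"
  proof (rule L2_test_zero[OF BM_L2[OF bmr]])
    fix \<phi> assume \<phi>: "\<phi> \<in> test_functions"
    note P = X1_C_k[OF test_C_k[OF \<phi>, of "Suc 0"]] Y1_C_k[OF test_C_k[OF \<phi>, of "Suc 0"]]
    have "B_form \<epsilon> a c u \<phi> = ip f \<phi>"
      using ws test_H10[OF \<phi>] by (simp add: weak_solution_def)
    then show "ip r \<phi> = 0"
      using rw[OF P] test_zero[OF \<phi>] B_form_eq[OF X1_C_k[OF u] Y1_C_k[OF u] P bm(1,2), of \<epsilon>]
      by (simp add: ip_eq_J frontier_Omega)
  qed
  then have "J (\<lambda>z. r z * v z) = J (\<lambda>z. 0)"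
    unfolding J_def
    by (intro integral_cong_AE) (use bmr X1_BM[OF v(1)] BM_measurable in \<open>auto intro!: borel_measurable_times\<close>)
  then show ?thesis using rw[OF v] by (simp add: J_const)
qed


section \<open>Piecewise linear interpolation\<close>

text \<open>One abstract partition of [-1, 1] serves both directions, so that \<open>swap\<close>
  can exchange the roles of the two meshes.\<close>

definition grid :: "(nat \<Rightarrow> real) \<Rightarrow> nat \<Rightarrow> bool" where
  "grid p K \<longleftrightarrow> p 0 = -1 \<and> p K = 1 \<and> (\<forall>k<K. p k < p (Suc k))"

text \<open>The derivative of the piecewise linear interpolant. Half-open cells make exactly one
  indicator fire at each point of [-1, 1), and the sum of indicators makes the measurability of
  \<open>Dx\<close> in both variables immediate.\<close>

definition slope :: "(nat \<Rightarrow> real) \<Rightarrow> nat \<Rightarrow> (real \<Rightarrow> real) \<Rightarrow> real \<Rightarrow> real" where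
  "slope p K g t = (\<Sum>k<K. indicator {p k..<p (Suc k)} t * ((g (p (Suc k)) - g (p k)) / (p (Suc k) - p k)))"

text \<open>The clamped increments make the interpolant visibly continuous.\<close>

definition interp :: "(nat \<Rightarrow> real) \<Rightarrow> nat \<Rightarrow> (real \<Rightarrow> real) \<Rightarrow> real \<Rightarrow> real" where
  "interp p K g t = g (p 0) +
     (\<Sum>k<K. (g (p (Suc k)) - g (p k)) * ((max (p k) (min (p (Suc k)) t) - p k) / (p (Suc k) - p k)))"

definition pwlin :: "(nat \<Rightarrow> real) \<Rightarrow> nat \<Rightarrow> (real \<Rightarrow> real) \<Rightarrow> bool" where
  "pwlin p K g \<longleftrightarrow> (\<forall>k<K. \<exists>r s. \<forall>t\<in>{p k..p (Suc k)}. g t = r + s * t)"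

lemma grid_less: "grid p K \<Longrightarrow> k < K \<Longrightarrow> p k < p (Suc k)"
  by (simp add: grid_def)

lemma grid_mono:
  assumes "grid p K" "i \<le> j" "j \<le> K"
  shows "p i \<le> p j"
  using assms(2,3)
proof (induction j rule: dec_induct)
  case (step j)
  then show ?case using grid_less[OF assms(1), of j] by simp
qed simp

lemma grid_bounds:
  assumes "grid p K" "k \<le> K"
  shows "-1 \<le> p k" "p k \<le> 1"
  using grid_mono[OF assms(1), of 0 k] grid_mono[OF assms(1), of k K] assms by (auto simp: grid_def)

lemma grid_pos: "grid p K \<Longrightarrow> 0 < K" by (cases K) (auto simp: grid_def)

lemma grid_cell:
  assumes "grid p K" "-1 \<le> t" "t < 1"
  obtains k where "k < K" "p k \<le> t" "t < p (Suc k)"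
proof -
  define j where "j = (LEAST j. t < p j)"
  have "t < p K" using assms by (simp add: grid_def)
  then have j: "t < p j" "j \<le> K"
    unfolding j_def by (auto intro: LeastI Least_le)
  moreover have "j \<noteq> 0"
  proof
    assume "j = 0"
    then show False using j(1) assms by (simp add: grid_def)
  qed
  then obtain k where k: "j = Suc k" by (cases j) auto
  then have "\<not> t < p k"
    unfolding j_def using not_less_Least[of k "\<lambda>j. t < p j"] by simp
  ultimately show ?thesis using k by (intro that[of k]) auto
qed

lemma grid_closed_cell:
  assumes "grid p K" "t \<in> {-1..1}"
  obtains k where "k < K" "p k \<le> t" "t \<le> p (Suc k)"
proof (cases "t < 1")
  case True
  then show ?thesis
    using grid_cell[OF assms(1), of t] assms(2) that by (metis atLeastAtMost_iff less_imp_le)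
next
  case False
  then show ?thesis
    using that[of "K - 1"] grid_pos[OF assms(1)] assms grid_bounds[OF assms(1), of "K - 1"]
    by (auto simp: grid_def)
qed

lemma slope_eq:
  assumes "grid p K" "k < K" "p k \<le> t" "t < p (Suc k)"
  shows "slope p K g t = (g (p (Suc k)) - g (p k)) / (p (Suc k) - p k)"
proof -
  have "indicator {p j..<p (Suc j)} t * ((g (p (Suc j)) - g (p j)) / (p (Suc j) - p j)) =
      (if j = k then (g (p (Suc k)) - g (p k)) / (p (Suc k) - p k) else 0)" if "j < K" for j
  proof -
    consider "j = k" | "Suc j \<le> k" | "Suc k \<le> j" by linarith
    then show ?thesis
    proof cases
      case 2
      then have "p (Suc j) \<le> p k" using assms that by (intro grid_mono[OF assms(1)]) auto
      then show ?thesis using 2 assms by auto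
    next
      case 3
      then have "p (Suc k) \<le> p j" using assms that by (intro grid_mono[OF assms(1)]) auto
      then show ?thesis using 3 assms by auto
    qed (use assms in auto)
  qed
  then have "slope p K g t = (\<Sum>j<K. if j = k then (g (p (Suc k)) - g (p k)) / (p (Suc k) - p k) else 0)"
    unfolding slope_def by (intro sum.cong) auto
  then show ?thesis using assms(2) by (simp add: sum.delta)
qed

text \<open>Cells to the left of \<open>t\<close> contribute their full increments, which telescope
  to \<open>g (p k) - g (p 0)\<close>; cells to the right contribute nothing.\<close>

lemma interp_eq:
  assumes "grid p K" "k < K" "p k \<le> t" "t \<le> p (Suc k)"
  shows "interp p K g t = g (p k) + (g (p (Suc k)) - g (p k)) * ((t - p k) / (p (Suc k) - p k))"
proof -
  let ?h = "\<lambda>j. (g (p (Suc j)) - g (p j)) * ((max (p j) (min (p (Suc j)) t) - p j) / (p (Suc j) - p j))"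
  have "?h j = 0" if "j \<in> {..<K} - {..<Suc k}" for j
  proof -
    have "p (Suc k) \<le> p j" "p j < p (Suc j)"
      using that by (auto intro: grid_mono[OF assms(1)] grid_less[OF assms(1)])
    then show ?thesis using assms by (simp add: max_def min_def)
  qed
  then have "(\<Sum>j<K. ?h j) = (\<Sum>j<Suc k. ?h j)"
    using assms(2) by (intro sum.mono_neutral_right) auto
  also have "\<dots> = (\<Sum>j<k. ?h j) + ?h k" by simp
  also have "(\<Sum>j<k. ?h j) = (\<Sum>j<k. g (p (Suc j)) - g (p j))"
  proof (rule sum.cong)
    fix j assume "j \<in> {..<k}"
    then have "p j < p (Suc j)" "p (Suc j) \<le> p k"
      using assms by (auto intro!: grid_mono[OF assms(1)] grid_less[OF assms(1)])
    then show "?h j = g (p (Suc j)) - g (p j)" using assms by (simp add: max_def min_def)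
  qed simp
  also have "\<dots> = g (p k) - g (p 0)" by (rule sum_lessThan_telescope)
  also have "?h k = (g (p (Suc k)) - g (p k)) * ((t - p k) / (p (Suc k) - p k))"
    using assms by (simp add: max_def min_def)
  finally show ?thesis by (simp add: interp_def)
qed

lemma interp_node:
  assumes "grid p K" "k \<le> K"
  shows "interp p K g (p k) = g (p k)"
proof (cases k)
  case 0
  then show ?thesis
    using interp_eq[OF assms(1) grid_pos[OF assms(1)], of "p 0"] grid_less[OF assms(1), of 0] grid_pos[OF assms(1)]
    by simp
next
  case (Suc j)
  then show ?thesis
    using interp_eq[OF assms(1), of j "p (Suc j)" g] grid_less[OF assms(1), of j] assms(2) by simp
qed

text \<open>The interpolated value is a convex combination of the two nodal values. The
  interpolation error bounds rest on this, so they ask only for a bound on increments within one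
  cell.\<close>

lemma interp_near:
  assumes "grid p K" "k < K" "p k \<le> t" "t \<le> p (Suc k)"
    and "\<bar>v - g (p k)\<bar> \<le> D" "\<bar>v - g (p (Suc k))\<bar> \<le> D"
  shows "\<bar>v - interp p K g t\<bar> \<le> D"
proof -
  define \<theta> where "\<theta> = (t - p k) / (p (Suc k) - p k)"
  have \<theta>: "0 \<le> \<theta>" "\<theta> \<le> 1"
    using assms grid_less[OF assms(1,2)] by (auto simp: \<theta>_def)
  have "v - interp p K g t = (1 - \<theta>) * (v - g (p k)) + \<theta> * (v - g (p (Suc k)))"
    unfolding interp_eq[OF assms(1-4)] \<theta>_def[symmetric] by (simp add: algebra_simps)
  also have "\<bar>\<dots>\<bar> \<le> (1 - \<theta>) * \<bar>v - g (p k)\<bar> + \<theta> * \<bar>v - g (p (Suc k))\<bar>"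
    using \<theta> by (intro order_trans[OF abs_triangle_ineq]) (simp add: abs_mult)
  also have "\<dots> \<le> (1 - \<theta>) * D + \<theta> * D"
    using \<theta> assms(5,6) by (intro add_mono mult_left_mono) auto
  finally show ?thesis by (simp add: algebra_simps)
qed

lemma slope_diff: "slope p K (\<lambda>s. g s - h s) t = slope p K g t - slope p K h t"
  unfolding slope_def sum_subtractf[symmetric]
  by (intro sum.cong refl) (simp add: diff_divide_distrib add_divide_distrib algebra_simps)

lemma slope_interp: "grid p K \<Longrightarrow> slope p K (interp p K g) t = slope p K g t"
  unfolding slope_def by (intro sum.cong) (simp_all add: interp_node)

lemma pwlin_deriv:
  assumes "grid p K" "pwlin p K g" "t \<in> {-1<..<1} - p ` {..K}"
  shows "(g has_real_derivative slope p K g t) (at t)"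
proof -
  obtain k where k: "k < K" "p k \<le> t" "t < p (Suc k)"
    using grid_cell[OF assms(1), of t] assms(3) by auto
  moreover have "p k \<noteq> t" using assms(3) k(1) by auto
  ultimately have t: "t \<in> {p k<..<p (Suc k)}" by auto
  obtain r s where rs: "\<And>t. t \<in> {p k..p (Suc k)} \<Longrightarrow> g t = r + s * t"
    using assms(2) k(1) unfolding pwlin_def by blast
  have "slope p K g t = s"
    using grid_less[OF assms(1) k(1)] rs[of "p k"] rs[of "p (Suc k)"]
    by (simp add: slope_eq[OF assms(1) k] field_simps)
  moreover have "((\<lambda>t. r + s * t) has_real_derivative s) (at t)"
    by (auto intro!: derivative_eq_intros)
  then have "(g has_real_derivative s) (at t)"
    by (rule has_field_derivative_transform_within_open[OF _ open_greaterThanLessThan t])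
       (use rs in auto)
  ultimately show ?thesis by simp
qed

lemma has_integral_grid:
  assumes "grid p K" "\<And>k. k < K \<Longrightarrow> (F has_integral (0::real)) {p k..p (Suc k)}"
  shows "(F has_integral 0) {-1..1}"
proof -
  have "(F has_integral 0) {p 0..p n}" if "n \<le> K" for n
    using that
  proof (induction n)
    case (Suc n)
    then show ?case
      using has_integral_combine[of "p 0" "p n" "p (Suc n)" F 0 0] grid_mono[OF assms(1), of 0 n]
        grid_less[OF assms(1), of n] assms(2)[of n] by simp
  qed (simp add: has_integral_refl)
  from this[of K] show ?thesis using assms(1) by (simp add: grid_def)
qed

text \<open>On every cell \<open>slope h\<close> is constant and \<open>g' - slope g\<close> has mean value \<open>0\<close>.\<close>

lemma slope_orthogonal:
  assumes "grid p K" "continuous_on {-1..1} g"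
    and g': "\<And>t. t \<in> {-1<..<1} \<Longrightarrow> (g has_real_derivative g' t) (at t)"
  shows "((\<lambda>t. (g' t - slope p K g t) * slope p K h t) has_integral 0) {-1..1}"
proof (rule has_integral_grid[OF assms(1)])
  fix k assume k: "k < K"
  note less = grid_less[OF assms(1) k]
  have b: "-1 \<le> p k" "p (Suc k) \<le> 1" using grid_bounds[OF assms(1)] k by auto
  define s where "s = (g (p (Suc k)) - g (p k)) / (p (Suc k) - p k)"
  define r where "r = (h (p (Suc k)) - h (p k)) / (p (Suc k) - p k)"
  have 1: "(g' has_integral (g (p (Suc k)) - g (p k))) {p k..p (Suc k)}"
  proof (rule fundamental_theorem_of_calculus_interior)
    show "continuous_on {p k..p (Suc k)} g" using assms(2) b by (auto intro: continuous_on_subset)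
    show "(g has_vector_derivative g' t) (at t)" if "t \<in> {p k<..<p (Suc k)}" for t
      using g'[of t] that b by (auto simp: has_real_derivative_iff_has_vector_derivative)
  qed (use less in simp)
  have 2: "((\<lambda>t. s) has_integral (g (p (Suc k)) - g (p k))) {p k..p (Suc k)}"
    using has_integral_const_real[of s "p k" "p (Suc k)"] less by (simp add: s_def)
  have "((\<lambda>t. g' t - s) has_integral 0) {p k..p (Suc k)}"
    using has_integral_diff[OF 1 2] by simp
  then have "((\<lambda>t. (g' t - s) * r) has_integral 0) {p k..p (Suc k)}"
    using has_integral_mult_left[of _ 0 _ r] by simp
  then show "((\<lambda>t. (g' t - slope p K g t) * slope p K h t) has_integral 0) {p k..p (Suc k)}"
    \<comment> \<open>At the right end of the cell \<open>slope\<close> no longer takes the value of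
      this cell; one point does not affect the integral.\<close>
    by (rule has_integral_spike_finite[of "{p (Suc k)}", rotated 2])
       (auto simp: slope_eq[OF assms(1) k] s_def r_def)
qed

section \<open>Interpolation of functions on the square in one variable at a time\<close>

definition Dx :: "(nat \<Rightarrow> real) \<Rightarrow> nat \<Rightarrow> (real \<times> real \<Rightarrow> real) \<Rightarrow> real \<times> real \<Rightarrow> real" where
  "Dx p K v z = slope p K (\<lambda>s. v (s, snd z)) (fst z)"

definition Dy :: "(nat \<Rightarrow> real) \<Rightarrow> nat \<Rightarrow> (real \<times> real \<Rightarrow> real) \<Rightarrow> real \<times> real \<Rightarrow> real" where
  "Dy q L v z = slope q L (\<lambda>s. v (fst z, s)) (snd z)"

definition Ix :: "(nat \<Rightarrow> real) \<Rightarrow> nat \<Rightarrow> (real \<times> real \<Rightarrow> real) \<Rightarrow> real \<times> real \<Rightarrow> real" where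
  "Ix p K v z = interp p K (\<lambda>s. v (s, snd z)) (fst z)"

definition Iy :: "(nat \<Rightarrow> real) \<Rightarrow> nat \<Rightarrow> (real \<times> real \<Rightarrow> real) \<Rightarrow> real \<times> real \<Rightarrow> real" where
  "Iy q L v z = interp q L (\<lambda>s. v (fst z, s)) (snd z)"

lemma Dx_swap: "Dx p K (swap v) = swap (Dy p K v)" by (auto simp: Dx_def Dy_def swap_def)

lemma Ix_swap: "Ix p K (swap v) = swap (Iy p K v)" by (auto simp: Ix_def Iy_def swap_def)

lemma continuous_on_slice:
  assumes "continuous_on Omega_bar v" "x \<in> {-1..1}"
  shows "continuous_on Omega_bar (\<lambda>z. v (x, snd z))"
  by (rule continuous_on_compose2[OF assms(1)]) (use assms(2) in \<open>auto intro!: continuous_intros\<close>)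

lemma continuous_on_swap:
  assumes "continuous_on Omega_bar v"
  shows "continuous_on Omega_bar (swap v)" using C_k_swap[of 0 v] assms by simp

lemma continuous_on_Ix:
  assumes "grid p K" "continuous_on Omega_bar v"
  shows "continuous_on Omega_bar (Ix p K v)"
proof -
  have "continuous_on Omega_bar (\<lambda>z. v (p k, snd z))" if "k \<le> K" for k
    using grid_bounds[OF assms(1) that] by (intro continuous_on_slice[OF assms(2)]) auto
  then show ?thesis
    unfolding Ix_def[abs_def] interp_def divide_inverse by (intro continuous_intros) auto
qed

lemma continuous_on_Iy:
  assumes "grid q L" "continuous_on Omega_bar v"
  shows "continuous_on Omega_bar (Iy q L v)"
  using continuous_on_swap[OF continuous_on_Ix[OF assms(1) continuous_on_swap[OF assms(2)]]]
  by (simp add: Ix_swap)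

lemma BM_Dx:
  assumes "grid p K" "continuous_on Omega_bar v"
  shows "BM (Dx p K v)"
proof -
  have "BM (\<lambda>z. v (p k, snd z))" if "k \<le> K" for k
    using grid_bounds[OF assms(1) that] by (intro BM_continuous continuous_on_slice[OF assms(2)]) auto
  moreover have "BM (\<lambda>z. indicator {p k..<p (Suc k)} (fst z))" for k
    by (rule BM_fst[of _ 1]) (auto simp: indicator_def)
  ultimately show ?thesis
    unfolding Dx_def[abs_def] slope_def divide_inverse
    by (intro BM_sum BM_mult BM_diff BM_const) auto
qed

lemma X1_pwlin:
  assumes "grid p K" "continuous_on Omega_bar v" "\<And>y. y \<in> {-1..1} \<Longrightarrow> pwlin p K (\<lambda>x. v (x, y))"
  shows "X1 v (Dx p K v)"
proof -
  have "continuous_on {-1..1} (\<lambda>x. v (x, y))" if "\<bar>y\<bar> < 1" for y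
    by (rule continuous_on_compose2[OF assms(2), of "{-1..1}" "\<lambda>x. (x, y)"])
       (use that in \<open>auto intro!: continuous_intros simp: abs_less_iff\<close>)
  moreover have "((\<lambda>x. v (x, y)) has_real_derivative Dx p K v (x, y)) (at x)"
    if "\<bar>y\<bar> < 1" "x \<in> {-1<..<1} - p ` {..K}" for x y
    using pwlin_deriv[OF assms(1) assms(3)[of y] that(2)] that(1) by (simp add: Dx_def abs_less_iff)
  ultimately show ?thesis
    unfolding X1_def using BM_continuous[OF assms(2)] BM_Dx[OF assms(1,2)]
    by (intro conjI exI[of _ "p ` {..K}"]) auto
qed

text \<open>\<open>Iy\<close> is a linear combination of the finitely many slices
  \<open>u (x, q j)\<close> with coefficients free of \<open>x\<close>, so it commutes with
  differentiation in \<open>x\<close>.\<close>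

lemma Iy_deriv:
  assumes q: "grid q L" and u: "C_k (Suc k) u" and x: "x \<in> {-1<..<1}"
  shows "((\<lambda>x. Iy q L u (x, y)) has_real_derivative Iy q L (pdx u) (x, y)) (at x)"
proof -
  have d: "((\<lambda>x. u (x, q j)) has_real_derivative pdx u (x, q j)) (at x)" if "j \<le> L" for j
    using pdx_deriv[OF u, of x "q j"] grid_bounds[OF q that] x by (simp add: at_within_Icc_at)
  show ?thesis
    unfolding Iy_def interp_def fst_conv snd_conv
    by (intro DERIV_add DERIV_sum DERIV_cmult_right DERIV_diff d) auto
qed

text \<open>By \<open>Iy_deriv\<close>, \<open>Iy q L (pdx u)\<close> is the x-derivative of
  \<open>Iy q L u\<close> on every horizontal line, so \<open>slope_orthogonal\<close> applies line
  by line. What is left in the diffusion term is \<open>pdx u - Iy q L (pdx u)\<close>.\<close>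

lemma Iy_orthogonal:
  assumes p: "grid p K" and q: "grid q L" and u: "C_k (Suc k) u" and v: "continuous_on Omega_bar v"
  shows "J (\<lambda>z. (Iy q L (pdx u) z - Dx p K (Iy q L u) z) * Dx p K v z) = 0"
proof (rule J_zero_x)
  have ux: "continuous_on Omega_bar (pdx u)" using u C_k_continuous[of k "pdx u"] by simp
  show "BM (\<lambda>z. (Iy q L (pdx u) z - Dx p K (Iy q L u) z) * Dx p K v z)"
    using continuous_on_Iy[OF q ux] continuous_on_Iy[OF q C_k_continuous[OF u]] p v
    by (intro BM_mult BM_diff BM_Dx BM_continuous)
  fix y :: real assume y: "\<bar>y\<bar> < 1"
  have "continuous_on {-1..1} (\<lambda>x. Iy q L u (x, y))"
    by (rule continuous_on_compose2[OF continuous_on_Iy[OF q C_k_continuous[OF u]], of "{-1..1}" "\<lambda>x. (x, y)"])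
       (use y in \<open>auto intro!: continuous_intros simp: abs_less_iff\<close>)
  from slope_orthogonal[OF p this Iy_deriv[OF q u]]
  show "((\<lambda>x. (Iy q L (pdx u) (x, y) - Dx p K (Iy q L u) (x, y)) * Dx p K v (x, y)) has_integral 0) {-1..1}"
    by (simp add: Dx_def)
qed


section \<open>The finite element space\<close>

text \<open>The finite element space over two abstract partitions, in a form symmetric under
  \<open>swap\<close>; \<open>FE_space_FES\<close> identifies it with
  \<open>FE_space\<close>.\<close>

definition FES :: "(nat \<Rightarrow> real) \<Rightarrow> nat \<Rightarrow> (nat \<Rightarrow> real) \<Rightarrow> nat \<Rightarrow> (real \<times> real \<Rightarrow> real) set" where
  "FES p K q L = {v. continuous_on Omega_bar v \<and> (\<forall>z\<in>frontier Omega. v z = 0) \<and>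
     (\<forall>k<K. \<forall>l<L. \<exists>a b c d. \<forall>x\<in>{p k..p (Suc k)}. \<forall>y\<in>{q l..q (Suc l)}.
        v (x, y) = a + b * x + c * y + d * x * y)}"

lemma FES_continuous: "v \<in> FES p K q L \<Longrightarrow> continuous_on Omega_bar v"
  by (simp add: FES_def)

lemma FES_frontier: "v \<in> FES p K q L \<Longrightarrow> z \<in> frontier Omega \<Longrightarrow> v z = 0"
  by (simp add: FES_def)

lemma FES_bilinear:
  assumes "v \<in> FES p K q L" "k < K" "l < L"
  obtains a b c d where "\<And>x y. x \<in> {p k..p (Suc k)} \<Longrightarrow> y \<in> {q l..q (Suc l)} \<Longrightarrow>
        v (x, y) = a + b * x + c * y + d * x * y" using assms unfolding FES_def by blast

lemma FES_pwlin:
  assumes "grid q L" "v \<in> FES p K q L" "y \<in> {-1..1}"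
  shows "pwlin p K (\<lambda>x. v (x, y))"
  unfolding pwlin_def
proof (intro allI impI)
  fix k assume k: "k < K"
  obtain l where l: "l < L" "q l \<le> y" "y \<le> q (Suc l)"
    using grid_closed_cell[OF assms(1,3)] .
  obtain a b c d where abcd: "\<And>x y. x \<in> {p k..p (Suc k)} \<Longrightarrow> y \<in> {q l..q (Suc l)} \<Longrightarrow>
        v (x, y) = a + b * x + c * y + d * x * y" using FES_bilinear[OF assms(2) k l(1)] by blast
  have "\<forall>t\<in>{p k..p (Suc k)}. v (t, y) = (a + c * y) + (b + d * y) * t"
    using abcd l by (auto simp: algebra_simps)
  then show "\<exists>r s. \<forall>t\<in>{p k..p (Suc k)}. v (t, y) = r + s * t" by blast
qed

lemma FES_swap:
  assumes "v \<in> FES p K q L"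
  shows "swap v \<in> FES q L p K"
proof -
  have "\<exists>a b c d. \<forall>x\<in>{q l..q (Suc l)}. \<forall>y\<in>{p k..p (Suc k)}. swap v (x, y) = a + b * x + c * y + d * x * y"
    if kl: "k < K" "l < L" for k l
  proof -
    obtain a b c d where "\<And>x y. x \<in> {p k..p (Suc k)} \<Longrightarrow> y \<in> {q l..q (Suc l)} \<Longrightarrow>
        v (x, y) = a + b * x + c * y + d * x * y" using FES_bilinear[OF assms kl] by blast
    then have "\<forall>x\<in>{q l..q (Suc l)}. \<forall>y\<in>{p k..p (Suc k)}. swap v (x, y) = a + c * x + b * y + d * x * y"
      by (auto simp: algebra_simps)
    then show ?thesis by blast
  qed
  moreover have "swap v z = 0" if "z \<in> frontier Omega" for z
    using that FES_frontier[OF assms, of "(snd z, fst z)"] unfolding frontier_Omega swap_def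
    by (cases z) auto
  ultimately show ?thesis
    using continuous_on_swap[OF FES_continuous[OF assms]] unfolding FES_def by blast
qed

lemma FES_X1:
  assumes "grid p K" "grid q L" "v \<in> FES p K q L"
  shows "X1 v (Dx p K v)"
  by (rule X1_pwlin[OF assms(1) FES_continuous[OF assms(3)] FES_pwlin[OF assms(2,3)]])

lemma FES_Y1:
  assumes "grid p K" "grid q L" "v \<in> FES p K q L"
  shows "Y1 v (Dy q L v)"
  using FES_X1[OF assms(2,1) FES_swap[OF assms(3)]] by (simp add: Y1_def Dx_swap)

lemma FES_diff:
  assumes "v \<in> FES p K q L" "w \<in> FES p K q L"
  shows "(\<lambda>z. v z - w z) \<in> FES p K q L"
proof -
  have "\<exists>a b c d. \<forall>x\<in>{p k..p (Suc k)}. \<forall>y\<in>{q l..q (Suc l)}. v (x, y) - w (x, y) = a + b * x + c * y + d * x * y"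
    if kl: "k < K" "l < L" for k l
  proof -
    obtain a b c d where 1: "\<And>x y. x \<in> {p k..p (Suc k)} \<Longrightarrow> y \<in> {q l..q (Suc l)} \<Longrightarrow>
        v (x, y) = a + b * x + c * y + d * x * y" using FES_bilinear[OF assms(1) kl] by blast
    obtain a' b' c' d' where 2: "\<And>x y. x \<in> {p k..p (Suc k)} \<Longrightarrow> y \<in> {q l..q (Suc l)} \<Longrightarrow>
        w (x, y) = a' + b' * x + c' * y + d' * x * y" using FES_bilinear[OF assms(2) kl] by blast
    have "v (x, y) - w (x, y) = (a - a') + (b - b') * x + (c - c') * y + (d - d') * x * y"
      if "x \<in> {p k..p (Suc k)}" "y \<in> {q l..q (Suc l)}" for x y
      unfolding 1[OF that] 2[OF that] by (simp add: algebra_simps)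
    then show ?thesis by blast
  qed
  then show ?thesis using assms unfolding FES_def by (auto intro: continuous_on_diff)
qed

lemma FES_interpolant:
  assumes p: "grid p K" and q: "grid q L"
    and u: "continuous_on Omega_bar u" "\<And>z. z \<in> frontier Omega \<Longrightarrow> u z = 0"
  shows "Ix p K (Iy q L u) \<in> FES p K q L"
proof -
  let ?w = "Ix p K (Iy q L u)"
  have "continuous_on Omega_bar ?w" by (intro continuous_on_Ix continuous_on_Iy p q u)
  moreover have "?w z = 0" if "z \<in> frontier Omega" for z
  proof -
    obtain x y where z: "z = (x, y)" "x \<in> {-1..1}" "y \<in> {-1..1}" "x = -1 \<or> x = 1 \<or> y = -1 \<or> y = 1"
      using \<open>z \<in> frontier Omega\<close> by (cases z) (auto simp: frontier_Omega)
    have pq: "p 0 = -1" "p K = 1" "q 0 = -1" "q L = 1" using p q by (auto simp: grid_def)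
    show ?thesis
    \<comment> \<open>On a horizontal edge interpolation in \<open>y\<close> reproduces the zero
      boundary value at every x-node; on a vertical edge all values entering it are zero.\<close>
    proof (cases "y = -1 \<or> y = 1")
      case True
      then have "Iy q L u (p k, y) = 0" if "k \<le> K" for k
        using interp_node[OF q, of 0] interp_node[OF q, of L] pq u(2) grid_bounds[OF p that]
        by (auto simp: Iy_def frontier_Omega)
      then have "interp p K (\<lambda>s. Iy q L u (s, y)) x = 0"
        unfolding interp_def by simp
      then show ?thesis by (simp add: Ix_def z(1))
    next
      case False
      then have x: "x = -1 \<or> x = 1" using z by auto
      then have "u (x, q l) = 0" if "l \<le> L" for l
        using u(2) grid_bounds[OF q that] by (auto simp: frontier_Omega)
      then have "Iy q L u (x, y) = 0"
        unfolding Iy_def interp_def by simp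
      moreover have "?w z = Iy q L u (x, y)"
        using interp_node[OF p, of 0] interp_node[OF p, of K] pq x by (auto simp: Ix_def z(1))
      ultimately show ?thesis by simp
    qed
  qed
  moreover have "\<exists>a b c d. \<forall>x\<in>{p k..p (Suc k)}. \<forall>y\<in>{q l..q (Suc l)}. ?w (x, y) = a + b * x + c * y + d * x * y"
    if kl: "k < K" "l < L" for k l
  proof -
    define H where "H = p (Suc k) - p k"
    define G where "G = q (Suc l) - q l"
    let ?A = "u (p k, q l)" and ?B = "u (p k, q (Suc l))"
    let ?C = "u (p (Suc k), q l)" and ?D = "u (p (Suc k), q (Suc l))"
    have "?w (x, y) = (?A + (?B - ?A) * ((y - q l) / G)) +
        ((?C + (?D - ?C) * ((y - q l) / G)) - (?A + (?B - ?A) * ((y - q l) / G))) * ((x - p k) / H)"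
      if "x \<in> {p k..p (Suc k)}" "y \<in> {q l..q (Suc l)}" for x y
      using that kl by (simp add: Ix_def Iy_def interp_eq[OF p, of k] interp_eq[OF q, of l] G_def H_def)
    moreover have "\<exists>a b c d. \<forall>x y. (A + (B - A) * ((y - t) / G)) +
        ((C + (D - C) * ((y - t) / G)) - (A + (B - A) * ((y - t) / G))) * ((x - s) / H) =
        a + b * x + c * y + d * x * y" for A B C D s t :: real
    proof -
      \<comment> \<open>The mixed second difference, which up to scaling is the coefficient of the
        monomial x y.\<close>
      define E where "E = D - C - B + A"
      have "(A + (B - A) * ((y - t) / G)) +
        ((C + (D - C) * ((y - t) / G)) - (A + (B - A) * ((y - t) / G))) * ((x - s) / H) =
        (A - (B - A) / G * t - (C - A) / H * s + E / G / H * s * t) +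
        ((C - A) / H - E / G / H * t) * x + ((B - A) / G - E / G / H * s) * y + (E / G / H) * x * y" for x y
        unfolding divide_inverse E_def by (simp add: algebra_simps)
      then show ?thesis by blast
    qed
    ultimately show ?thesis by metis
  qed
  ultimately show ?thesis
    unfolding FES_def by blast
qed


section \<open>Stability\<close>

text \<open>The two diffusion terms only see the error of interpolation in the respective other
  variable, by \<open>Iy_orthogonal\<close>.\<close>

lemma discrete_stability:
  assumes p: "grid p K" and q: "grid q L" and u: "C_k (Suc (Suc k)) u"
    and ub: "\<And>z. z \<in> frontier Omega \<Longrightarrow> u z = 0"
    and ws: "weak_solution \<epsilon> a c f u"
    and uh: "uh \<in> FES p K q L" "\<And>v. v \<in> FES p K q L \<Longrightarrow> B_form \<epsilon> a c uh v = ip f v"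
    and b: "X1 (b1 a) bx" and bm: "BM c" "BM f"
    and coercive: "\<And>z. z \<in> Omega \<Longrightarrow> \<gamma> \<le> c z - 1 / 2 * bx z" and pos: "0 < \<epsilon>" "0 < \<gamma>"
  defines "w \<equiv> Ix p K (Iy q L u)"
  shows "\<gamma> * J (\<lambda>z. (w z - uh z)\<^sup>2) \<le>
      \<epsilon> * J (\<lambda>z. (pdx u z - Iy q L (pdx u) z)\<^sup>2) + \<epsilon> * J (\<lambda>z. (pdy u z - Ix p K (pdy u) z)\<^sup>2)
      + 1 / \<gamma> * J (\<lambda>z. (b1 a z * (pdx u z - Dx p K w z) + c z * (u z - w z))\<^sup>2)"
proof -
  define \<xi> where "\<xi> = (\<lambda>z. w z - uh z)"
  define \<phi>1 where "\<phi>1 = (\<lambda>z. pdx u z - Iy q L (pdx u) z)"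
  define \<phi>2 where "\<phi>2 = (\<lambda>z. pdy u z - Ix p K (pdy u) z)"
  define \<phi>3 where "\<phi>3 = (\<lambda>z. b1 a z * (pdx u z - Dx p K w z) + c z * (u z - w z))"
  have w: "w \<in> FES p K q L"
    unfolding w_def by (rule FES_interpolant[OF p q C_k_continuous[OF u] ub])
  have \<xi>: "\<xi> \<in> FES p K q L"
    unfolding \<xi>_def by (rule FES_diff[OF w uh(1)])
  define \<xi>x where "\<xi>x = Dx p K \<xi>"
  define \<xi>y where "\<xi>y = Dy q L \<xi>"
  have X: "X1 \<xi> \<xi>x" and Y: "Y1 \<xi> \<xi>y"
    unfolding \<xi>x_def \<xi>y_def by (rule FES_X1[OF p q \<xi>], rule FES_Y1[OF p q \<xi>])
  have ux: "C_k (Suc k) (pdx u)" and uy: "C_k (Suc k) (pdy u)" using u by simp_all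
  have bmb: "BM (b1 a)" "BM bx" by (rule X1_BM[OF b])+
  note bmX = X1_BM[OF X] Y1_BM[OF Y]
  note bmu = X1_BM[OF X1_C_k[OF u]] Y1_BM[OF Y1_C_k[OF u]]
  note bmh = X1_BM[OF FES_X1[OF p q uh(1)]] Y1_BM[OF FES_Y1[OF p q uh(1)]]
  note bmw = X1_BM[OF FES_X1[OF p q w]] Y1_BM[OF FES_Y1[OF p q w]]
  have bmI: "BM (Iy q L (pdx u))" "BM (Ix p K (pdy u))"
    by (intro BM_continuous continuous_on_Iy continuous_on_Ix p q C_k_continuous[OF ux] C_k_continuous[OF uy])+
  have bm\<phi>: "BM \<phi>1" "BM \<phi>2" "BM \<phi>3"
    unfolding \<phi>1_def \<phi>2_def \<phi>3_def using bm bmb bmu bmw bmI by (auto intro!: BM_diff BM_mult BM_add)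
  have hx: "Dx p K uh z = Dx p K w z - \<xi>x z" for z
    unfolding \<xi>x_def \<xi>_def Dx_def slope_diff by simp
  have hy: "Dy q L uh z = Dy q L w z - \<xi>y z" for z
    unfolding \<xi>y_def \<xi>_def Dy_def slope_diff by simp

  \<comment> \<open>The splitting is \<open>pdx u - Dx uh = (pdx u - Iy (pdx u)) + (Iy (pdx u) - Dx
    w) + \<xi>x\<close>, and the middle part is orthogonal to \<open>\<xi>x\<close>.\<close>
  have dx: "J (\<lambda>z. pdx u z * \<xi>x z) - J (\<lambda>z. Dx p K uh z * \<xi>x z) = J (\<lambda>z. \<phi>1 z * \<xi>x z) + J (\<lambda>z. (\<xi>x z)\<^sup>2)"
  proof -
    have "Dx p K w z = Dx p K (Iy q L u) z" for z
      unfolding w_def Dx_def Ix_def fst_conv snd_conv by (rule slope_interp[OF p])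
    then have 0: "J (\<lambda>z. (Iy q L (pdx u) z - Dx p K w z) * \<xi>x z) = 0"
      using Iy_orthogonal[OF p q u FES_continuous[OF \<xi>]] by (simp add: \<xi>x_def)
    have "J (\<lambda>z. pdx u z * \<xi>x z) - J (\<lambda>z. Dx p K uh z * \<xi>x z) = J (\<lambda>z. pdx u z * \<xi>x z - Dx p K uh z * \<xi>x z)"
      using bmX bmu bmh by (intro J_diff[symmetric] BM_mult)
    also have "\<dots> = J (\<lambda>z. (\<phi>1 z * \<xi>x z + (\<xi>x z)\<^sup>2) + (Iy q L (pdx u) z - Dx p K w z) * \<xi>x z)"
      by (rule J_cong) (simp add: hx \<phi>1_def algebra_simps power2_eq_square)
    also have "\<dots> = J (\<lambda>z. \<phi>1 z * \<xi>x z + (\<xi>x z)\<^sup>2) + J (\<lambda>z. (Iy q L (pdx u) z - Dx p K w z) * \<xi>x z)"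
      using bmX bm\<phi> bmI bmw by (intro J_add BM_mult BM_add BM_diff BM_power)
    also have "\<dots> = J (\<lambda>z. \<phi>1 z * \<xi>x z) + J (\<lambda>z. (\<xi>x z)\<^sup>2)"
      unfolding 0 using bmX bm\<phi> by (simp add: J_add BM_mult BM_power)
    finally show ?thesis .
  qed
  have dy: "J (\<lambda>z. pdy u z * \<xi>y z) - J (\<lambda>z. Dy q L uh z * \<xi>y z) = J (\<lambda>z. \<phi>2 z * \<xi>y z) + J (\<lambda>z. (\<xi>y z)\<^sup>2)"
  proof -
    \<comment> \<open>\<open>Dy\<close> reads its argument only on the mesh lines y = q l, where
      \<open>w\<close> coincides with \<open>Ix p K u\<close>; this makes the orthogonality in
      \<open>x\<close> applicable after \<open>swap\<close>.\<close>
    have "w (x, q l) = Ix p K u (x, q l)" if "l \<le> L" for x l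
      unfolding w_def Ix_def Iy_def fst_conv snd_conv by (simp add: interp_node[OF q that])
    then have Dw: "Dy q L w = Dy q L (Ix p K u)"
      unfolding Dy_def slope_def by (intro ext sum.cong) auto
    have "J (\<lambda>z. (Ix p K (pdy u) z - Dy q L (Ix p K u) z) * Dy q L \<xi> z) = 0"
    proof -
      have "swap (\<lambda>z. (Ix p K (pdy u) z - Dy q L (Ix p K u) z) * Dy q L \<xi> z) =
          (\<lambda>z. (Iy p K (pdx (swap u)) z - Dx q L (Iy p K (swap u)) z) * Dx q L (swap \<xi>) z)"
        by (auto simp: pdx_swap Dx_swap[symmetric] swap_def Ix_def Iy_def Dx_def Dy_def)
      moreover have "J (\<lambda>z. (Iy p K (pdx (swap u)) z - Dx q L (Iy p K (swap u)) z) * Dx q L (swap \<xi>) z) = 0"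
        by (rule Iy_orthogonal[OF q p C_k_swap[OF u] FES_continuous[OF FES_swap[OF \<xi>]]])
      moreover have "BM (\<lambda>z. (Ix p K (pdy u) z - Dy q L (Ix p K u) z) * Dy q L \<xi> z)"
        using bmI bmw bmX unfolding \<xi>y_def[symmetric] Dw[symmetric] by (intro BM_mult BM_diff)
      ultimately show ?thesis using J_swap by metis
    qed
    then have 0: "J (\<lambda>z. (Ix p K (pdy u) z - Dy q L w z) * \<xi>y z) = 0"
      by (simp add: \<xi>y_def Dw)
    have "J (\<lambda>z. pdy u z * \<xi>y z) - J (\<lambda>z. Dy q L uh z * \<xi>y z) = J (\<lambda>z. pdy u z * \<xi>y z - Dy q L uh z * \<xi>y z)"
      using bmX bmu bmh by (intro J_diff[symmetric] BM_mult)
    also have "\<dots> = J (\<lambda>z. (\<phi>2 z * \<xi>y z + (\<xi>y z)\<^sup>2) + (Ix p K (pdy u) z - Dy q L w z) * \<xi>y z)"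
      by (rule J_cong) (simp add: hy \<phi>2_def algebra_simps power2_eq_square)
    also have "\<dots> = J (\<lambda>z. \<phi>2 z * \<xi>y z + (\<xi>y z)\<^sup>2) + J (\<lambda>z. (Ix p K (pdy u) z - Dy q L w z) * \<xi>y z)"
      using bmX bm\<phi> bmI bmw by (intro J_add BM_mult BM_add BM_diff BM_power)
    also have "\<dots> = J (\<lambda>z. \<phi>2 z * \<xi>y z) + J (\<lambda>z. (\<xi>y z)\<^sup>2)"
      unfolding 0 using bmX bm\<phi> by (simp add: J_add BM_mult BM_power)
    finally show ?thesis .
  qed
  have conv: "J (\<lambda>z. b1 a z * pdx u z * \<xi> z) + J (\<lambda>z. c z * u z * \<xi> z)
      - (J (\<lambda>z. b1 a z * Dx p K uh z * \<xi> z) + J (\<lambda>z. c z * uh z * \<xi> z))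
      = J (\<lambda>z. \<phi>3 z * \<xi> z) + J (\<lambda>z. (b1 a z * \<xi> z) * \<xi>x z) + J (\<lambda>z. c z * (\<xi> z)\<^sup>2)"
  proof -
    have "J (\<lambda>z. b1 a z * pdx u z * \<xi> z) + J (\<lambda>z. c z * u z * \<xi> z)
      - (J (\<lambda>z. b1 a z * Dx p K uh z * \<xi> z) + J (\<lambda>z. c z * uh z * \<xi> z))
      = J (\<lambda>z. (b1 a z * pdx u z * \<xi> z + c z * u z * \<xi> z) - (b1 a z * Dx p K uh z * \<xi> z + c z * uh z * \<xi> z))"
      using bm bmb bmu bmX bmh by (simp add: J_diff J_add BM_add BM_mult)
    also have "\<dots> = J (\<lambda>z. \<phi>3 z * \<xi> z + (b1 a z * \<xi> z) * \<xi>x z + c z * (\<xi> z)\<^sup>2)"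
      by (rule J_cong) (simp add: hx \<phi>3_def \<xi>_def algebra_simps power2_eq_square)
    also have "\<dots> = J (\<lambda>z. \<phi>3 z * \<xi> z) + J (\<lambda>z. (b1 a z * \<xi> z) * \<xi>x z) + J (\<lambda>z. c z * (\<xi> z)\<^sup>2)"
      using bm bmb bmX bm\<phi> by (simp add: J_add BM_add BM_mult BM_power)
    finally show ?thesis .
  qed
  have coer: "\<gamma> * J (\<lambda>z. (\<xi> z)\<^sup>2) \<le> J (\<lambda>z. (b1 a z * \<xi> z) * \<xi>x z) + J (\<lambda>z. c z * (\<xi> z)\<^sup>2)"
  proof -
    have [simp]: "\<xi> (-1, y) = 0" "\<xi> (1, y) = 0" if "\<bar>y\<bar> < 1" for y
      using FES_frontier[OF \<xi>] that by (auto simp: frontier_Omega abs_less_iff)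
    \<comment> \<open>Integration by parts with the factors \<open>b1 a * \<xi>\<close> and
      \<open>\<xi>\<close> returns the same integral with opposite sign, so the convection term is
      -1/2 times the integral of \<open>bx * \<xi>^2\<close>.\<close>
    have "J (\<lambda>z. (bx z * \<xi> z + b1 a z * \<xi>x z) * \<xi> z) = - J (\<lambda>z. (b1 a z * \<xi> z) * \<xi>x z)"
      by (rule X1_parts[OF X1_mult[OF b X] X]) simp
    moreover have "J (\<lambda>z. (bx z * \<xi> z + b1 a z * \<xi>x z) * \<xi> z) = J (\<lambda>z. bx z * (\<xi> z)\<^sup>2 + (b1 a z * \<xi> z) * \<xi>x z)"
      by (rule J_cong) (simp add: algebra_simps power2_eq_square)
    moreover have "\<dots> = J (\<lambda>z. bx z * (\<xi> z)\<^sup>2) + J (\<lambda>z. (b1 a z * \<xi> z) * \<xi>x z)"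
      using bmb bmX by (simp add: J_add BM_mult BM_power)
    ultimately have eq: "J (\<lambda>z. (b1 a z * \<xi> z) * \<xi>x z) = - 1 / 2 * J (\<lambda>z. bx z * (\<xi> z)\<^sup>2)"
      by simp
    have "\<gamma> * J (\<lambda>z. (\<xi> z)\<^sup>2) \<le> J (\<lambda>z. (- 1 / 2) * (bx z * (\<xi> z)\<^sup>2) + c z * (\<xi> z)\<^sup>2)"
      unfolding J_cmult[symmetric]
    proof (rule J_mono)
      fix z assume "z \<in> Omega"
      then have "\<gamma> * (\<xi> z)\<^sup>2 \<le> (c z - 1 / 2 * bx z) * (\<xi> z)\<^sup>2"
        using coercive by (intro mult_right_mono) auto
      then show "\<gamma> * (\<xi> z)\<^sup>2 \<le> (- 1 / 2) * (bx z * (\<xi> z)\<^sup>2) + c z * (\<xi> z)\<^sup>2"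
        by (simp add: algebra_simps)
    next
      show "BM (\<lambda>z. \<gamma> * (\<xi> z)\<^sup>2)" by (intro BM_mult BM_power BM_const bmX)
      show "BM (\<lambda>z. (- 1 / 2) * (bx z * (\<xi> z)\<^sup>2) + c z * (\<xi> z)\<^sup>2)"
        by (intro BM_add BM_mult BM_power BM_const bmX bmb bm)
    qed
    also have "\<dots> = - 1 / 2 * J (\<lambda>z. bx z * (\<xi> z)\<^sup>2) + J (\<lambda>z. c z * (\<xi> z)\<^sup>2)"
      using bm bmb bmX by (subst J_add) (auto intro!: BM_mult BM_power BM_const simp only: J_cmult)
    finally show ?thesis using eq by simp
  qed

  have "\<epsilon> * (J (\<lambda>z. pdx u z * \<xi>x z) + J (\<lambda>z. pdy u z * \<xi>y z))
     + J (\<lambda>z. b1 a z * pdx u z * \<xi> z) + J (\<lambda>z. c z * u z * \<xi> z) = J (\<lambda>z. f z * \<xi> z)"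
    by (rule weak_solution_galerkin[OF ws u bmb(1) bm X Y FES_frontier[OF \<xi>]])
  moreover have "\<epsilon> * (J (\<lambda>z. Dx p K uh z * \<xi>x z) + J (\<lambda>z. Dy q L uh z * \<xi>y z))
     + J (\<lambda>z. b1 a z * Dx p K uh z * \<xi> z) + J (\<lambda>z. c z * uh z * \<xi> z) = J (\<lambda>z. f z * \<xi> z)"
    using uh(2)[OF \<xi>] B_form_eq[OF FES_X1[OF p q uh(1)] FES_Y1[OF p q uh(1)] X Y bmb(1) bm(1), of \<epsilon>]
    by (simp add: ip_eq_J)
  ultimately have "\<epsilon> * ((J (\<lambda>z. pdx u z * \<xi>x z) - J (\<lambda>z. Dx p K uh z * \<xi>x z))
      + (J (\<lambda>z. pdy u z * \<xi>y z) - J (\<lambda>z. Dy q L uh z * \<xi>y z)))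
      + (J (\<lambda>z. b1 a z * pdx u z * \<xi> z) + J (\<lambda>z. c z * u z * \<xi> z)
      - (J (\<lambda>z. b1 a z * Dx p K uh z * \<xi> z) + J (\<lambda>z. c z * uh z * \<xi> z))) = 0"
    by (simp add: algebra_simps)
  then have eq: "\<epsilon> * (J (\<lambda>z. \<phi>1 z * \<xi>x z) + J (\<lambda>z. (\<xi>x z)\<^sup>2) + (J (\<lambda>z. \<phi>2 z * \<xi>y z) + J (\<lambda>z. (\<xi>y z)\<^sup>2)))
      + (J (\<lambda>z. \<phi>3 z * \<xi> z) + J (\<lambda>z. (b1 a z * \<xi> z) * \<xi>x z) + J (\<lambda>z. c z * (\<xi> z)\<^sup>2)) = 0"
    unfolding dx dy conv .
  have young: "- J (\<lambda>z. F z * G z) \<le> 1 / (2 * r) * J (\<lambda>z. (F z)\<^sup>2) + r / 2 * J (\<lambda>z. (G z)\<^sup>2)"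
    if "BM F" "BM G" "r > 0" for F G r
    using J_young[of G "\<lambda>z. - F z" r] that by (simp add: J_uminus mult.commute BM_uminus)
  \<comment> \<open>The weights in Young's inequality are 1 for the diffusion terms and
    \<open>\<gamma>\<close> for the rest, so that half of each energy term on the left absorbs its
    counterpart; a final doubling restores the factor \<open>\<gamma>\<close>.\<close>
  have "\<epsilon> * (- J (\<lambda>z. \<phi>1 z * \<xi>x z) - J (\<lambda>z. \<phi>2 z * \<xi>y z)) \<le>
      \<epsilon> * ((1 / 2 * J (\<lambda>z. (\<phi>1 z)\<^sup>2) + 1 / 2 * J (\<lambda>z. (\<xi>x z)\<^sup>2)) + (1 / 2 * J (\<lambda>z. (\<phi>2 z)\<^sup>2) + 1 / 2 * J (\<lambda>z. (\<xi>y z)\<^sup>2)))"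
    using young[of \<phi>1 \<xi>x 1] young[of \<phi>2 \<xi>y 1] bm\<phi> bmX pos by (intro mult_left_mono) auto
  moreover have "- J (\<lambda>z. \<phi>3 z * \<xi> z) \<le> 1 / (2 * \<gamma>) * J (\<lambda>z. (\<phi>3 z)\<^sup>2) + \<gamma> / 2 * J (\<lambda>z. (\<xi> z)\<^sup>2)"
    using young[of \<phi>3 \<xi> \<gamma>] bm\<phi> bmX pos by simp
  moreover have "0 \<le> \<epsilon> * J (\<lambda>z. (\<xi>x z)\<^sup>2)" "0 \<le> \<epsilon> * J (\<lambda>z. (\<xi>y z)\<^sup>2)"
    using pos by (auto intro!: mult_nonneg_nonneg J_nonneg)
  ultimately have "\<gamma> / 2 * J (\<lambda>z. (\<xi> z)\<^sup>2) \<le> \<epsilon> / 2 * J (\<lambda>z. (\<phi>1 z)\<^sup>2) + \<epsilon> / 2 * J (\<lambda>z. (\<phi>2 z)\<^sup>2)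
      + 1 / (2 * \<gamma>) * J (\<lambda>z. (\<phi>3 z)\<^sup>2)"
    using eq coer by (simp add: algebra_simps)
  then have "2 * (\<gamma> / 2 * J (\<lambda>z. (\<xi> z)\<^sup>2)) \<le> 2 * (\<epsilon> / 2 * J (\<lambda>z. (\<phi>1 z)\<^sup>2) + \<epsilon> / 2 * J (\<lambda>z. (\<phi>2 z)\<^sup>2)
      + 1 / (2 * \<gamma>) * J (\<lambda>z. (\<phi>3 z)\<^sup>2))" by (rule mult_left_mono) simp
  then show ?thesis
    unfolding \<xi>_def \<phi>1_def \<phi>2_def \<phi>3_def by (simp add: algebra_simps)
qed


section \<open>Interpolation errors\<close>

lemma lipschitz_x:
  assumes g: "C_k (Suc k) g" and ab: "-1 \<le> a" "b \<le> 1" "y \<in> {-1..1}"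
    and B: "\<And>t. t \<in> {a..b} \<Longrightarrow> \<bar>pdx g (t, y)\<bar> \<le> B" and st: "s \<in> {a..b}" "t \<in> {a..b}"
  shows "\<bar>g (s, y) - g (t, y)\<bar> \<le> B * \<bar>s - t\<bar>"
proof -
  have "((\<lambda>t. g (t, y)) has_real_derivative pdx g (t, y)) (at t within {a..b})" if "t \<in> {a..b}" for t
    by (rule DERIV_subset[OF pdx_deriv[OF g]]) (use that ab in auto)
  from field_differentiable_bound[OF convex_real_interval(5) this _ st(1,2), of B] B
  show ?thesis by simp
qed

lemma lipschitz_y:
  assumes g: "C_k (Suc k) g" and ab: "-1 \<le> a" "b \<le> 1" "x \<in> {-1..1}"
    and B: "\<And>t. t \<in> {a..b} \<Longrightarrow> \<bar>pdy g (x, t)\<bar> \<le> B" and st: "s \<in> {a..b}" "t \<in> {a..b}"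
  shows "\<bar>g (x, s) - g (x, t)\<bar> \<le> B * \<bar>s - t\<bar>"
  using lipschitz_x[OF C_k_swap[OF g] ab _ st, of B] B by (simp add: pdx_swap)

text \<open>Only bounds on \<open>u\<^sub>y\<^sub>x\<close> are used to control increments of \<open>u\<^sub>x\<close> in \<open>y\<close>, so the symmetry
  of the second derivatives is not needed.\<close>

lemma pdx_increment_y:
  assumes u: "C_k (Suc (Suc k)) u" and U: "open U" "x \<in> U" "U \<subseteq> {-1<..<1}" and B: "isCont B x"
    and ab: "-1 \<le> a" "b \<le> 1"
    and bound: "\<And>x' y. x' \<in> U \<Longrightarrow> y \<in> {a..b} \<Longrightarrow> \<bar>pdx (pdy u) (x', y)\<bar> \<le> B x'"
    and st: "s \<in> {a..b}" "t \<in> {a..b}"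
  shows "\<bar>pdx u (x, s) - pdx u (x, t)\<bar> \<le> B x * \<bar>s - t\<bar>"
proof -
  have uy: "C_k (Suc k) (pdy u)" using u by simp
  have x: "x \<in> {-1<..<1}" using U by auto
  \<comment> \<open>\<open>B\<close> varies with \<open>x\<close>; by continuity it stays below
    \<open>B x + \<delta>\<close> near \<open>x\<close>, and \<open>\<delta>\<close> is sent to 0 at
    the end.\<close>
  have *: "\<bar>pdx u (x, s) - pdx u (x, t)\<bar> \<le> (B x + \<delta>) * \<bar>s - t\<bar>" if "\<delta> > 0" for \<delta>
  proof -
    have "(B \<longlongrightarrow> B x) (nhds x)"
      using B by (simp add: continuous_at tendsto_at_iff_tendsto_nhds)
    then have "\<forall>\<^sub>F x' in nhds x. B x' < B x + \<delta>"
      using that by (intro order_tendstoD(2)) auto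
    moreover have "\<forall>\<^sub>F x' in nhds x. x' \<in> U"
      using U by (intro eventually_nhds_in_open)
    ultimately have "\<forall>\<^sub>F x' in nhds x. x' \<in> U \<and> B x' < B x + \<delta>"
      by eventually_elim simp
    then obtain r where r: "r > 0" "\<And>x'. dist x' x < r \<Longrightarrow> x' \<in> U \<and> B x' < B x + \<delta>"
      by (auto simp: eventually_nhds_metric)
    \<comment> \<open>A mixed second difference of \<open>u\<close>: the bound on
      \<open>pdx (pdy u)\<close> controls the x-increment of \<open>pdy u\<close>, and the mean
      value inequality in \<open>y\<close> then controls the difference. Dividing by
      \<open>h\<close> and letting \<open>h\<close> tend to 0 yields the increment of
      \<open>pdx u\<close>.\<close>
    have incr: "\<bar>(u (x + h, s) - u (x + h, t)) - (u (x, s) - u (x, t))\<bar> \<le> (B x + \<delta>) * \<bar>h\<bar> * \<bar>s - t\<bar>"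
      if h: "\<bar>h\<bar> < r" for h
    proof -
      define a' where "a' = min x (x + h)"
      define b' where "b' = max x (x + h)"
      have seg: "x' \<in> U" "B x' < B x + \<delta>" if "x' \<in> {a'..b'}" for x'
        using r(2)[of x'] that h by (auto simp: a'_def b'_def dist_real_def)
      have ab': "-1 \<le> a'" "b' \<le> 1" "x \<in> {a'..b'}" "x + h \<in> {a'..b'}"
        using seg(1)[of "x + h"] x U(3) by (auto simp: a'_def b'_def)
      have d: "\<bar>pdy u (x + h, y) - pdy u (x, y)\<bar> \<le> (B x + \<delta>) * \<bar>h\<bar>" if y: "y \<in> {a..b}" for y
      proof -
        have "\<bar>pdx (pdy u) (t, y)\<bar> \<le> B x + \<delta>" if "t \<in> {a'..b'}" for t
          using bound[OF seg(1)[OF that] y] seg(2)[OF that] by simp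
        from lipschitz_x[OF uy ab'(1,2) _ this ab'(4,3)] y ab show ?thesis by simp
      qed
      have der: "((\<lambda>y. u (x + h, y) - u (x, y)) has_real_derivative pdy u (x + h, y) - pdy u (x, y)) (at y within {a..b})"
        if y: "y \<in> {a..b}" for y
      proof (rule DERIV_diff)
        show "((\<lambda>y. u (x + h, y)) has_real_derivative pdy u (x + h, y)) (at y within {a..b})"
          by (rule DERIV_subset[OF pdy_deriv[OF u]]) (use y ab ab' in auto)
        show "((\<lambda>y. u (x, y)) has_real_derivative pdy u (x, y)) (at y within {a..b})"
          by (rule DERIV_subset[OF pdy_deriv[OF u]]) (use y ab x in auto)
      qed
      have "norm ((u (x + h, s) - u (x, s)) - (u (x + h, t) - u (x, t))) \<le> (B x + \<delta>) * \<bar>h\<bar> * norm (s - t)"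
        by (rule field_differentiable_bound[OF convex_real_interval(5) der _ st]) (use d in auto)
      then show ?thesis by (simp add: algebra_simps)
    qed
    have "((\<lambda>x. u (x, s) - u (x, t)) has_real_derivative pdx u (x, s) - pdx u (x, t)) (at x)"
    proof (rule DERIV_diff)
      show "((\<lambda>x. u (x, s)) has_real_derivative pdx u (x, s)) (at x)"
        using pdx_deriv[OF u, of x s] st ab x by (simp add: at_within_Icc_at)
      show "((\<lambda>x. u (x, t)) has_real_derivative pdx u (x, t)) (at x)"
        using pdx_deriv[OF u, of x t] st ab x by (simp add: at_within_Icc_at)
    qed
    then have "((\<lambda>h. \<bar>((u (x + h, s) - u (x + h, t)) - (u (x, s) - u (x, t))) / h\<bar>) \<longlongrightarrow>
        \<bar>pdx u (x, s) - pdx u (x, t)\<bar>) (at 0)"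
      unfolding DERIV_def by (rule tendsto_rabs)
    moreover have "\<forall>\<^sub>F h in at 0. \<bar>((u (x + h, s) - u (x + h, t)) - (u (x, s) - u (x, t))) / h\<bar> \<le> (B x + \<delta>) * \<bar>s - t\<bar>"
      unfolding eventually_at
    proof (intro exI[of _ r] conjI ballI impI r(1))
      fix h :: real assume "h \<noteq> 0 \<and> dist h 0 < r"
      then show "\<bar>((u (x + h, s) - u (x + h, t)) - (u (x, s) - u (x, t))) / h\<bar> \<le> (B x + \<delta>) * \<bar>s - t\<bar>"
        using incr[of h] by (simp add: abs_divide pos_divide_le_eq mult.commute mult.left_commute)
    qed
    ultimately show ?thesis by (rule tendsto_upperbound) simp
  qed
  have "((\<lambda>\<delta>. (B x + \<delta>) * \<bar>s - t\<bar>) \<longlongrightarrow> (B x + 0) * \<bar>s - t\<bar>) (at_right 0)"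
    by (intro tendsto_intros)
  moreover have "\<forall>\<^sub>F \<delta> in at_right 0. \<bar>pdx u (x, s) - pdx u (x, t)\<bar> \<le> (B x + \<delta>) * \<bar>s - t\<bar>"
    using * by (auto simp: eventually_at_filter)
  ultimately have "\<bar>pdx u (x, s) - pdx u (x, t)\<bar> \<le> (B x + 0) * \<bar>s - t\<bar>"
    by (rule tendsto_lowerbound) simp
  then show ?thesis by simp
qed

text \<open>\<open>B\<close> is a function of \<open>x\<close>, so that the exponential of the layer
  can be retained at the very point \<open>x\<close> instead of being maximised over a cell.\<close>

lemma Iy_pdx_error:
  assumes q: "grid q L" "l < L" and y: "y \<in> {q l..q (Suc l)}"
    and u: "C_k (Suc (Suc k)) u" and U: "open U" "x \<in> U" "U \<subseteq> {-1<..<1}" and B: "isCont B x"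
    and bound: "\<And>x' y. x' \<in> U \<Longrightarrow> y \<in> {q l..q (Suc l)} \<Longrightarrow> \<bar>pdx (pdy u) (x', y)\<bar> \<le> B x'"
  shows "\<bar>pdx u (x, y) - Iy q L (pdx u) (x, y)\<bar> \<le> B x * (q (Suc l) - q l)"
proof -
  have ab: "-1 \<le> q l" "q (Suc l) \<le> 1" "q l < q (Suc l)"
    using grid_bounds[OF q(1)] grid_less[OF q] q(2) by auto
  have "0 \<le> B x" using bound[OF U(2) y] by simp
  then have "B x * \<bar>y - t\<bar> \<le> B x * (q (Suc l) - q l)" if "t \<in> {q l..q (Suc l)}" for t
    using that y by (intro mult_left_mono) auto
  then have "\<bar>pdx u (x, y) - pdx u (x, t)\<bar> \<le> B x * (q (Suc l) - q l)" if "t \<in> {q l..q (Suc l)}" for t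
    using that pdx_increment_y[OF u U B ab(1,2) bound y that] by (meson order_trans)
  then show ?thesis
    unfolding Iy_def fst_conv snd_conv using q y ab(3) by (intro interp_near) auto
qed

lemma Ix_pdy_error:
  assumes p: "grid p K" "k < K" and x: "x \<in> {p k..p (Suc k)}" and y: "y \<in> {-1..1}"
    and u: "C_k (Suc (Suc j)) u"
    and bound: "\<And>x'. x' \<in> {p k..p (Suc k)} \<Longrightarrow> \<bar>pdx (pdy u) (x', y)\<bar> \<le> B"
  shows "\<bar>pdy u (x, y) - Ix p K (pdy u) (x, y)\<bar> \<le> B * (p (Suc k) - p k)"
proof -
  have ab: "-1 \<le> p k" "p (Suc k) \<le> 1" "p k < p (Suc k)"
    using grid_bounds[OF p(1)] grid_less[OF p] p(2) by auto
  have uy: "C_k (Suc j) (pdy u)" using u by simp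
  have "0 \<le> B" using bound[OF x] by simp
  then have "B * \<bar>x - t\<bar> \<le> B * (p (Suc k) - p k)" if "t \<in> {p k..p (Suc k)}" for t
    using that x by (intro mult_left_mono) auto
  then have "\<bar>pdy u (x, y) - pdy u (t, y)\<bar> \<le> B * (p (Suc k) - p k)" if "t \<in> {p k..p (Suc k)}" for t
    using that lipschitz_x[OF uy ab(1,2) y bound x that] by (meson order_trans)
  then show ?thesis
    unfolding Ix_def fst_conv snd_conv using p x ab(3) by (intro interp_near) auto
qed

text \<open>By the mean value theorem the difference quotient equals \<open>Iy q L (pdx u)\<close>
  at an intermediate point of the cell. Moving from \<open>x\<close> to that point costs the
  \<open>B\<close> term, interpolating in \<open>y\<close> there costs the \<open>B'\<close>
  term.\<close>

lemma Dx_error: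
  assumes p: "grid p K" "k < K" and x: "x \<in> {p k..<p (Suc k)}"
    and q: "grid q L" "l < L" and y: "y \<in> {q l..q (Suc l)}"
    and u: "C_k (Suc (Suc j)) u"
    and xx: "\<And>x' y'. x' \<in> {p k..p (Suc k)} \<Longrightarrow> y' \<in> {q l..q (Suc l)} \<Longrightarrow> \<bar>pdx (pdx u) (x', y')\<bar> \<le> B"
    and xy: "\<And>x' y'. x' \<in> {p k..p (Suc k)} \<Longrightarrow> y' \<in> {q l..q (Suc l)} \<Longrightarrow> \<bar>pdx (pdy u) (x', y')\<bar> \<le> B'"
  shows "\<bar>pdx u (x, y) - Dx p K (Ix p K (Iy q L u)) (x, y)\<bar> \<le> B * (p (Suc k) - p k) + B' * (q (Suc l) - q l)"
proof -
  have ab: "-1 \<le> p k" "p (Suc k) \<le> 1" "p k < p (Suc k)" and ab': "-1 \<le> q l" "q (Suc l) \<le> 1"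
    using grid_bounds[OF p(1)] grid_less[OF p] p(2) grid_bounds[OF q(1)] q(2) by auto
  have ux: "C_k (Suc j) (pdx u)" using u by simp
  let ?G = "\<lambda>x. Iy q L u (x, y)"
  have G': "(?G has_real_derivative Iy q L (pdx u) (x, y)) (at x)" if "p k < x" "x < p (Suc k)" for x
    by (rule Iy_deriv[OF q(1) u]) (use that ab in auto)
  have "continuous_on {p k..p (Suc k)} ?G"
    by (rule continuous_on_compose2[OF continuous_on_Iy[OF q(1) C_k_continuous[OF u]], of _ "\<lambda>x. (x, y)"])
       (use y ab ab' in \<open>auto intro!: continuous_intros\<close>)
  then obtain d \<xi> where \<xi>: "p k < \<xi>" "\<xi> < p (Suc k)" "(?G has_real_derivative d) (at \<xi>)"
      "?G (p (Suc k)) - ?G (p k) = (p (Suc k) - p k) * d"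
    using MVT[of "p k" "p (Suc k)" ?G] ab(3) G' real_differentiable_def by blast
  have d: "d = Iy q L (pdx u) (\<xi>, y)"
    using DERIV_unique[OF \<xi>(3) G'[OF \<xi>(1,2)]] .
  have "Dx p K (Ix p K (Iy q L u)) (x, y) = slope p K ?G x"
    unfolding Dx_def Ix_def fst_conv snd_conv by (rule slope_interp[OF p(1)])
  also have "\<dots> = d" using \<xi>(4) ab(3) x by (simp add: slope_eq[OF p])
  finally have 1: "Dx p K (Ix p K (Iy q L u)) (x, y) = Iy q L (pdx u) (\<xi>, y)" by (simp add: d)
  have "0 \<le> B" using xx[of x y] x y by simp
  then have "B * \<bar>x - \<xi>\<bar> \<le> B * (p (Suc k) - p k)"
    using \<xi> x by (intro mult_left_mono) auto
  moreover have "\<bar>pdx u (x, y) - pdx u (\<xi>, y)\<bar> \<le> B * \<bar>x - \<xi>\<bar>"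
    by (rule lipschitz_x[OF ux ab(1,2)]) (use xx y x \<xi> ab' in auto)
  moreover have "\<bar>pdx u (\<xi>, y) - Iy q L (pdx u) (\<xi>, y)\<bar> \<le> B' * (q (Suc l) - q l)"
    by (rule Iy_pdx_error[OF q y u, of "{p k<..<p (Suc k)}" \<xi> "\<lambda>_. B'"]) (use xy \<xi> ab in auto)
  ultimately show ?thesis
    unfolding 1 by linarith
qed

text \<open>The interpolant averages the four corner values, and each of them is reached from
  \<open>(x, y)\<close> by a move in \<open>x\<close> followed by a move in \<open>y\<close>. First
  order suffices, since only an error of order 1/N is sought.\<close>

lemma interpolant_error:
  assumes p: "grid p K" "k < K" and x: "x \<in> {p k..p (Suc k)}"
    and q: "grid q L" "l < L" and y: "y \<in> {q l..q (Suc l)}"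
    and u: "C_k (Suc j) u"
    and ux: "\<And>x' y'. x' \<in> {p k..p (Suc k)} \<Longrightarrow> y' \<in> {q l..q (Suc l)} \<Longrightarrow> \<bar>pdx u (x', y')\<bar> \<le> B"
    and uy: "\<And>x' y'. x' \<in> {p k..p (Suc k)} \<Longrightarrow> y' \<in> {q l..q (Suc l)} \<Longrightarrow> \<bar>pdy u (x', y')\<bar> \<le> B'"
  shows "\<bar>u (x, y) - Ix p K (Iy q L u) (x, y)\<bar> \<le> B * (p (Suc k) - p k) + B' * (q (Suc l) - q l)"
proof -
  have ab: "-1 \<le> p k" "p (Suc k) \<le> 1" "p k < p (Suc k)" and ab': "-1 \<le> q l" "q (Suc l) \<le> 1" "q l < q (Suc l)"
    using grid_bounds[OF p(1)] grid_less[OF p] p(2) grid_bounds[OF q(1)] grid_less[OF q] q(2) by auto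
  have "0 \<le> B" "0 \<le> B'" using ux[OF x y] uy[OF x y] by auto
  have *: "\<bar>u (x, y) - u (s, t)\<bar> \<le> B * (p (Suc k) - p k) + B' * (q (Suc l) - q l)"
    if st: "s \<in> {p k..p (Suc k)}" "t \<in> {q l..q (Suc l)}" for s t
  proof -
    have "\<bar>u (x, y) - u (s, y)\<bar> \<le> B * \<bar>x - s\<bar>"
      by (rule lipschitz_x[OF u ab(1,2)]) (use ux st x y ab' in auto)
    moreover have "B * \<bar>x - s\<bar> \<le> B * (p (Suc k) - p k)"
      using \<open>0 \<le> B\<close> x st by (intro mult_left_mono) auto
    moreover have "\<bar>u (s, y) - u (s, t)\<bar> \<le> B' * \<bar>y - t\<bar>"
      by (rule lipschitz_y[OF u ab'(1,2)]) (use uy st x y ab in auto)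
    moreover have "B' * \<bar>y - t\<bar> \<le> B' * (q (Suc l) - q l)"
      using \<open>0 \<le> B'\<close> y st by (intro mult_left_mono) auto
    ultimately show ?thesis by linarith
  qed
  have "\<bar>u (x, y) - Iy q L u (s, y)\<bar> \<le> B * (p (Suc k) - p k) + B' * (q (Suc l) - q l)"
    if "s \<in> {p k..p (Suc k)}" for s
    unfolding Iy_def fst_conv snd_conv using q y ab' that * by (intro interp_near) auto
  then show ?thesis
    unfolding Ix_def fst_conv snd_conv using p x ab by (intro interp_near) auto
qed


section \<open>Energy estimate on a layer-adapted mesh\<close>

lemma indicator_has_integral:
  assumes "-1 \<le> a" "a \<le> b" "b \<le> (1::real)"
  shows "((\<lambda>t. indicator {a..b} t) has_integral (b - a)) {-1..1}"
proof -
  have "((\<lambda>t. 1::real) has_integral (b - a)) {a..b}"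
    using has_integral_const_real[of "1::real" a b] assms by simp
  then have "((\<lambda>t. if t \<in> {a..b} then 1 else 0::real) has_integral (b - a)) {-1..1}"
    using assms by (subst has_integral_restrict) auto
  then show ?thesis by (simp add: indicator_def of_bool_def)
qed

lemma exp_layer_has_integral:
  assumes "\<kappa> > (0::real)"
  shows "((\<lambda>t. exp (- \<kappa> * \<bar>t\<bar>)) has_integral 2 * ((1 - exp (- \<kappa>)) / \<kappa>)) {-1..1}"
proof -
  have "((\<lambda>t. exp (- \<kappa> * t)) has_integral (- exp (- \<kappa> * 1) / \<kappa> - (- exp (- \<kappa> * 0) / \<kappa>))) {0..1}"
    using assms by (intro fundamental_theorem_of_calculus)
      (auto intro!: derivative_eq_intros simp: has_real_derivative_iff_has_vector_derivative[symmetric])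
  then have "((\<lambda>t. exp (- \<kappa> * \<bar>t\<bar>)) has_integral ((1 - exp (- \<kappa>)) / \<kappa>)) {0..1}"
    by (subst has_integral_cong[where g = "\<lambda>t. exp (- \<kappa> * t)"]) (auto simp: diff_divide_distrib)
  moreover have "((\<lambda>t. exp (\<kappa> * t)) has_integral (exp (\<kappa> * 0) / \<kappa> - (exp (\<kappa> * (-1)) / \<kappa>))) {-1..0}"
    using assms by (intro fundamental_theorem_of_calculus)
      (auto intro!: derivative_eq_intros simp: has_real_derivative_iff_has_vector_derivative[symmetric])
  then have "((\<lambda>t. exp (- \<kappa> * \<bar>t\<bar>)) has_integral ((1 - exp (- \<kappa>)) / \<kappa>)) {-1..0}"
    by (subst has_integral_cong[where g = "\<lambda>t. exp (\<kappa> * t)"]) (auto simp: diff_divide_distrib)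
  ultimately show ?thesis
    using has_integral_combine[of "-1" 0 1 "\<lambda>t. exp (- \<kappa> * \<bar>t\<bar>)"] by fastforce
qed

lemma abs_le_imp_square_le: "\<bar>x\<bar> \<le> y \<Longrightarrow> x\<^sup>2 \<le> y\<^sup>2" for x y :: real
  using power_mono[of "\<bar>x\<bar>" y 2] by simp

text \<open>\<open>g\<^sub>x\<close>, \<open>g\<^sub>y\<close> are the sizes of the derivatives on a cell, and \<open>P\<close> (a logarithm) is the price of
  resolving the layers. \<open>fx\<close> and \<open>fy\<close> mark the fine cells.\<close>

lemma energy_estimate:
  fixes n :: real
  assumes p: "grid p K" and q: "grid q L" and u: "C_k (Suc (Suc j)) u"
    and ub: "\<And>z. z \<in> frontier Omega \<Longrightarrow> u z = 0"
    and ws: "weak_solution \<epsilon> a c f u"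
    and uh: "uh \<in> FES p K q L" "\<And>v. v \<in> FES p K q L \<Longrightarrow> B_form \<epsilon> a c uh v = ip f v"
    and b: "X1 (b1 a) bx" and bm: "BM c" "BM f"
    and coercive: "\<And>z. z \<in> Omega \<Longrightarrow> \<gamma> \<le> c z - 1 / 2 * bx z" and pos: "0 < \<epsilon>" "\<epsilon> < 1" "0 < \<gamma>" "0 < n" "1 \<le> \<alpha>"
    and P: "1 \<le> P" and M: "1 \<le> M" "\<And>z. z \<in> Omega \<Longrightarrow> \<bar>c z\<bar> \<le> M"
    and fx: "\<And>k. k < K \<Longrightarrow> fx k \<Longrightarrow> -lx \<le> p k \<and> p (Suc k) \<le> lx" "0 \<le> lx" "lx \<le> 1"
    and fy: "\<And>l. l < L \<Longrightarrow> fy l \<Longrightarrow> q (Suc l) \<le> -1 + ly \<or> 1 - ly \<le> q l" "0 \<le> ly" "ly \<le> 1"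
    and Pl: "P ^ 4 * lx \<le> M'" "P\<^sup>2 * ly \<le> M'"
    and Px: "\<And>k. Px k = (if fx k then P else 1)" and Py: "\<And>l. Py l = (if fy l then P else 1)"
    and gpos: "\<And>k. 0 \<le> gx k" "\<And>l. 0 \<le> gy l"
    and hx: "\<And>k. k < K \<Longrightarrow> (p (Suc k) - p k) * gx k \<le> M / n * Px k"
    and hy: "\<And>l. l < L \<Longrightarrow> (q (Suc l) - q l) * gy l \<le> M / n * Py l"
    and bg: "\<And>k x y. k < K \<Longrightarrow> x \<in> {p k..p (Suc k)} \<Longrightarrow> y \<in> {-1..1} \<Longrightarrow> \<bar>b1 a (x, y)\<bar> * gx k \<le> M * Px k"
    and \<epsilon>g: "\<And>l. sqrt \<epsilon> * gy l \<le> 1"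
    and C: "0 \<le> C"
    and D: "\<And>k l x y. k < K \<Longrightarrow> l < L \<Longrightarrow> x \<in> {p k..p (Suc k)} \<Longrightarrow> y \<in> {q l..q (Suc l)} \<Longrightarrow>
      \<bar>pdx u (x, y)\<bar> \<le> C * gx k \<and> \<bar>pdy u (x, y)\<bar> \<le> C * gy l \<and> \<bar>pdx (pdx u) (x, y)\<bar> \<le> C * (gx k)\<^sup>2 \<and>
      \<bar>pdx (pdy u) (x, y)\<bar> \<le> C * gx k * gy l \<and>
      \<bar>pdx (pdy u) (x, y)\<bar> \<le> C * gy l * (1 + exp (- \<alpha> * \<bar>x\<bar> / \<epsilon>) / \<epsilon>)"
  shows "\<gamma> * J (\<lambda>z. (Ix p K (Iy q L u) z - uh z)\<^sup>2) \<le>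
      (C * M)\<^sup>2 * (16 * (1 + M') + 64 * M\<^sup>2 * (1 + M')\<^sup>2 / \<gamma>) / n\<^sup>2"
proof -
  define w where "w = Ix p K (Iy q L u)"
  define T where "T = (C * M / n)\<^sup>2"
  define e where "e x = 1 + exp (- \<alpha> * \<bar>x\<bar> / \<epsilon>) / \<epsilon>" for x
  \<comment> \<open>\<open>\<Phi> i\<close> and \<open>\<Psi>\<close> dominate \<open>Px^i\<close>
    and \<open>Py^2\<close> pointwise. For the exponents in use their means are at most
    \<open>1 + M'\<close> by \<open>Pl\<close>, which weighs the logarithms against the widths of
    the strips.\<close>
  define \<Phi> where "\<Phi> i x = 1 + P ^ i * indicator {-lx..lx} x" for i :: nat and x :: real
  define \<Psi> where "\<Psi> y = 1 + P\<^sup>2 * (indicator {-1..-1 + ly} y + indicator {1 - ly..1} y)" for y :: real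
  have "T \<ge> 0" by (simp add: T_def)
  have M': "0 \<le> M'" using Pl(1) fx(2) P by (smt (verit) mult_nonneg_nonneg zero_le_power)

  have bm\<Phi>: "BM (\<lambda>z. \<Phi> i (fst z))" for i
    unfolding \<Phi>_def using P by (intro BM_add BM_mult BM_const BM_fst[of _ 1]) (auto simp: indicator_def)
  have bm\<Psi>: "BM (\<lambda>z. \<Psi> (snd z))"
    unfolding \<Psi>_def using P by (intro BM_add BM_mult BM_const BM_snd[of _ 1]) (auto simp: indicator_def)
  have \<Psi>pos: "0 \<le> \<Psi> t" for t using P by (simp add: \<Psi>_def indicator_def)
  have int\<Phi>: "(\<Phi> i has_integral 2 + P ^ i * (2 * lx)) {-1..1}" for i
  proof -
    have "((\<lambda>t. indicator {-lx..lx} t) has_integral 2 * lx) {-1..1::real}"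
      using indicator_has_integral[of "-lx" lx] fx(2,3) by simp
    moreover have "((\<lambda>t. 1::real) has_integral 2) {-1..1::real}"
      using has_integral_const_real[of "1::real" "-1" 1] by simp
    ultimately show ?thesis
      unfolding \<Phi>_def by (intro has_integral_add has_integral_mult_right)
  qed
  have int\<Psi>: "(\<Psi> has_integral 2 + P\<^sup>2 * (ly + ly)) {-1..1}"
  proof -
    have "((\<lambda>t. indicator {-1..-1 + ly} t) has_integral ly) {-1..1::real}"
      using indicator_has_integral[of "-1" "-1 + ly"] fy(2,3) by simp
    moreover have "((\<lambda>t. indicator {1 - ly..1} t) has_integral ly) {-1..1::real}"
      using indicator_has_integral[of "1 - ly" 1] fy(2,3) by simp
    moreover have "((\<lambda>t. 1::real) has_integral 2) {-1..1::real}"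
      using has_integral_const_real[of "1::real" "-1" 1] by simp
    ultimately show ?thesis
      unfolding \<Psi>_def by (intro has_integral_add has_integral_mult_right)
  qed
  have cell: "\<exists>k l. k < K \<and> l < L \<and> x \<in> {p k..<p (Suc k)} \<and> y \<in> {q l..q (Suc l)} \<and>
      (\<forall>i. Px k ^ i \<le> \<Phi> i x) \<and> (Py l)\<^sup>2 \<le> \<Psi> y" if "(x, y) \<in> Omega" for x y
  proof -
    obtain k where k: "k < K" "p k \<le> x" "x < p (Suc k)"
      using grid_cell[OF p, of x] \<open>(x, y) \<in> Omega\<close> by auto
    obtain l where l: "l < L" "q l \<le> y" "y < q (Suc l)"
      using grid_cell[OF q, of y] \<open>(x, y) \<in> Omega\<close> by auto
    have "Px k ^ i \<le> \<Phi> i x" for i using fx(1)[OF k(1)] k P by (auto simp: Px \<Phi>_def)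
    moreover have "(Py l)\<^sup>2 \<le> \<Psi> y"
      using fy(1)[OF l(1)] l P \<open>(x, y) \<in> Omega\<close> by (auto simp: Py \<Psi>_def indicator_def)
    ultimately show ?thesis using k l by (intro exI[of _ k] exI[of _ l]) auto
  qed
  have P1: "1 \<le> Px k" "1 \<le> Py l" for k l using P by (auto simp: Px Py)

  have sub: "x \<in> {-1..1}" if "k < K" "x \<in> {p k..p (Suc k)}" for k x
    using grid_bounds[OF p, of k] grid_bounds[OF p, of "Suc k"] that by auto
  have suby: "y \<in> {-1..1}" if "l < L" "y \<in> {q l..q (Suc l)}" for l y
    using grid_bounds[OF q, of l] grid_bounds[OF q, of "Suc l"] that by auto
  have e_pos: "0 \<le> e x" for x using pos by (simp add: e_def add_nonneg_nonneg)

  have E1: "\<epsilon> * (pdx u z - Iy q L (pdx u) z)\<^sup>2 \<le> T * (\<epsilon> * (e (fst z))\<^sup>2 * \<Psi> (snd z))" if "z \<in> Omega" for z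
  proof -
    obtain x y where z: "z = (x, y)" by (cases z)
    then obtain k l where kl: "k < K" "l < L" "x \<in> {p k..<p (Suc k)}" "y \<in> {q l..q (Suc l)}" "(Py l)\<^sup>2 \<le> \<Psi> y"
      using cell[of x y] \<open>z \<in> Omega\<close> by blast
    have x: "x \<in> {-1<..<1}" using \<open>z \<in> Omega\<close> z by simp
    \<comment> \<open>The last bound in \<open>D\<close> is used, which keeps the exponential
      instead of \<open>gx k\<close>; it holds across all cells in \<open>x\<close>, so the
      neighbourhood may be the whole interval.\<close>
    have "\<bar>pdx u (x, y) - Iy q L (pdx u) (x, y)\<bar> \<le> C * gy l * e x * (q (Suc l) - q l)"
    proof (rule Iy_pdx_error[OF q kl(2,4) u, of "{-1<..<1}"])
      fix x' y' :: real assume x': "x' \<in> {-1<..<1}" and y': "y' \<in> {q l..q (Suc l)}"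
      obtain k' where "k' < K" "p k' \<le> x'" "x' < p (Suc k')"
        using grid_cell[OF p, of x'] x' by auto
      then show "\<bar>pdx (pdy u) (x', y')\<bar> \<le> C * gy l * e x'"
        using D[OF _ kl(2), of k' x' y'] y' by (auto simp: e_def)
    next
      show "isCont (\<lambda>x. C * gy l * e x) x"
        unfolding e_def using pos by (intro continuous_intros) auto
    qed (use x in auto)
    also have "\<dots> = C * e x * ((q (Suc l) - q l) * gy l)" by (simp add: algebra_simps)
    also have "\<dots> \<le> C * e x * (M / n * Py l)"
      using C e_pos hy[OF kl(2)] by (intro mult_left_mono) auto
    finally have "(pdx u (x, y) - Iy q L (pdx u) (x, y))\<^sup>2 \<le> (C * e x * (M / n * Py l))\<^sup>2"
      by (rule abs_le_imp_square_le)
    also have "\<dots> = T * ((e x)\<^sup>2 * (Py l)\<^sup>2)"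
      by (simp add: T_def power_mult_distrib power_divide)
    also have "\<dots> \<le> T * ((e x)\<^sup>2 * \<Psi> y)"
      using kl(5) \<open>T \<ge> 0\<close> by (intro mult_left_mono) auto
    finally have "\<epsilon> * (pdx u (x, y) - Iy q L (pdx u) (x, y))\<^sup>2 \<le> \<epsilon> * (T * ((e x)\<^sup>2 * \<Psi> y))"
      using pos by (intro mult_left_mono) auto
    then show ?thesis by (simp add: z algebra_simps)
  qed

  have E2: "\<epsilon> * (pdy u z - Ix p K (pdy u) z)\<^sup>2 \<le> T * (\<Phi> 2 (fst z) * 1)" if "z \<in> Omega" for z
  proof -
    obtain x y where z: "z = (x, y)" by (cases z)
    then obtain k l where kl: "k < K" "l < L" "x \<in> {p k..<p (Suc k)}" "y \<in> {q l..q (Suc l)}" "Px k ^ 2 \<le> \<Phi> 2 x"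
      using cell[of x y] \<open>z \<in> Omega\<close> by blast
    have "\<bar>pdy u (x, y) - Ix p K (pdy u) (x, y)\<bar> \<le> C * gx k * gy l * (p (Suc k) - p k)"
      by (rule Ix_pdy_error[OF p kl(1) _ _ u]) (use kl D[OF kl(1,2)] suby[OF kl(2,4)] in auto)
    then have "sqrt \<epsilon> * \<bar>pdy u (x, y) - Ix p K (pdy u) (x, y)\<bar> \<le> sqrt \<epsilon> * (C * gx k * gy l * (p (Suc k) - p k))"
      using pos by (intro mult_left_mono) auto
    \<comment> \<open>The factor \<open>sqrt \<epsilon>\<close> removes the size \<open>gy l\<close>
      of the layers in \<open>y\<close>; only a logarithm in \<open>x\<close> remains.\<close>
    also have "\<dots> = C * ((p (Suc k) - p k) * gx k) * (sqrt \<epsilon> * gy l)"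
      by (simp add: algebra_simps)
    also have "\<dots> \<le> C * (M / n * Px k) * 1"
    proof (rule mult_mono)
      show "C * ((p (Suc k) - p k) * gx k) \<le> C * (M / n * Px k)"
        by (rule mult_left_mono[OF hx[OF kl(1)] C])
      show "0 \<le> C * (M / n * Px k)" using C M pos P1[of k] by simp
    qed (use \<epsilon>g gpos pos in auto)
    finally have "(sqrt \<epsilon> * \<bar>pdy u (x, y) - Ix p K (pdy u) (x, y)\<bar>)\<^sup>2 \<le> (C * (M / n * Px k))\<^sup>2"
      using pos by (intro power_mono) auto
    also have "\<dots> = T * Px k ^ 2" by (simp add: T_def power_mult_distrib power_divide)
    also have "\<dots> \<le> T * \<Phi> 2 x"
      using kl(5) \<open>T \<ge> 0\<close> by (intro mult_left_mono) auto
    finally show ?thesis using pos by (simp add: z power_mult_distrib)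
  qed

  have E3: "(b1 a z * (pdx u z - Dx p K w z) + c z * (u z - w z))\<^sup>2 \<le>
      16 * M\<^sup>2 * T * (\<Phi> 4 (fst z) * \<Psi> (snd z))" if "z \<in> Omega" for z
  proof -
    obtain x y where z: "z = (x, y)" by (cases z)
    then obtain k l where kl: "k < K" "l < L" "x \<in> {p k..<p (Suc k)}" "y \<in> {q l..q (Suc l)}"
        "Px k ^ 4 \<le> \<Phi> 4 x" "(Py l)\<^sup>2 \<le> \<Psi> y"
      using cell[of x y] \<open>z \<in> Omega\<close> by blast
    have x: "x \<in> {p k..p (Suc k)}" using kl by auto
    define S where "S = C * M / n"
    have S: "0 \<le> S" using C M pos by (simp add: S_def)
    define h where "h = p (Suc k) - p k"
    define h' where "h' = q (Suc l) - q l"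
    have hS: "C * (h * gx k) \<le> S * Px k" "C * (h' * gy l) \<le> S * Py l"
      using mult_left_mono[OF hx[OF kl(1)] C] mult_left_mono[OF hy[OF kl(2)] C] by (auto simp: S_def h_def h'_def)
    have "\<bar>pdx u (x, y) - Dx p K w (x, y)\<bar> \<le> C * (gx k)\<^sup>2 * h + C * gx k * gy l * h'"
      unfolding w_def h_def h'_def
      by (rule Dx_error[OF p kl(1,3) q kl(2,4) u]) (use D[OF kl(1,2)] in auto)
    also have "\<dots> = gx k * (C * (h * gx k) + C * (h' * gy l))"
      by (simp add: algebra_simps power2_eq_square)
    also have "\<dots> \<le> gx k * (S * Px k + S * Py l)"
      using hS gpos by (intro mult_left_mono add_mono) auto
    finally have "\<bar>b1 a (x, y)\<bar> * \<bar>pdx u (x, y) - Dx p K w (x, y)\<bar> \<le> \<bar>b1 a (x, y)\<bar> * (gx k * (S * Px k + S * Py l))"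
      by (intro mult_left_mono) auto
    \<comment> \<open>\<open>b1 a\<close> is paired with one factor \<open>gx k\<close>, which costs
      a logarithm at most; the other derivative size is already paired with its mesh width.\<close>
    also have "\<dots> = \<bar>b1 a (x, y)\<bar> * gx k * (S * Px k + S * Py l)" by simp
    also have "\<dots> \<le> M * Px k * (S * Px k + S * Py l)"
      using bg[OF kl(1) x suby[OF kl(2,4)]] S P1[of k] P1(2)[of l] by (intro mult_right_mono) (auto intro!: add_nonneg_nonneg mult_nonneg_nonneg)
    also have "\<dots> = M * S * (Px k * Px k + Px k * Py l)" by (simp add: algebra_simps)
    finally have 1: "\<bar>b1 a (x, y) * (pdx u (x, y) - Dx p K w (x, y))\<bar> \<le> M * S * (Px k * Px k + Px k * Py l)"
      by (simp add: abs_mult)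
    have "\<bar>u (x, y) - w (x, y)\<bar> \<le> C * gx k * h + C * gy l * h'"
      unfolding w_def h_def h'_def
      by (rule interpolant_error[OF p kl(1) x q kl(2,4) u]) (use D[OF kl(1,2)] in auto)
    also have "\<dots> \<le> S * Px k + S * Py l" using hS by (simp add: algebra_simps)
    finally have "\<bar>c (x, y)\<bar> * \<bar>u (x, y) - w (x, y)\<bar> \<le> M * (S * Px k + S * Py l)"
      using M that z by (intro mult_mono) auto
    then have 2: "\<bar>c (x, y) * (u (x, y) - w (x, y))\<bar> \<le> M * S * (Px k + Py l)"
      unfolding abs_mult by (simp add: distrib_left mult.assoc)
    \<comment> \<open>All four products are dominated by \<open>Px^2 * Py\<close>. This is the
      reason for the exponent 4 in \<open>\<Phi>\<close> and for the factor 16 after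
      squaring.\<close>
    have PP: "Px k * Px k \<le> (Px k)\<^sup>2 * Py l" "Px k * Py l \<le> (Px k)\<^sup>2 * Py l" "Px k \<le> (Px k)\<^sup>2 * Py l" "Py l \<le> (Px k)\<^sup>2 * Py l"
    proof -
      have a: "1 \<le> Px k" "1 \<le> Py l" "1 \<le> Px k * Px k"
        using P1[of k] P1(2)[of l] mult_mono[of 1 "Px k" 1 "Px k"] by auto
      have 1: "Px k * Px k * 1 \<le> Px k * Px k * Py l" using a by (intro mult_left_mono) auto
      have 2: "1 * (Px k * Py l) \<le> Px k * (Px k * Py l)" using a by (intro mult_right_mono) auto
      have 3: "Px k * 1 \<le> Px k * Py l" using a by (intro mult_left_mono) auto
      have 4: "1 * Py l \<le> Px k * Px k * Py l" using a by (intro mult_right_mono) auto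
      show "Px k * Px k \<le> (Px k)\<^sup>2 * Py l" "Px k * Py l \<le> (Px k)\<^sup>2 * Py l"
          "Px k \<le> (Px k)\<^sup>2 * Py l" "Py l \<le> (Px k)\<^sup>2 * Py l"
        using 1 2 3 4 unfolding power2_eq_square mult.assoc mult_1 mult_1_right by linarith+
    qed
    have "\<bar>b1 a (x, y) * (pdx u (x, y) - Dx p K w (x, y)) + c (x, y) * (u (x, y) - w (x, y))\<bar>
        \<le> M * S * (Px k * Px k + Px k * Py l) + M * S * (Px k + Py l)" using 1 2 by linarith
    also have "\<dots> = M * S * (Px k * Px k + Px k * Py l + Px k + Py l)"
      by (simp add: algebra_simps)
    also have "\<dots> \<le> M * S * (4 * ((Px k)\<^sup>2 * Py l))"
      using PP M S by (intro mult_left_mono) auto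
    finally have "(b1 a (x, y) * (pdx u (x, y) - Dx p K w (x, y)) + c (x, y) * (u (x, y) - w (x, y)))\<^sup>2
        \<le> (M * S * (4 * ((Px k)\<^sup>2 * Py l)))\<^sup>2" by (rule abs_le_imp_square_le)
    also have "\<dots> = 16 * M\<^sup>2 * T * (Px k ^ 4 * (Py l)\<^sup>2)"
      by (simp add: T_def S_def power_mult_distrib power_divide flip: power_mult)
    also have "\<dots> \<le> 16 * M\<^sup>2 * T * (\<Phi> 4 x * \<Psi> y)"
      using kl(5,6) \<open>T \<ge> 0\<close> order_trans[OF zero_le_power kl(5)] P1[of k] by (intro mult_left_mono mult_mono) auto
    finally show ?thesis by (simp add: z)
  qed

  have ux: "C_k (Suc j) (pdx u)" and uy: "C_k (Suc j) (pdy u)" using u by simp_all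
  note bmu = X1_BM[OF X1_C_k[OF u]] Y1_BM[OF Y1_C_k[OF u]]
  have bmI: "BM (Iy q L (pdx u))" "BM (Ix p K (pdy u))"
    by (intro BM_continuous continuous_on_Iy continuous_on_Ix p q C_k_continuous[OF ux] C_k_continuous[OF uy])+
  have wF: "w \<in> FES p K q L"
    unfolding w_def by (rule FES_interpolant[OF p q C_k_continuous[OF u] ub])
  note bmw = X1_BM[OF FES_X1[OF p q wF]]

  have J1: "\<epsilon> * J (\<lambda>z. (pdx u z - Iy q L (pdx u) z)\<^sup>2) \<le> T * (12 * (1 + M'))"
  proof -
    \<comment> \<open>The square of exp(-\<alpha>|x|/\<epsilon>)/\<epsilon> has an integral of order
      1/\<epsilon>, cancelled by the factor \<epsilon> without a logarithm. The total is at most 4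
      \<epsilon> + 2/\<alpha> <= 6, hence the mean 3 below.\<close>
    let ?e = "\<lambda>x. 2 * \<epsilon> + 2 / \<epsilon> * exp (- (2 * \<alpha> / \<epsilon>) * \<bar>x\<bar>)"
    have e2: "\<epsilon> * (e x)\<^sup>2 \<le> ?e x" for x
    proof -
      define r where "r = exp (- \<alpha> * \<bar>x\<bar> / \<epsilon>)"
      have "(1 + t)\<^sup>2 \<le> 2 + 2 * t\<^sup>2" for t :: real
        using zero_le_power2[of "1 - t"] by (simp add: power2_eq_square algebra_simps)
      from this[of "r / \<epsilon>"] have "\<epsilon> * (e x)\<^sup>2 \<le> \<epsilon> * (2 + 2 * (r / \<epsilon>)\<^sup>2)"
        unfolding e_def r_def[symmetric] using pos by (intro mult_left_mono) auto
      also have "\<dots> = 2 * \<epsilon> + 2 / \<epsilon> * r\<^sup>2"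
        using pos by (simp add: power2_eq_square field_simps)
      also have "r\<^sup>2 = exp (- (2 * \<alpha> / \<epsilon>) * \<bar>x\<bar>)"
        unfolding r_def by (simp add: power2_eq_square flip: exp_add)
      finally show ?thesis .
    qed
    have "BM (\<lambda>z. exp (- (2 * \<alpha> / \<epsilon>) * \<bar>fst z\<bar>))"
      by (intro BM_continuous continuous_intros)
    then have bme: "BM (\<lambda>z. ?e (fst z))" by (intro BM_add BM_mult BM_const)
    have int: "(?e has_integral 2 * \<epsilon> * 2 + 2 / \<epsilon> * (2 * ((1 - exp (- (2 * \<alpha> / \<epsilon>))) / (2 * \<alpha> / \<epsilon>)))) {-1..1}"
    proof -
      have "((\<lambda>t. 2 * \<epsilon>) has_integral 2 * \<epsilon> * 2) {-1..1::real}"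
        using has_integral_const_real[of "2 * \<epsilon>" "-1" 1] by (simp add: mult.commute)
      moreover have "((\<lambda>t. exp (- (2 * \<alpha> / \<epsilon>) * \<bar>t\<bar>)) has_integral
          2 * ((1 - exp (- (2 * \<alpha> / \<epsilon>))) / (2 * \<alpha> / \<epsilon>))) {-1..1}"
        by (rule exp_layer_has_integral) (use pos in simp)
      ultimately show ?thesis by (intro has_integral_add has_integral_mult_right)
    qed
    have "2 / \<epsilon> * (2 * ((1 - exp (- (2 * \<alpha> / \<epsilon>))) / (2 * \<alpha> / \<epsilon>))) \<le> 2 / \<epsilon> * (2 * (1 / (2 * \<alpha> / \<epsilon>)))"
      using pos by (intro mult_left_mono divide_right_mono) auto
    also have "\<dots> = 2 / \<alpha>" using pos by (simp add: field_simps)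
    also have "\<dots> \<le> 2" using pos by (simp add: pos_divide_le_eq)
    finally have i: "2 * \<epsilon> * 2 + 2 / \<epsilon> * (2 * ((1 - exp (- (2 * \<alpha> / \<epsilon>))) / (2 * \<alpha> / \<epsilon>))) \<le> 2 * 3"
      using pos by linarith
    have "\<epsilon> * J (\<lambda>z. (pdx u z - Iy q L (pdx u) z)\<^sup>2) \<le> T * J (\<lambda>z. ?e (fst z) * \<Psi> (snd z))"
      unfolding J_cmult[symmetric]
    proof (rule J_mono)
      fix z assume "z \<in> Omega"
      have "T * (\<epsilon> * (e (fst z))\<^sup>2 * \<Psi> (snd z)) \<le> T * (?e (fst z) * \<Psi> (snd z))"
        using e2 \<Psi>pos \<open>T \<ge> 0\<close> by (intro mult_left_mono mult_right_mono) auto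
      with E1[OF \<open>z \<in> Omega\<close>]
      show "\<epsilon> * (pdx u z - Iy q L (pdx u) z)\<^sup>2 \<le> T * (?e (fst z) * \<Psi> (snd z))"
        by (rule order_trans)
    next
      show "BM (\<lambda>z. \<epsilon> * (pdx u z - Iy q L (pdx u) z)\<^sup>2)"
        by (intro BM_mult BM_power BM_const BM_diff bmu bmI)
      show "BM (\<lambda>z. T * (?e (fst z) * \<Psi> (snd z)))"
        by (intro BM_mult BM_const bme bm\<Psi>)
    qed
    also have "J (\<lambda>z. ?e (fst z) * \<Psi> (snd z)) \<le> 4 * 3 * (1 + M')"
      by (rule J_product_le[OF bme bm\<Psi> \<Psi>pos _ int i int\<Psi>]) (use Pl in auto)
    finally show ?thesis using \<open>T \<ge> 0\<close> by (simp add: mult_left_mono)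
  qed
  have J2: "\<epsilon> * J (\<lambda>z. (pdy u z - Ix p K (pdy u) z)\<^sup>2) \<le> T * (4 * (1 + M'))"
  proof -
    have "P\<^sup>2 * lx \<le> P ^ 4 * lx"
      using P fx(2) by (intro mult_right_mono power_increasing) auto
    then have i: "2 + P\<^sup>2 * (2 * lx) \<le> 2 * (1 + M')" using Pl by simp
    have "\<epsilon> * J (\<lambda>z. (pdy u z - Ix p K (pdy u) z)\<^sup>2) \<le> T * J (\<lambda>z. \<Phi> 2 (fst z) * 1)"
      unfolding J_cmult[symmetric]
    proof (rule J_mono)
      show "BM (\<lambda>z. \<epsilon> * (pdy u z - Ix p K (pdy u) z)\<^sup>2)"
        by (intro BM_mult BM_power BM_const BM_diff bmu bmI)
      show "BM (\<lambda>z. T * (\<Phi> 2 (fst z) * 1))" by (intro BM_mult BM_const bm\<Phi>)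
    qed (rule E2)
    also have "J (\<lambda>z. \<Phi> 2 (fst z) * 1) \<le> 4 * (1 + M') * 1"
      by (rule J_product_le[of "\<Phi> 2" "\<lambda>_. 1", OF bm\<Phi> BM_const _ _ int\<Phi> i, of "2"])
         (use M' has_integral_const_real[of "1::real" "-1" 1] in auto)
    finally show ?thesis using \<open>T \<ge> 0\<close> by (simp add: mult_left_mono)
  qed
  have J3: "J (\<lambda>z. (b1 a z * (pdx u z - Dx p K w z) + c z * (u z - w z))\<^sup>2) \<le> 16 * M\<^sup>2 * T * (4 * (1 + M')\<^sup>2)"
  proof -
    have "J (\<lambda>z. (b1 a z * (pdx u z - Dx p K w z) + c z * (u z - w z))\<^sup>2) \<le> 16 * M\<^sup>2 * T * J (\<lambda>z. \<Phi> 4 (fst z) * \<Psi> (snd z))"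
      unfolding J_cmult[symmetric]
    proof (rule J_mono)
      show "BM (\<lambda>z. (b1 a z * (pdx u z - Dx p K w z) + c z * (u z - w z))\<^sup>2)"
        by (intro BM_power BM_add BM_mult BM_diff bmu bmw bm X1_BM[OF b])
      show "BM (\<lambda>z. 16 * M\<^sup>2 * T * (\<Phi> 4 (fst z) * \<Psi> (snd z)))"
        by (intro BM_mult BM_const bm\<Phi> bm\<Psi>)
    qed (rule E3)
    also have "J (\<lambda>z. \<Phi> 4 (fst z) * \<Psi> (snd z)) \<le> 4 * (1 + M') * (1 + M')"
      by (rule J_product_le[OF bm\<Phi> bm\<Psi> \<Psi>pos _ int\<Phi> _ int\<Psi>]) (use Pl M' in auto)
    also have "4 * (1 + M') * (1 + M') = 4 * (1 + M')\<^sup>2" by (simp add: power2_eq_square)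
    finally show ?thesis using \<open>T \<ge> 0\<close> by (simp add: mult_left_mono)
  qed
  \<comment> \<open>The two diffusion terms give 12 + 4 = 16; the convection and reaction term gives
    16 times 4 = 64.\<close>
  have "\<gamma> * J (\<lambda>z. (w z - uh z)\<^sup>2) \<le> T * (12 * (1 + M')) + T * (4 * (1 + M')) + 1 / \<gamma> * (16 * M\<^sup>2 * T * (4 * (1 + M')\<^sup>2))"
    using discrete_stability[OF p q u ub ws uh b bm coercive pos(1,3)] J1 J2
      mult_left_mono[OF J3, of "1 / \<gamma>"] pos unfolding w_def by simp
  also have "\<dots> = (C * M)\<^sup>2 * (16 * (1 + M') + 64 * M\<^sup>2 * (1 + M')\<^sup>2 / \<gamma>) / n\<^sup>2"
  proof -
    have "T = (C * M)\<^sup>2 * inverse (n\<^sup>2)"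
      unfolding T_def power_divide by (simp only: divide_inverse)
    then show ?thesis
      unfolding divide_inverse by (simp add: algebra_simps)
  qed
  finally show ?thesis by (simp add: w_def)
qed


section \<open>From the \<open>L\<^sup>2\<close> norm to nodal values\<close>

text \<open>With end values A and B the integral is (b - a)/3 times A^2 + A B + B^2, which is at
  least 3/4 A^2 because (A + 2 B)^2 >= 0, and likewise for B. It acts as an inverse inequality with
  an explicit constant.\<close>

lemma linear_square_integral:
  assumes "a < (b::real)" "\<And>t. t \<in> {a..b} \<Longrightarrow> g t = r + s * t" "t0 = a \<or> t0 = b"
  shows "\<exists>i. ((\<lambda>t. (g t)\<^sup>2) has_integral i) {a..b} \<and> (b - a) / 4 * (g t0)\<^sup>2 \<le> i"
proof -
  define G where "G t = r\<^sup>2 * t + r * s * t\<^sup>2 + s\<^sup>2 * t ^ 3 / 3" for t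
  have "((\<lambda>t. (r + s * t)\<^sup>2) has_integral (G b - G a)) {a..b}"
    unfolding G_def using assms(1) by (intro fundamental_theorem_of_calculus)
       (auto intro!: derivative_eq_intros simp: power2_eq_square algebra_simps
         has_real_derivative_iff_has_vector_derivative[symmetric])
  then have 1: "((\<lambda>t. (g t)\<^sup>2) has_integral (G b - G a)) {a..b}"
    by (subst has_integral_cong[where g = "\<lambda>t. (r + s * t)\<^sup>2"]) (auto simp: assms(2))
  define A where "A = r + s * a"
  define B where "B = r + s * b"
  have "G b - G a = (b - a) / 3 * (A\<^sup>2 + A * B + B\<^sup>2)"
    unfolding G_def A_def B_def by (simp add: power2_eq_square power3_eq_cube algebra_simps) (simp add: field_simps)
  moreover have "A\<^sup>2 / 4 \<le> (A\<^sup>2 + A * B + B\<^sup>2) / 3" "B\<^sup>2 / 4 \<le> (A\<^sup>2 + A * B + B\<^sup>2) / 3"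
    using zero_le_power2[of "A + 2 * B"] zero_le_power2[of "2 * A + B"]
    by (simp_all add: power2_eq_square algebra_simps)
  then have "(b - a) * (A\<^sup>2 / 4) \<le> (b - a) * ((A\<^sup>2 + A * B + B\<^sup>2) / 3)"
      "(b - a) * (B\<^sup>2 / 4) \<le> (b - a) * ((A\<^sup>2 + A * B + B\<^sup>2) / 3)"
    using assms(1) by (auto intro!: mult_left_mono)
  moreover have "g t0 = A \<or> g t0 = B" using assms by (auto simp: A_def B_def)
  ultimately have "(b - a) / 4 * (g t0)\<^sup>2 \<le> G b - G a" by auto
  with 1 show ?thesis by blast
qed

lemma has_integral_cell:
  assumes "(g has_integral i) {a..b}" "-1 \<le> a" "b \<le> (1::real)"
  shows "((\<lambda>t. indicator {a..b} t * g t) has_integral (i::real)) {-1..1}"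
proof -
  have "((\<lambda>t. if t \<in> {a..b} then g t else 0) has_integral i) {-1..1}"
    using assms by (subst has_integral_restrict) auto
  moreover have "(\<lambda>t. if t \<in> {a..b} then g t else 0) = (\<lambda>t. indicator {a..b} t * g t)"
    by (auto simp: indicator_def)
  ultimately show ?thesis by simp
qed

text \<open>\<open>linear_square_integral\<close> is applied in \<open>x\<close> on every line
  through the cell and then in \<open>y\<close> on the line x = x0; each application costs a factor
  4, whence 16.\<close>

lemma nodal_bound:
  assumes p: "grid p K" "k < K" and q: "grid q L" "l < L" and v: "v \<in> FES p K q L"
    and x0: "x0 = p k \<or> x0 = p (Suc k)" and y0: "y0 = q l \<or> y0 = q (Suc l)"
  shows "(p (Suc k) - p k) * (q (Suc l) - q l) * (v (x0, y0))\<^sup>2 \<le> 16 * J (\<lambda>z. (v z)\<^sup>2)"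
proof -
  define hx where "hx = p (Suc k) - p k"
  define hy where "hy = q (Suc l) - q l"
  have h: "0 < hx" "0 < hy" using grid_less[OF p] grid_less[OF q] by (auto simp: hx_def hy_def)
  have bx: "-1 \<le> p k" "p (Suc k) \<le> 1" and by': "-1 \<le> q l" "q (Suc l) \<le> 1"
    using grid_bounds[OF p(1)] grid_bounds[OF q(1)] p(2) q(2) by auto
  have x0': "x0 \<in> {-1..1}" and y0': "y0 \<in> {q l..q (Suc l)}"
    using x0 y0 bx h by (auto simp: hx_def hy_def)
  obtain a b c d where v_eq: "\<And>x y. x \<in> {p k..p (Suc k)} \<Longrightarrow> y \<in> {q l..q (Suc l)} \<Longrightarrow>
        v (x, y) = a + b * x + c * y + d * x * y" using FES_bilinear[OF v p(2) q(2)] by blast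
  have bmv: "BM v" and bms: "BM (\<lambda>z. v (x0, snd z))"
    using BM_continuous FES_continuous[OF v] continuous_on_slice[OF FES_continuous[OF v] x0'] by auto
  have ix: "BM (\<lambda>z. indicator {p k..p (Suc k)} (fst z))" and iy: "BM (\<lambda>z. indicator {q l..q (Suc l)} (snd z))"
    by (rule BM_fst[of _ 1] BM_snd[of _ 1]; auto simp: indicator_def)+
  define F where "F z = indicator {q l..q (Suc l)} (snd z) * (indicator {p k..p (Suc k)} (fst z) * (v z)\<^sup>2)" for z
  define G where "G z = indicator {q l..q (Suc l)} (snd z) * (v (x0, snd z))\<^sup>2" for z :: "real \<times> real"
  have bmF: "BM F" and bmG: "BM G"
    unfolding F_def[abs_def] G_def[abs_def] by (intro BM_mult BM_power bmv bms ix iy)+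
  have "J F \<le> J (\<lambda>z. (v z)\<^sup>2)"
    by (rule J_mono) (auto simp: bmF bmv BM_power F_def indicator_def)
  \<comment> \<open>\<open>G\<close> does not depend on \<open>x\<close> and is integrated over a
    line of length 2, so \<open>hx / 4\<close> turns into \<open>hx / 8\<close>.\<close>
  moreover have "0 \<le> J (\<lambda>z. F z - hx / 8 * G z)"
  proof (rule J_nonneg_x)
    show "BM (\<lambda>z. F z - hx / 8 * G z)" by (intro BM_diff BM_mult BM_const bmF bmG)
    fix y :: real
    show "\<exists>i\<ge>0. ((\<lambda>x. F (x, y) - hx / 8 * G (x, y)) has_integral i) {-1..1}"
    proof (cases "y \<in> {q l..q (Suc l)}")
      case True
      have "v (x, y) = (a + c * y) + (b + d * y) * x" if "x \<in> {p k..p (Suc k)}" for x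
        using v_eq[OF that True] by (simp add: algebra_simps)
      from linear_square_integral[OF grid_less[OF p] this x0] obtain i
        where i: "((\<lambda>x. (v (x, y))\<^sup>2) has_integral i) {p k..p (Suc k)}" "hx / 4 * (v (x0, y))\<^sup>2 \<le> i"
        unfolding hx_def by blast
      have "((\<lambda>x. F (x, y)) has_integral i) {-1..1}"
        using has_integral_cell[OF i(1) bx] True by (simp add: F_def)
      moreover have "((\<lambda>x. hx / 8 * G (x, y)) has_integral hx / 8 * (v (x0, y))\<^sup>2 * 2) {-1..1::real}"
        using has_integral_const_real[of "hx / 8 * (v (x0, y))\<^sup>2" "-1" 1] True by (simp add: G_def mult.commute)
      ultimately have "((\<lambda>x. F (x, y) - hx / 8 * G (x, y)) has_integral i - hx / 8 * (v (x0, y))\<^sup>2 * 2) {-1..1}"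
        by (rule has_integral_diff)
      then show ?thesis using i(2) by (intro exI[of _ "i - hx / 8 * (v (x0, y))\<^sup>2 * 2"]) simp
    next
      case False
      then show ?thesis by (intro exI[of _ 0]) (simp add: F_def G_def)
    qed
  qed
  moreover have "0 \<le> J (\<lambda>z. G z - hy / 8 * (v (x0, y0))\<^sup>2)"
  proof (rule J_nonneg_y)
    show "BM (\<lambda>z. G z - hy / 8 * (v (x0, y0))\<^sup>2)" by (intro BM_diff BM_const bmG)
    have x0_cell: "x0 \<in> {p k..p (Suc k)}" using x0 h by (auto simp: hx_def)
    have "v (x0, y) = (a + b * x0) + (c + d * x0) * y" if "y \<in> {q l..q (Suc l)}" for y
      using v_eq[OF x0_cell that] by (simp add: algebra_simps)
    from linear_square_integral[OF grid_less[OF q] this y0] obtain i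
      where i: "((\<lambda>y. (v (x0, y))\<^sup>2) has_integral i) {q l..q (Suc l)}" "hy / 4 * (v (x0, y0))\<^sup>2 \<le> i"
      unfolding hy_def by blast
    have "((\<lambda>y. G (x, y)) has_integral i) {-1..1}" for x
      using has_integral_cell[OF i(1) by'] by (simp add: G_def)
    moreover have "((\<lambda>y. hy / 8 * (v (x0, y0))\<^sup>2) has_integral hy / 8 * (v (x0, y0))\<^sup>2 * 2) {-1..1::real}"
      using has_integral_const_real[of "hy / 8 * (v (x0, y0))\<^sup>2" "-1" 1] by (simp add: mult.commute)
    ultimately have "((\<lambda>y. G (x, y) - hy / 8 * (v (x0, y0))\<^sup>2) has_integral i - hy / 8 * (v (x0, y0))\<^sup>2 * 2) {-1..1}" for x
      by (rule has_integral_diff)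
    then show "\<exists>i\<ge>0. ((\<lambda>y. G (x, y) - hy / 8 * (v (x0, y0))\<^sup>2) has_integral i) {-1..1}" for x
      using i(2) by (intro exI[of _ "i - hy / 8 * (v (x0, y0))\<^sup>2 * 2"]) simp
  qed
  moreover have "J (\<lambda>z. F z - hx / 8 * G z) = J F - hx / 8 * J G"
    by (simp only: J_diff[OF bmF BM_mult[OF BM_const bmG]] J_cmult)
  moreover have "J (\<lambda>z. G z - hy / 8 * (v (x0, y0))\<^sup>2) = J G - 4 * (hy / 8 * (v (x0, y0))\<^sup>2)"
    by (simp only: J_diff[OF bmG BM_const] J_const)
  ultimately have "J F \<le> J (\<lambda>z. (v z)\<^sup>2)" "hx / 8 * J G \<le> J F" "4 * (hy / 8 * (v (x0, y0))\<^sup>2) \<le> J G"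
    by linarith+
  moreover from this(3) have "hx / 8 * (4 * (hy / 8 * (v (x0, y0))\<^sup>2)) \<le> hx / 8 * J G"
    using h by (intro mult_left_mono) auto
  ultimately have "hx / 8 * (4 * (hy / 8 * (v (x0, y0))\<^sup>2)) \<le> J (\<lambda>z. (v z)\<^sup>2)"
    by linarith
  then show ?thesis by (simp add: hx_def[symmetric] hy_def[symmetric] algebra_simps)
qed


section \<open>The Shishkin mesh\<close>

lemma x_node_pos_fine:
  assumes "i \<le> real N / 2"
  shows "x_node_pos N lam i = i * (2 * lam / real N)" using assms by (simp add: x_node_pos_def)

text \<open>The two branches of \<open>x_node_pos\<close> agree at the transition index, so the
  coarse formula extends to it.\<close>

lemma x_node_pos_coarse:
  assumes "real N / 2 \<le> i" "0 < N"
  shows "x_node_pos N lam i = lam + (i - real N / 2) * (2 * (1 - lam) / real N)"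
proof (cases "i = real N / 2")
  case True
  show ?thesis
    unfolding True using assms(2) by (simp add: x_node_pos_def)
next
  case False
  then show ?thesis using assms by (simp add: x_node_pos_def)
qed

lemma x_node_nonneg: "0 \<le> m \<Longrightarrow> x_node N lam m = x_node_pos N lam (of_int m)"
  by (cases "m = 0") (auto simp: x_node_def x_node_pos_def)

lemma x_node_minus: "x_node N lam (- m) = - x_node N lam m" by (simp add: x_node_def)

lemma x_cell_pos:
  assumes N: "even N" "0 < N" and lam: "0 < lam" "lam < 1" and m: "0 \<le> m" "m < int N"
  shows "if 2 * m < int N
    then x_node N lam (m + 1) - x_node N lam m = 2 * lam / real N \<and> 0 \<le> x_node N lam m \<and> x_node N lam (m + 1) \<le> lam
    else x_node N lam (m + 1) - x_node N lam m = 2 * (1 - lam) / real N \<and> lam \<le> x_node N lam m \<and> x_node N lam (m + 1) \<le> 1"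
proof (cases "2 * m < int N")
  case True
  \<comment> \<open>As N is even, the transition point is a node and no cell straddles it.\<close>
  with N have "2 * (m + 1) \<le> int N" by presburger
  then have "real_of_int (2 * (m + 1)) \<le> real N" by linarith
  then have m1: "real_of_int (m + 1) \<le> real N / 2" "real_of_int m \<le> real N / 2" by auto
  define d where "d = 2 * lam / real N"
  have d: "0 \<le> d" "real N / 2 * d = lam" using lam N by (simp_all add: d_def)
  have "x_node N lam (m + 1) = real_of_int (m + 1) * d" "x_node N lam m = real_of_int m * d"
    using m m1 unfolding d_def by (simp_all only: x_node_nonneg x_node_pos_fine)
  moreover have "real_of_int (m + 1) * d \<le> real N / 2 * d"
    by (rule mult_right_mono[OF m1(1) d(1)])
  moreover have "0 \<le> real_of_int m * d" using m d by simp
  ultimately show ?thesis using True d(2) unfolding d_def[symmetric] by (simp add: distrib_right)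
next
  case False
  then have m1: "real N / 2 \<le> real_of_int (m + 1)" "real N / 2 \<le> real_of_int m" by linarith+
  define d where "d = 2 * (1 - lam) / real N"
  have d: "0 \<le> d" "real N / 2 * d = 1 - lam" using lam N by (simp_all add: d_def)
  have "real_of_int (m + 1) \<le> real N" using m by linarith
  then have "real_of_int (m + 1) - real N / 2 \<le> real N / 2" "0 \<le> real_of_int m - real N / 2"
    using m1 by linarith+
  then have "(real_of_int (m + 1) - real N / 2) * d \<le> real N / 2 * d" "0 \<le> (real_of_int m - real N / 2) * d"
    using mult_right_mono[OF _ d(1)] mult_nonneg_nonneg[OF _ d(1)] by blast+
  moreover have "x_node N lam (m + 1) = lam + (real_of_int (m + 1) - real N / 2) * d"
      "x_node N lam m = lam + (real_of_int m - real N / 2) * d"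
    using m m1 N unfolding d_def by (simp_all only: x_node_nonneg x_node_pos_coarse)
  moreover have "(real_of_int (m + 1) - real N / 2) * d = (real_of_int m - real N / 2) * d + d"
    by (simp add: algebra_simps)
  ultimately show ?thesis using False d(2) unfolding d_def[symmetric] by simp
qed

lemma x_cell:
  assumes N: "even N" "0 < N" and lam: "0 < lam" "lam < 1" and m: "- int N \<le> m" "m < int N"
  shows "if - int N \<le> 2 * m \<and> 2 * m < int N
    then x_node N lam (m + 1) - x_node N lam m = 2 * lam / real N \<and> - lam \<le> x_node N lam m \<and> x_node N lam (m + 1) \<le> lam
    else x_node N lam (m + 1) - x_node N lam m = 2 * (1 - lam) / real N \<and> (lam \<le> x_node N lam m \<or> x_node N lam (m + 1) \<le> - lam)"
proof (cases "0 \<le> m")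
  case True
  then show ?thesis using x_cell_pos[OF N lam True m(2)] lam by (auto split: if_splits)
next
  case False
  \<comment> \<open>Reflection maps the cell from m to m + 1 onto the one from -m - 1 to -m, with
    its end points exchanged.\<close>
  define m' where "m' = - m - 1"
  have m': "0 \<le> m'" "m' < int N" using False m by (auto simp: m'_def)
  have nodes: "x_node N lam m = - x_node N lam (m' + 1)" "x_node N lam (m + 1) = - x_node N lam m'"
    unfolding m'_def x_node_minus[symmetric] by (simp_all add: algebra_simps)
  have "2 * m' < int N \<longleftrightarrow> - int N \<le> 2 * m \<and> 2 * m < int N"
    using False N unfolding m'_def by presburger
  then show ?thesis using x_cell_pos[OF N lam m'] lam unfolding nodes by (auto split: if_splits)
qed

text \<open>Shifts the index range -N..N to 0..2N, as \<open>grid\<close> requires.\<close>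

definition px :: "nat \<Rightarrow> real \<Rightarrow> nat \<Rightarrow> real" where
  "px N lam k = x_node N lam (int k - int N)"

lemma px_Suc: "px N lam (Suc k) = x_node N lam (int k - int N + 1)"
  by (simp add: px_def algebra_simps)

lemma grid_px:
  assumes N: "even N" "0 < N" and lam: "0 < lam" "lam < 1"
  shows "grid (px N lam) (2 * N)"
proof -
  have "x_node N lam (int N) = x_node_pos N lam (real N)"
    using x_node_nonneg[of "int N" N lam] by simp
  also have "\<dots> = lam + (real N - real N / 2) * (2 * (1 - lam) / real N)"
    by (rule x_node_pos_coarse) (use N in auto)
  also have "real N - real N / 2 = real N / 2" by simp
  also have "real N / 2 * (2 * (1 - lam) / real N) = 1 - lam" using N by simp
  finally have "x_node N lam (int N) = 1" by simp
  moreover have "px N lam k < px N lam (Suc k)" if "k < 2 * N" for k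
  proof -
    define m where "m = int k - int N"
    have m: "- int N \<le> m" "m < int N" using that by (auto simp: m_def)
    have "0 < 2 * lam / real N" "0 < 2 * (1 - lam) / real N" using lam N by simp_all
    moreover have "x_node N lam (m + 1) - x_node N lam m \<in> {2 * lam / real N, 2 * (1 - lam) / real N}"
      using x_cell[OF N lam m]
      by (cases "- int N \<le> 2 * m \<and> 2 * m < int N"; simp only: if_True if_False insert_iff; blast)
    ultimately show ?thesis
      unfolding px_Suc unfolding px_def m_def[symmetric] by auto
  qed
  ultimately show ?thesis using x_node_minus[of N lam "int N"] by (simp add: grid_def px_def)
qed

lemma y_node_lower:
  assumes "4 * l \<le> N"
  shows "y_node N lam l = -1 + real l * (4 * lam / real N)"
proof -
  have "real l \<le> real N / 4" using assms by linarith
  then show ?thesis by (simp add: y_node_def)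
qed

lemma y_node_middle:
  assumes "N \<le> 4 * l" "4 * l \<le> 3 * N" "0 < N"
  shows "y_node N lam l = -1 + lam + (real l - real N / 4) * (4 * (1 - lam) / real N)"
proof -
  have "real N / 4 \<le> real l" "real l \<le> 3 * real N / 4" using assms by linarith+
  then show ?thesis
    using assms(3) by (cases "real l = real N / 4") (simp_all only: y_node_def, simp_all)
qed

lemma y_node_upper:
  assumes "3 * N \<le> 4 * l" "0 < N"
  shows "y_node N lam l = 1 - lam + (real l - 3 * real N / 4) * (4 * lam / real N)"
proof (cases "4 * l = 3 * N")
  case True
  then have "real l = 3 * real N / 4" by linarith
  then show ?thesis using assms(2) by (simp add: y_node_middle True field_simps)
next
  case False
  then have "3 * real N / 4 < real l" using assms by linarith
  moreover from this assms(2) have "real N / 4 < real l" by simp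
  ultimately show ?thesis by (simp add: y_node_def)
qed

lemma y_cell:
  assumes N: "4 dvd N" "0 < N" and lam: "0 < lam" "lam < 1" and l: "l < N"
  shows "if 4 * l < N \<or> 3 * N \<le> 4 * l
    then y_node N lam (Suc l) - y_node N lam l = 4 * lam / real N \<and> (y_node N lam (Suc l) \<le> -1 + lam \<or> 1 - lam \<le> y_node N lam l)
    else y_node N lam (Suc l) - y_node N lam l = 4 * (1 - lam) / real N \<and> -1 + lam \<le> y_node N lam l \<and> y_node N lam (Suc l) \<le> 1 - lam"
proof -
  obtain r where r: "N = 4 * r" "0 < r" using N by auto
  consider "l < r" | "r \<le> l" "l < 3 * r" | "3 * r \<le> l" by linarith
  then show ?thesis
  proof cases
    case 1
    define d where "d = 4 * lam / real N"
    have d: "0 \<le> d" "real r * d = lam" using lam r by (simp_all add: d_def)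
    have "real (Suc l) * d \<le> real r * d" using 1 d by (intro mult_right_mono) auto
    moreover have "y_node N lam (Suc l) = -1 + real (Suc l) * d" "y_node N lam l = -1 + real l * d"
      unfolding d_def by (rule y_node_lower; use 1 r in simp)+
    moreover have "real (Suc l) * d = real l * d + d" by (simp add: algebra_simps)
    ultimately show ?thesis using 1 r d(2) unfolding d_def[symmetric] by simp
  next
    case 2
    define d where "d = 4 * (1 - lam) / real N"
    have d: "0 \<le> d" "2 * real r * d = 2 - 2 * lam" using lam r by (simp_all add: d_def)
    have e: "y_node N lam (Suc l) = -1 + lam + (real (Suc l) - real N / 4) * d"
        "y_node N lam l = -1 + lam + (real l - real N / 4) * d"
      unfolding d_def by (rule y_node_middle; use 2 r in simp)+
    have "real (Suc l) - real N / 4 \<le> 2 * real r" "0 \<le> real l - real N / 4"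
      using 2 r by linarith+
    then have "(real (Suc l) - real N / 4) * d \<le> 2 * real r * d" "0 \<le> (real l - real N / 4) * d"
      using mult_right_mono[OF _ d(1)] mult_nonneg_nonneg[OF _ d(1)] by blast+
    then have "-1 + lam \<le> y_node N lam l" "y_node N lam (Suc l) \<le> 1 - lam"
      unfolding e using d(2) by linarith+
    moreover have "y_node N lam (Suc l) - y_node N lam l = d"
      unfolding e by (simp add: algebra_simps)
    ultimately show ?thesis using 2 r unfolding d_def[symmetric] by simp
  next
    case 3
    define d where "d = 4 * lam / real N"
    have d: "0 \<le> d" using lam r by (simp add: d_def)
    have e: "y_node N lam (Suc l) = 1 - lam + (real (Suc l) - 3 * real N / 4) * d"
        "y_node N lam l = 1 - lam + (real l - 3 * real N / 4) * d"
      unfolding d_def by (rule y_node_upper; use 3 r in simp)+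
    have "0 \<le> real l - 3 * real N / 4" using 3 r by simp
    then have "0 \<le> (real l - 3 * real N / 4) * d" using d by (rule mult_nonneg_nonneg)
    then have "1 - lam \<le> y_node N lam l"
      unfolding e by linarith
    moreover have "y_node N lam (Suc l) - y_node N lam l = d"
      unfolding e by (simp add: algebra_simps)
    ultimately show ?thesis using 3 r unfolding d_def[symmetric] by simp
  qed
qed

lemma grid_y_node:
  assumes N: "4 dvd N" "0 < N" and lam: "0 < lam" "lam < 1"
  shows "grid (y_node N lam) N"
proof -
  have "y_node N lam N = 1" using N by (simp add: y_node_upper field_simps)
  moreover have "y_node N lam 0 = -1" by (simp add: y_node_lower)
  moreover have "y_node N lam l < y_node N lam (Suc l)" if "l < N" for l
  proof -
    have "0 < 4 * lam / real N" "0 < 4 * (1 - lam) / real N" using lam N by simp_all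
    moreover have "y_node N lam (Suc l) - y_node N lam l \<in> {4 * lam / real N, 4 * (1 - lam) / real N}"
      using y_cell[OF N lam that] by (cases "4 * l < N \<or> 3 * N \<le> 4 * l"; simp only: if_True if_False insert_iff; blast)
    ultimately show ?thesis by auto
  qed
  ultimately show ?thesis by (simp add: grid_def)
qed

lemma FE_space_FES: "FE_space N lx ly = FES (px N lx) (2 * N) (y_node N ly) N"
proof -
  have "(\<forall>m\<in>{- int N..<int N}. Q m) \<longleftrightarrow> (\<forall>k<2 * N. Q (int k - int N))" for Q
  proof safe
    fix m assume *: "\<forall>k<2 * N. Q (int k - int N)" and m: "m \<in> {- int N..<int N}"
    then have "nat (m + int N) < 2 * N" "int (nat (m + int N)) - int N = m" by auto
    then show "Q m" using * by metis
  qed auto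
  then show ?thesis
    unfolding FE_space_def FES_def px_Suc by (auto simp: px_def)
qed


section \<open>Transition points and layer functions\<close>

text \<open>Since 2/\<alpha> <= 1 and \<epsilon> ln(1/\<epsilon>) <= 1/2, the minimum is always the
  logarithmic term, and the layer function is exactly \<epsilon>^2 at the transition point. This
  cancels the factor 1/\<epsilon>^2 in the bound for \<open>pdx (pdx u)\<close>.\<close>

lemma lambda_x_facts:
  assumes \<epsilon>: "0 < \<epsilon>" "\<epsilon> < 1" and \<alpha>: "5 / 2 \<le> \<alpha>"
  shows "0 < lambda_x \<alpha> \<epsilon>" "lambda_x \<alpha> \<epsilon> \<le> 1 / 2" "lambda_x \<alpha> \<epsilon> \<le> \<epsilon> * ln (1 / \<epsilon>)"
    and "exp (- \<alpha> * lambda_x \<alpha> \<epsilon> / \<epsilon>) = \<epsilon>\<^sup>2"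
proof -
  define s where "s = sqrt \<epsilon>"
  have s: "0 < s" "\<epsilon> = s\<^sup>2" using \<epsilon> by (auto simp: s_def)
  have ln: "0 < ln (1 / \<epsilon>)" using \<epsilon> by simp
  \<comment> \<open>Passing to s = sqrt \<epsilon> gives \<epsilon> ln(1/\<epsilon>) <= 2 (s - s^2)
    <= 1/2; the same bound on the logarithm applied to \<epsilon> itself would only give 1 -
    \<epsilon>.\<close>
  have "ln (1 / s) \<le> 1 / s - 1" using s by (intro ln_le_minus_one) simp
  then have "\<epsilon> * ln (1 / \<epsilon>) \<le> \<epsilon> * (2 * (1 / s - 1))"
    using s by (intro mult_left_mono) (auto simp: ln_div ln_realpow)
  also have "\<dots> = 2 * (s - s\<^sup>2)" using s by (simp add: power2_eq_square field_simps)
  also have "\<dots> \<le> 1 / 2"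
    using zero_le_power2[of "s - 1 / 2"] by (simp add: power2_eq_square algebra_simps)
  finally have half: "\<epsilon> * ln (1 / \<epsilon>) \<le> 1 / 2" .
  have "2 / \<alpha> * (\<epsilon> * ln (1 / \<epsilon>)) \<le> 1 * (\<epsilon> * ln (1 / \<epsilon>))"
    using \<alpha> \<epsilon> ln by (intro mult_right_mono) (auto simp: pos_divide_le_eq)
  then have le: "2 * \<epsilon> / \<alpha> * ln (1 / \<epsilon>) \<le> \<epsilon> * ln (1 / \<epsilon>)"
    by simp
  then have eq: "lambda_x \<alpha> \<epsilon> = 2 * \<epsilon> / \<alpha> * ln (1 / \<epsilon>)"
    using half by (simp add: lambda_x_def min_def)
  show "0 < lambda_x \<alpha> \<epsilon>" "lambda_x \<alpha> \<epsilon> \<le> 1 / 2" "lambda_x \<alpha> \<epsilon> \<le> \<epsilon> * ln (1 / \<epsilon>)"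
    unfolding eq using le half \<epsilon> \<alpha> ln by auto
  have "- \<alpha> * lambda_x \<alpha> \<epsilon> / \<epsilon> = ln \<epsilon> + ln \<epsilon>"
    unfolding eq using \<epsilon> \<alpha> by (simp add: ln_div field_simps)
  then show "exp (- \<alpha> * lambda_x \<alpha> \<epsilon> / \<epsilon>) = \<epsilon>\<^sup>2"
    using \<epsilon> by (simp only: exp_add exp_ln power2_eq_square)
qed

text \<open>Here the minimum may be the cap 1/4. In that case exp(-r) <= 1/r with r = \<beta>/(4
  sqrt \<epsilon>) still gives decay of order sqrt \<epsilon>, and 4/\<beta> <= 6. Otherwise the
  exponent is -3 sqrt \<beta> ln(1/\<epsilon>), which sqrt \<beta> >= 2/3 makes at most ln(sqrt
  \<epsilon>). The factor 5 bounds 3/sqrt \<beta>.\<close>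

lemma lambda_y_facts:
  assumes \<epsilon>: "0 < \<epsilon>" "\<epsilon> < 1" and \<beta>: "2 / 3 \<le> \<beta>" "\<beta> \<le> 1"
  shows "0 < lambda_y \<beta> \<epsilon>" "lambda_y \<beta> \<epsilon> \<le> 1 / 4" "lambda_y \<beta> \<epsilon> \<le> 5 * sqrt \<epsilon> * ln (1 / \<epsilon>)"
    and "exp (- (\<beta> / sqrt \<epsilon>) * lambda_y \<beta> \<epsilon>) \<le> 6 * sqrt \<epsilon>"
proof -
  have ln: "0 < ln (1 / \<epsilon>)" using \<epsilon> by simp
  have sq: "0 < sqrt \<epsilon>" using \<epsilon> by simp
  define t where "t = sqrt \<beta>"
  have t: "2 / 3 \<le> t" "\<beta> = t * t"
  proof -
    have "(2 / 3)\<^sup>2 \<le> \<beta>" using \<beta> by (simp add: power2_eq_square)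
    then show "2 / 3 \<le> t"
      unfolding t_def by (rule real_le_rsqrt)
    show "\<beta> = t * t" using \<beta> by (simp add: t_def)
  qed
  have "ln (1 / \<epsilon> powr (3 / 2)) = 3 / 2 * ln (1 / \<epsilon>)"
    using \<epsilon> by (simp add: ln_div ln_powr)
  then have arg: "2 * sqrt (\<epsilon> / \<beta>) * ln (1 / \<epsilon> powr (3 / 2)) = 3 / t * sqrt \<epsilon> * ln (1 / \<epsilon>)"
    by (simp add: real_sqrt_divide t_def)
  have "0 < 3 / t * sqrt \<epsilon> * ln (1 / \<epsilon>)"
    using sq ln t by (intro mult_pos_pos) auto
  then show "0 < lambda_y \<beta> \<epsilon>"
    unfolding lambda_y_def arg by simp
  show "lambda_y \<beta> \<epsilon> \<le> 1 / 4" by (simp add: lambda_y_def)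
  have "3 / t * (sqrt \<epsilon> * ln (1 / \<epsilon>)) \<le> 5 * (sqrt \<epsilon> * ln (1 / \<epsilon>))"
    using t sq ln by (intro mult_right_mono) (auto simp: pos_divide_le_eq)
  then show "lambda_y \<beta> \<epsilon> \<le> 5 * sqrt \<epsilon> * ln (1 / \<epsilon>)"
    unfolding lambda_y_def arg by (simp add: mult.assoc)
  consider "lambda_y \<beta> \<epsilon> = 1 / 4" | "lambda_y \<beta> \<epsilon> = 3 / t * sqrt \<epsilon> * ln (1 / \<epsilon>)"
    unfolding lambda_y_def arg by linarith
  then show "exp (- (\<beta> / sqrt \<epsilon>) * lambda_y \<beta> \<epsilon>) \<le> 6 * sqrt \<epsilon>"
  proof cases
    case 1
    define r where "r = \<beta> / (4 * sqrt \<epsilon>)"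
    have r: "0 < r" using \<beta> sq by (simp add: r_def)
    have "r \<le> exp r" using exp_ge_add_one_self[of r] by linarith
    then have "inverse (exp r) \<le> inverse r" using r by (rule le_imp_inverse_le)
    also have "\<dots> = 4 / \<beta> * sqrt \<epsilon>" by (simp add: r_def)
    also have "\<dots> \<le> 6 * sqrt \<epsilon>"
      using \<beta> sq by (intro mult_right_mono) (auto simp: pos_divide_le_eq)
    finally show ?thesis
      unfolding 1 by (simp add: r_def exp_minus mult.commute)
  next
    case 2
    have "- (\<beta> / sqrt \<epsilon>) * lambda_y \<beta> \<epsilon> = - (3 * t * ln (1 / \<epsilon>))"
      unfolding 2 using t sq by (simp add: field_simps)
    also have "\<dots> \<le> - (1 / 2 * ln (1 / \<epsilon>))"
      using t ln by (intro le_imp_neg_le mult_right_mono) auto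
    also have "\<dots> = ln (sqrt \<epsilon>)" using \<epsilon> by (simp add: ln_sqrt ln_div)
    finally have "exp (- (\<beta> / sqrt \<epsilon>) * lambda_y \<beta> \<epsilon>) \<le> exp (ln (sqrt \<epsilon>))"
      by (simp only: exp_le_cancel_iff)
    moreover have "exp (ln (sqrt \<epsilon>)) = sqrt \<epsilon>" using sq by simp
    ultimately show ?thesis using sq by linarith
  qed
qed

text \<open>With t the tenth root of \<epsilon> one has P <= 10/t, so each logarithm uses up one
  factor t, and \<epsilon> = t^10, sqrt \<epsilon> = t^5 provide enough of them. The powers 5 and 3
  come from \<open>P^4 * lx\<close> with lx <= \<epsilon> P and from \<open>P^2 * ly\<close> with ly
  <= 5 sqrt \<epsilon> P.\<close>

lemma log_power_bounds:
  assumes \<epsilon>: "0 < \<epsilon>" "\<epsilon> < 1"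
  defines "P \<equiv> 1 + ln (1 / \<epsilon>)"
  shows "1 \<le> P" "P ^ 5 * \<epsilon> \<le> 10 ^ 5" "P ^ 3 * sqrt \<epsilon> \<le> 10 ^ 5"
proof -
  define t where "t = root 10 \<epsilon>"
  have t: "0 < t" "t < 1" "\<epsilon> = t ^ 10" using \<epsilon> by (auto simp: t_def)
  have "sqrt ((t ^ 5)\<^sup>2) = t ^ 5" using t by (simp only: real_sqrt_abs) simp
  then have sq: "sqrt \<epsilon> = t ^ 5" using t(3) by (simp flip: power_mult)
  show P1: "1 \<le> P" using \<epsilon> by (simp add: P_def)
  have "ln (1 / \<epsilon>) = 10 * ln (1 / t)" using t by (simp add: ln_div ln_realpow)
  moreover have "ln (1 / t) \<le> 1 / t - 1" using t by (intro ln_le_minus_one) simp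
  ultimately have "P \<le> 10 / t" by (simp add: P_def)
  then have Pt: "P * t \<le> 10" using t by (simp add: pos_le_divide_eq)
  have t1: "t ^ n \<le> 1" for n using t by (simp add: power_le_one)
  have "P ^ 5 * \<epsilon> = (P * t) ^ 5 * t ^ 5"
    using t by (simp add: power_mult_distrib flip: power_add)
  also have "\<dots> \<le> 10 ^ 5 * 1" using Pt P1 t t1 by (intro mult_mono power_mono) auto
  finally show "P ^ 5 * \<epsilon> \<le> 10 ^ 5" by simp
  have "P ^ 3 * sqrt \<epsilon> = (P * t) ^ 3 * t\<^sup>2"
    unfolding sq by (simp add: power_mult_distrib flip: power_add)
  also have "\<dots> \<le> 10 ^ 3 * 1" using Pt P1 t t1 by (intro mult_mono power_mono) auto
  finally show "P ^ 3 * sqrt \<epsilon> \<le> 10 ^ 5" by simp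
qed

section \<open>Derivative bounds for \<open>u\<close> on the mesh cells\<close>

lemma second_derivatives_add:
  assumes "C_k 2 g" "C_k 2 h"
  shows "C_k 2 (\<lambda>z. g z + h z)"
    and "\<And>z. z \<in> Omega_bar \<Longrightarrow> pdx (\<lambda>z. g z + h z) z = pdx g z + pdx h z"
    and "\<And>z. z \<in> Omega_bar \<Longrightarrow> pdy (\<lambda>z. g z + h z) z = pdy g z + pdy h z"
    and "\<And>z. z \<in> Omega_bar \<Longrightarrow> pdx (pdx (\<lambda>z. g z + h z)) z = pdx (pdx g) z + pdx (pdx h) z"
    and "\<And>z. z \<in> Omega_bar \<Longrightarrow> pdx (pdy (\<lambda>z. g z + h z)) z = pdx (pdy g) z + pdx (pdy h) z"
proof -
  note C = assms[unfolded numeral_2_eq_2]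
  have C1: "C_k (Suc 0) (pdx g)" "C_k (Suc 0) (pdx h)" "C_k (Suc 0) (pdy g)" "C_k (Suc 0) (pdy h)"
    using C by simp_all
  show "C_k 2 (\<lambda>z. g z + h z)" using C_k_lin[OF assms, of 1 1] by simp
  show x: "pdx (\<lambda>z. g z + h z) z = pdx g z + pdx h z" if "z \<in> Omega_bar" for z
    using pdx_lin[OF C that, of 1 1] by simp
  show y: "pdy (\<lambda>z. g z + h z) z = pdy g z + pdy h z" if "z \<in> Omega_bar" for z
    using pdy_lin[OF C that, of 1 1] by simp
  show "pdx (pdx (\<lambda>z. g z + h z)) z = pdx (pdx g) z + pdx (pdx h) z" if "z \<in> Omega_bar" for z
    using pdx_cong[OF x that] pdx_lin[OF C1(1,2) that, of 1 1] by simp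
  show "pdx (pdy (\<lambda>z. g z + h z)) z = pdx (pdy g) z + pdx (pdy h) z" if "z \<in> Omega_bar" for z
    using pdx_cong[OF y that] pdx_lin[OF C1(3,4) that, of 1 1] by simp
qed

text \<open>The bounds for the four components are the four terms of the product (1 +
  \<epsilon>^(-i) s)(1 + \<epsilon>^(-j/2) E), with s and E the layer functions in \<open>x\<close>
  and \<open>y\<close>.\<close>

lemma decomposition_bounds:
  assumes dec: "solution_decomposition C\<^sub>0 \<alpha> \<beta> \<epsilon> u" and \<epsilon>: "0 < \<epsilon>"
  shows "C_k 2 u" "0 \<le> C\<^sub>0"
    and "\<And>x y. x \<in> {-1..1} \<Longrightarrow> y \<in> {-1..1} \<Longrightarrow>
      \<bar>pdx u (x, y)\<bar> \<le> C\<^sub>0 * ((1 + exp (- \<alpha> * \<bar>x\<bar> / \<epsilon>) / \<epsilon>) * (1 + layer_y \<epsilon> \<beta> y)) \<and>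
      \<bar>pdy u (x, y)\<bar> \<le> C\<^sub>0 * ((1 + exp (- \<alpha> * \<bar>x\<bar> / \<epsilon>)) * (1 + layer_y \<epsilon> \<beta> y / sqrt \<epsilon>)) \<and>
      \<bar>pdx (pdx u) (x, y)\<bar> \<le> C\<^sub>0 * ((1 + exp (- \<alpha> * \<bar>x\<bar> / \<epsilon>) / \<epsilon>\<^sup>2) * (1 + layer_y \<epsilon> \<beta> y)) \<and>
      \<bar>pdx (pdy u) (x, y)\<bar> \<le> C\<^sub>0 * ((1 + exp (- \<alpha> * \<bar>x\<bar> / \<epsilon>) / \<epsilon>) * (1 + layer_y \<epsilon> \<beta> y / sqrt \<epsilon>))"
proof -
  obtain R F1 F2 F3 where C: "C_k 2 R" "C_k 2 F1" "C_k 2 F2" "C_k 2 F3"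
    and sum: "\<And>z. z \<in> Omega_bar \<Longrightarrow> u z = R z + F1 z + F2 z + F3 z"
    and bnd: "\<And>x y i j. x \<in> {-1..1} \<Longrightarrow> y \<in> {-1..1} \<Longrightarrow> i + j \<le> 2 \<Longrightarrow>
          \<bar>pd i j R (x, y)\<bar> \<le> C\<^sub>0 \<and>
          \<bar>pd i j F1 (x, y)\<bar> \<le> C\<^sub>0 * \<epsilon> powr (- real i) * exp (- \<alpha> * \<bar>x\<bar> / \<epsilon>) \<and>
          \<bar>pd i j F2 (x, y)\<bar> \<le> C\<^sub>0 * \<epsilon> powr (- real j / 2) * layer_y \<epsilon> \<beta> y \<and>
          \<bar>pd i j F3 (x, y)\<bar> \<le> C\<^sub>0 * \<epsilon> powr (- real i - real j / 2) * exp (- \<alpha> * \<bar>x\<bar> / \<epsilon>) * layer_y \<epsilon> \<beta> y"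
    using dec unfolding solution_decomposition_def by blast
  define v where "v = (\<lambda>z. R z + F1 z + F2 z + F3 z)"
  note A = second_derivatives_add[OF C(1,2)]
  note B = second_derivatives_add[OF A(1) C(3)]
  note D = second_derivatives_add[OF B(1) C(4)]
  have uv: "u z = v z" if "z \<in> Omega_bar" for z using sum[OF that] by (simp add: v_def)
  have "C_k 2 v"
    unfolding v_def by (rule D(1))
  then show Cu: "C_k 2 u" by (rule C_k_cong) (use uv in auto)
  show "0 \<le> C\<^sub>0" using bnd[of 0 0 0 0] abs_ge_zero[of "pd 0 0 R (0, 0)"] by force
  fix x y :: real assume xy: "x \<in> {-1..1}" "y \<in> {-1..1}"
  then have z: "(x, y) \<in> Omega_bar" by simp
  have four: "\<bar>r + f1 + f2 + f3\<bar> \<le> C\<^sub>0 * ((1 + ei * s) * (1 + ej * E))"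
    if "\<bar>r\<bar> \<le> C\<^sub>0" "\<bar>f1\<bar> \<le> C\<^sub>0 * ei * s" "\<bar>f2\<bar> \<le> C\<^sub>0 * ej * E" "\<bar>f3\<bar> \<le> C\<^sub>0 * (ei * ej) * s * E"
    for r f1 f2 f3 ei ej s E :: real
  proof -
    have "\<bar>r + f1 + f2 + f3\<bar> \<le> C\<^sub>0 + C\<^sub>0 * ei * s + C\<^sub>0 * ej * E + C\<^sub>0 * (ei * ej) * s * E"
      using that by linarith
    then show ?thesis by (simp add: algebra_simps)
  qed
  have pw: "\<epsilon> powr (- real i - real j / 2) = \<epsilon> powr (- real i) * \<epsilon> powr (- real j / 2)" for i j
    by (simp flip: powr_add)
  have all: "\<bar>pd i j R (x, y) + pd i j F1 (x, y) + pd i j F2 (x, y) + pd i j F3 (x, y)\<bar> \<le>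
      C\<^sub>0 * ((1 + \<epsilon> powr (- real i) * exp (- \<alpha> * \<bar>x\<bar> / \<epsilon>)) * (1 + \<epsilon> powr (- real j / 2) * layer_y \<epsilon> \<beta> y))"
    if "i + j \<le> 2" for i j using bnd[OF xy that] unfolding pw by (intro four) auto
  have pws: "\<epsilon> powr (- 1) = 1 / \<epsilon>" "\<epsilon> powr (- 2) = 1 / \<epsilon>\<^sup>2" "\<epsilon> powr (- (1 / 2)) = 1 / sqrt \<epsilon>"
    using \<epsilon> by (subst powr_minus, simp add: powr_half_sqrt inverse_eq_divide)+
  have pd: "pd 1 0 g = pdx g" "pd 0 1 g = pdy g" "pd 2 0 g = pdx (pdx g)" "pd 1 1 g = pdx (pdy g)" for g
    by (simp_all add: pd_def numeral_2_eq_2)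
  have a: "\<bar>pdx R (x, y) + pdx F1 (x, y) + pdx F2 (x, y) + pdx F3 (x, y)\<bar> \<le>
        C\<^sub>0 * ((1 + exp (- \<alpha> * \<bar>x\<bar> / \<epsilon>) / \<epsilon>) * (1 + layer_y \<epsilon> \<beta> y))"
      "\<bar>pdy R (x, y) + pdy F1 (x, y) + pdy F2 (x, y) + pdy F3 (x, y)\<bar> \<le>
        C\<^sub>0 * ((1 + exp (- \<alpha> * \<bar>x\<bar> / \<epsilon>)) * (1 + layer_y \<epsilon> \<beta> y / sqrt \<epsilon>))"
      "\<bar>pdx (pdx R) (x, y) + pdx (pdx F1) (x, y) + pdx (pdx F2) (x, y) + pdx (pdx F3) (x, y)\<bar> \<le>
        C\<^sub>0 * ((1 + exp (- \<alpha> * \<bar>x\<bar> / \<epsilon>) / \<epsilon>\<^sup>2) * (1 + layer_y \<epsilon> \<beta> y))"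
      "\<bar>pdx (pdy R) (x, y) + pdx (pdy F1) (x, y) + pdx (pdy F2) (x, y) + pdx (pdy F3) (x, y)\<bar> \<le>
        C\<^sub>0 * ((1 + exp (- \<alpha> * \<bar>x\<bar> / \<epsilon>) / \<epsilon>) * (1 + layer_y \<epsilon> \<beta> y / sqrt \<epsilon>))"
    using all[of 1 0] all[of 0 1] all[of 2 0] all[of 1 1] \<epsilon> unfolding pd by (simp_all add: pws)
  have "pdx u (x, y) = pdx v (x, y)" "pdy u (x, y) = pdy v (x, y)"
    using pdx_cong[OF uv z] pdy_cong[OF uv z] by auto
  moreover have "pdx (pdx u) (x, y) = pdx (pdx v) (x, y)" "pdx (pdy u) (x, y) = pdx (pdy v) (x, y)"
    using pdx_cong[OF pdx_cong[OF uv] z] pdx_cong[OF pdy_cong[OF uv] z] by auto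
  ultimately show "\<bar>pdx u (x, y)\<bar> \<le> C\<^sub>0 * ((1 + exp (- \<alpha> * \<bar>x\<bar> / \<epsilon>) / \<epsilon>) * (1 + layer_y \<epsilon> \<beta> y)) \<and>
      \<bar>pdy u (x, y)\<bar> \<le> C\<^sub>0 * ((1 + exp (- \<alpha> * \<bar>x\<bar> / \<epsilon>)) * (1 + layer_y \<epsilon> \<beta> y / sqrt \<epsilon>)) \<and>
      \<bar>pdx (pdx u) (x, y)\<bar> \<le> C\<^sub>0 * ((1 + exp (- \<alpha> * \<bar>x\<bar> / \<epsilon>) / \<epsilon>\<^sup>2) * (1 + layer_y \<epsilon> \<beta> y)) \<and>
      \<bar>pdx (pdy u) (x, y)\<bar> \<le> C\<^sub>0 * ((1 + exp (- \<alpha> * \<bar>x\<bar> / \<epsilon>) / \<epsilon>) * (1 + layer_y \<epsilon> \<beta> y / sqrt \<epsilon>))"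
      using a unfolding v_def D(2-5)[OF z] B(2-5)[OF z] A(2-5)[OF z] by simp
qed

text \<open>On coarse cells the layer functions have decayed enough to compensate the negative
  powers of \<epsilon>: s <= \<epsilon>^2 and E <= 12 sqrt \<epsilon>, the latter from two layers at
  6 sqrt \<epsilon> each. On fine cells they are bounded by constants and the power is charged to
  \<open>gx\<close> or \<open>gy\<close>. The constant is 26 = 2 times (1 + 12).\<close>

lemma cell_bounds:
  assumes dec: "solution_decomposition C\<^sub>0 \<alpha> \<beta> \<epsilon> u" and \<epsilon>: "0 < \<epsilon>" "\<epsilon> < 1"
    and \<alpha>: "5 / 2 \<le> \<alpha>" and \<beta>: "2 / 3 \<le> \<beta>" "\<beta> \<le> 1"
    and xy: "x \<in> {-1..1}" "y \<in> {-1..1}"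
    and fx: "\<not> fx \<Longrightarrow> lambda_x \<alpha> \<epsilon> \<le> \<bar>x\<bar>" and fy: "\<not> fy \<Longrightarrow> \<bar>y\<bar> \<le> 1 - lambda_y \<beta> \<epsilon>"
    and gx: "gx = (if fx then 1 / \<epsilon> else 1)" and gy: "gy = (if fy then 1 / sqrt \<epsilon> else 1)"
    and C: "C = 26 * C\<^sub>0"
  shows "\<bar>pdx u (x, y)\<bar> \<le> C * gx \<and> \<bar>pdy u (x, y)\<bar> \<le> C * gy \<and> \<bar>pdx (pdx u) (x, y)\<bar> \<le> C * gx\<^sup>2 \<and>
      \<bar>pdx (pdy u) (x, y)\<bar> \<le> C * gx * gy \<and>
      \<bar>pdx (pdy u) (x, y)\<bar> \<le> C * gy * (1 + exp (- \<alpha> * \<bar>x\<bar> / \<epsilon>) / \<epsilon>)"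
proof -
  define s where "s = exp (- \<alpha> * \<bar>x\<bar> / \<epsilon>)"
  define E where "E = layer_y \<epsilon> \<beta> y"
  have sq: "0 < sqrt \<epsilon>" "sqrt \<epsilon> < 1" using \<epsilon> by auto
  have s: "0 \<le> s" "s \<le> 1" using \<alpha> \<epsilon> by (auto simp: s_def divide_nonneg_pos)
  have s_coarse: "s \<le> \<epsilon>\<^sup>2" if "\<not> fx"
  proof -
    have "- \<alpha> * \<bar>x\<bar> / \<epsilon> \<le> - \<alpha> * lambda_x \<alpha> \<epsilon> / \<epsilon>"
      using fx[OF that] \<alpha> \<epsilon> by (intro divide_right_mono) auto
    then have "s \<le> exp (- \<alpha> * lambda_x \<alpha> \<epsilon> / \<epsilon>)"
      unfolding s_def by (simp only: exp_le_cancel_iff)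
    then show ?thesis using lambda_x_facts(4)[OF \<epsilon> \<alpha>] by simp
  qed
  have E: "0 \<le> E" "E \<le> 2"
  proof -
    have "exp (- (\<beta> / sqrt \<epsilon>) * (1 + y)) \<le> 1" "exp (- (\<beta> / sqrt \<epsilon>) * (1 - y)) \<le> 1"
      using \<beta> sq xy by (auto intro!: mult_nonneg_nonneg divide_nonneg_pos)
    then show "E \<le> 2"
      unfolding E_def layer_y_def by linarith
    show "0 \<le> E"
      unfolding E_def layer_y_def by (intro add_nonneg_nonneg) auto
  qed
  have E_coarse: "E \<le> 12 * sqrt \<epsilon>" if "\<not> fy"
  proof -
    have *: "exp (- (\<beta> / sqrt \<epsilon>) * d) \<le> 6 * sqrt \<epsilon>" if "lambda_y \<beta> \<epsilon> \<le> d" for d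
    proof -
      have "- (\<beta> / sqrt \<epsilon>) * d \<le> - (\<beta> / sqrt \<epsilon>) * lambda_y \<beta> \<epsilon>"
        using that \<beta> sq by (intro mult_left_mono_neg) auto
      then have "exp (- (\<beta> / sqrt \<epsilon>) * d) \<le> exp (- (\<beta> / sqrt \<epsilon>) * lambda_y \<beta> \<epsilon>)"
        by (simp only: exp_le_cancel_iff)
      then show ?thesis using lambda_y_facts(4)[OF \<epsilon> \<beta>] by linarith
    qed
    show ?thesis
      using *[of "1 + y"] *[of "1 - y"] fy[OF that] unfolding E_def layer_y_def by linarith
  qed
  have gx1: "1 \<le> gx" and gy1: "1 \<le> gy" using \<epsilon> sq by (auto simp: gx gy)
  have X1: "1 + s / \<epsilon> \<le> 2 * gx"
  proof (cases fx)
    case True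
    have "s / \<epsilon> \<le> 1 / \<epsilon>" using s \<epsilon> by (intro divide_right_mono) auto
    then show ?thesis using True gx1 by (simp add: gx)
  next
    case False
    have "s / \<epsilon> \<le> \<epsilon>\<^sup>2 / \<epsilon>"
      using s_coarse[OF False] \<epsilon> by (intro divide_right_mono) auto
    also have "\<dots> \<le> 1" using \<epsilon> by (simp add: power2_eq_square)
    finally show ?thesis using False unfolding gx by simp
  qed
  have X2: "1 + s / \<epsilon>\<^sup>2 \<le> 2 * gx\<^sup>2"
  proof (cases fx)
    case True
    have "s / \<epsilon>\<^sup>2 \<le> 1 / \<epsilon>\<^sup>2"
      using s \<epsilon> by (intro divide_right_mono) auto
    moreover have "1 \<le> gx\<^sup>2" using gx1 by simp
    ultimately show ?thesis using True by (simp add: gx power_divide)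
  next
    case False
    have "s / \<epsilon>\<^sup>2 \<le> \<epsilon>\<^sup>2 / \<epsilon>\<^sup>2"
      using s_coarse[OF False] \<epsilon> by (intro divide_right_mono) auto
    then show ?thesis using False \<epsilon> by (simp add: gx)
  qed
  have Y1: "1 + E / sqrt \<epsilon> \<le> 13 * gy"
  proof (cases fy)
    case True
    have "E / sqrt \<epsilon> \<le> 2 / sqrt \<epsilon>"
      using E sq by (intro divide_right_mono) auto
    then show ?thesis using True gy1 by (simp add: gy)
  next
    case False
    have "E / sqrt \<epsilon> \<le> 12 * sqrt \<epsilon> / sqrt \<epsilon>"
      using E_coarse[OF False] sq by (intro divide_right_mono) auto
    then show ?thesis using False sq by (simp add: gy)
  qed
  note D = decomposition_bounds[OF dec \<epsilon>(1)]
  note d = D(3)[OF xy, folded s_def E_def]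
  have C0: "0 \<le> C\<^sub>0" by (rule D(2))
  have nn: "0 \<le> s / \<epsilon>" "0 \<le> s / \<epsilon>\<^sup>2" "0 \<le> E / sqrt \<epsilon>"
    using s E \<epsilon> by auto
  have "\<bar>pdx u (x, y)\<bar> \<le> C\<^sub>0 * (2 * gx * 13)"
    by (rule order_trans[OF conjunct1[OF d]]) (intro mult_left_mono[OF mult_mono] X1 C0; use E gx1 nn in simp)
  moreover have "\<bar>pdy u (x, y)\<bar> \<le> C\<^sub>0 * (2 * (13 * gy))"
    by (rule order_trans[OF conjunct1[OF conjunct2[OF d]]]) (intro mult_left_mono[OF mult_mono] Y1 C0; use E s gy1 nn in simp)
  moreover have "\<bar>pdx (pdx u) (x, y)\<bar> \<le> C\<^sub>0 * (2 * gx\<^sup>2 * 13)"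
    by (rule order_trans[OF conjunct1[OF conjunct2[OF conjunct2[OF d]]]])
       (intro mult_left_mono[OF mult_mono] X2 C0; use E gx1 nn in simp)
  moreover have "\<bar>pdx (pdy u) (x, y)\<bar> \<le> C\<^sub>0 * (2 * gx * (13 * gy))"
    by (rule order_trans[OF conjunct2[OF conjunct2[OF conjunct2[OF d]]]])
       (intro mult_left_mono[OF mult_mono] X1 Y1 C0; use E gx1 gy1 nn in simp)
  \<comment> \<open>A second bound for the same derivative, with the exponential in \<open>x\<close>
    left in place for the diffusion term.\<close>
  moreover have "\<bar>pdx (pdy u) (x, y)\<bar> \<le> C\<^sub>0 * (2 * (1 + s / \<epsilon>) * (13 * gy))"
    by (rule order_trans[OF conjunct2[OF conjunct2[OF conjunct2[OF d]]]])
       (intro mult_left_mono[OF mult_mono] Y1 C0; use E gx1 gy1 nn in simp)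
  ultimately show ?thesis
    unfolding C s_def[symmetric] by (simp add: algebra_simps)
qed

lemma bounded_on_square:
  assumes "continuous_on Omega_bar (g :: real \<times> real \<Rightarrow> real)"
  obtains K where "0 \<le> K" "\<And>z. z \<in> Omega_bar \<Longrightarrow> \<bar>g z\<bar> \<le> K"
proof -
  have "compact Omega_bar" by (simp add: compact_Times)
  then have "bounded (g ` Omega_bar)"
    using assms compact_continuous_image compact_imp_bounded by blast
  then obtain K where "\<forall>z\<in>Omega_bar. \<bar>g z\<bar> \<le> K"
    unfolding bounded_iff by (auto simp del: mem_Times_iff)
  then show ?thesis by (intro that[of "max 0 K"]) (auto simp: le_max_iff_disj)
qed


section \<open>The error bound\<close>

lemma shishkin_L2_bound:
  assumes \<alpha>: "5 / 2 \<le> \<alpha>" and \<beta>: "2 / 3 \<le> \<beta>" "\<beta> \<le> 1" and \<gamma>: "0 < \<gamma>"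
    and b: "X1 (b1 a) bx" and bm: "BM c" "BM f"
    and coercive: "\<And>z. z \<in> Omega \<Longrightarrow> \<gamma> \<le> c z - 1 / 2 * bx z"
    and M: "20 \<le> M" "\<And>z. z \<in> Omega_bar \<Longrightarrow> \<bar>a z\<bar> \<le> M" "\<And>z. z \<in> Omega_bar \<Longrightarrow> \<bar>c z\<bar> \<le> M"
    and \<epsilon>: "0 < \<epsilon>" "\<epsilon> < 1" and N: "4 dvd N" "0 < N"
    and ws: "weak_solution \<epsilon> a c f u" and dec: "solution_decomposition C\<^sub>0 \<alpha> \<beta> \<epsilon> u"
  defines "p \<equiv> px N (lambda_x \<alpha> \<epsilon>)" and "q \<equiv> y_node N (lambda_y \<beta> \<epsilon>)"
  assumes uh: "uh \<in> FES p (2 * N) q N" "\<And>v. v \<in> FES p (2 * N) q N \<Longrightarrow> B_form \<epsilon> a c uh v = ip f v"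
  shows "\<gamma> * J (\<lambda>z. (Ix p (2 * N) (Iy q N u) z - uh z)\<^sup>2) \<le>
      (26 * C\<^sub>0 * M)\<^sup>2 * (16 * (1 + 10 ^ 6) + 64 * M\<^sup>2 * (1 + 10 ^ 6)\<^sup>2 / \<gamma>) / (real N)\<^sup>2"
proof -
  define lx where "lx = lambda_x \<alpha> \<epsilon>"
  define ly where "ly = lambda_y \<beta> \<epsilon>"
  define P where "P = 1 + ln (1 / \<epsilon>)"
  define fx where "fx k \<longleftrightarrow> - int N \<le> 2 * (int k - int N) \<and> 2 * (int k - int N) < int N" for k
  define fy where "fy l \<longleftrightarrow> 4 * l < N \<or> 3 * N \<le> 4 * l" for l
  define gx where "gx k = (if fx k then 1 / \<epsilon> else 1)" for k
  define gy where "gy l = (if fy l then 1 / sqrt \<epsilon> else 1)" for l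
  note lx = lambda_x_facts[OF \<epsilon> \<alpha>, folded lx_def]
  note ly = lambda_y_facts[OF \<epsilon> \<beta>, folded ly_def]
  note P = log_power_bounds[OF \<epsilon>, folded P_def]
  have lx1: "lx < 1" and ly1: "ly < 1" using lx(2) ly(2) by auto
  have N2: "even N" using N(1) by auto
  have sq: "0 < sqrt \<epsilon>" "sqrt \<epsilon> < 1" using \<epsilon> by auto
  have p: "grid p (2 * N)" and q: "grid q N"
    unfolding p_def q_def
    by (rule grid_px[OF N2 N(2) lx(1) lx1, unfolded lx_def], rule grid_y_node[OF N ly(1) ly1, unfolded ly_def])
  have ln: "0 \<le> ln (1 / \<epsilon>)" "ln (1 / \<epsilon>) \<le> P"
    using \<epsilon> by (auto simp: P_def)
  have lxP: "lx \<le> \<epsilon> * P"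
    by (rule order_trans[OF lx(3) mult_left_mono[OF ln(2)]]) (use \<epsilon> in simp)
  have lyP: "ly \<le> 5 * sqrt \<epsilon> * P"
    by (rule order_trans[OF ly(3) mult_left_mono[OF ln(2)]]) (use sq in simp)
  have cx: "if fx k then p (Suc k) - p k = 2 * lx / real N \<and> - lx \<le> p k \<and> p (Suc k) \<le> lx
      else p (Suc k) - p k = 2 * (1 - lx) / real N \<and> (lx \<le> p k \<or> p (Suc k) \<le> - lx)" if "k < 2 * N" for k
    using x_cell[OF N2 N(2) lx(1) lx1, of "int k - int N"] that
    unfolding fx_def p_def lx_def[symmetric] px_Suc by (auto simp: px_def)
  have cy: "if fy l then q (Suc l) - q l = 4 * ly / real N \<and> (q (Suc l) \<le> -1 + ly \<or> 1 - ly \<le> q l)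
      else q (Suc l) - q l = 4 * (1 - ly) / real N \<and> -1 + ly \<le> q l \<and> q (Suc l) \<le> 1 - ly" if "l < N" for l
    using y_cell[OF N ly(1) ly1 that] unfolding fy_def q_def ly_def[symmetric] .
  have u2: "C_k 2 u" and C0: "0 \<le> C\<^sub>0"
    by (rule decomposition_bounds[OF dec \<epsilon>(1)])+
  have u: "C_k (Suc (Suc 0)) u" using u2 by (simp only: numeral_2_eq_2)
  have ub: "u z = 0" if "z \<in> frontier Omega" for z
    using ws that by (intro H10_boundary[OF _ u]) (auto simp: weak_solution_def)
  show ?thesis
  proof (rule energy_estimate[OF p q u ub ws uh b bm coercive \<epsilon> \<gamma>, where P = P and fx = fx and fy = fy and lx = lx and ly = ly
        and Px = "\<lambda>k. if fx k then P else 1" and Py = "\<lambda>l. if fy l then P else 1" and gx = gx and gy = gy and \<alpha> = \<alpha>])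
    show "0 < real N" "1 \<le> \<alpha>" "1 \<le> P" "1 \<le> M" "0 \<le> lx" "lx \<le> 1" "0 \<le> ly" "ly \<le> 1" "0 \<le> 26 * C\<^sub>0"
      using N \<alpha> P(1) M(1) lx(1) lx1 ly(1) ly1 C0 by auto
    show "\<bar>c z\<bar> \<le> M" if "z \<in> Omega" for z
      using M(3) that Omega_subset_bar by blast
    show "- lx \<le> p k \<and> p (Suc k) \<le> lx" if "k < 2 * N" "fx k" for k
      using cx[OF that(1)] that(2) by simp
    show "q (Suc l) \<le> -1 + ly \<or> 1 - ly \<le> q l" if "l < N" "fy l" for l
      using cy[OF that(1)] that(2) by simp
    \<comment> \<open>The value 10^6 for \<open>M'\<close> covers both 10^5, which arises for
      \<open>lx\<close>, and 5 times 10^5, which arises for \<open>ly\<close>.\<close>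
    have "P ^ 4 * lx \<le> P ^ 4 * (\<epsilon> * P)" using lxP P(1) by (intro mult_left_mono) auto
    also have "\<dots> = P ^ 5 * \<epsilon>" by (simp add: eval_nat_numeral)
    also have "\<dots> \<le> 10 ^ 6" using P(2) by simp
    finally show "P ^ 4 * lx \<le> 10 ^ 6" .
    have "P\<^sup>2 * ly \<le> P\<^sup>2 * (5 * sqrt \<epsilon> * P)"
      using lyP P(1) by (intro mult_left_mono) auto
    also have "\<dots> = 5 * (P ^ 3 * sqrt \<epsilon>)" by (simp add: eval_nat_numeral)
    also have "\<dots> \<le> 5 * 10 ^ 5" using P(3) by (rule mult_left_mono) simp
    also have "\<dots> \<le> 10 ^ 6" by simp
    finally show "P\<^sup>2 * ly \<le> 10 ^ 6" .
    show "0 \<le> gx k" "0 \<le> gy k" "sqrt \<epsilon> * gy k \<le> 1" for k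
      using \<epsilon> sq by (auto simp: gx_def gy_def)
    show "(p (Suc k) - p k) * gx k \<le> M / real N * (if fx k then P else 1)" if "k < 2 * N" for k
    proof (cases "fx k")
      case True
      have "lx / \<epsilon> \<le> P"
        using lxP \<epsilon> by (simp add: pos_divide_le_eq mult.commute)
      then have "2 * (lx / \<epsilon>) \<le> 2 * P" by simp
      also have "\<dots> \<le> M * P" using M(1) P(1) by (intro mult_right_mono) auto
      finally have "2 * (lx / \<epsilon>) / real N \<le> M * P / real N"
        using N by (intro divide_right_mono) auto
      then show ?thesis using cx[OF that] True by (simp add: gx_def mult.commute)
    next
      case False
      have "2 * (1 - lx) / real N \<le> M / real N"
        using M(1) lx(1) N by (intro divide_right_mono) auto
      then show ?thesis using cx[OF that] False by (simp add: gx_def)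
    qed
    show "(q (Suc l) - q l) * gy l \<le> M / real N * (if fy l then P else 1)" if "l < N" for l
    proof (cases "fy l")
      case True
      have "ly / sqrt \<epsilon> \<le> 5 * P"
        using lyP sq by (simp add: pos_divide_le_eq mult.commute mult.left_commute)
      \<comment> \<open>The fine width 4 ly / N with ly <= 5 sqrt \<epsilon> P is the origin of the
        requirement M >= 20.\<close>
      then have "4 * (ly / sqrt \<epsilon>) \<le> 20 * P" by simp
      also have "\<dots> \<le> M * P" using M(1) P(1) by (intro mult_right_mono) auto
      finally have "4 * (ly / sqrt \<epsilon>) / real N \<le> M * P / real N"
        using N by (intro divide_right_mono) auto
      then show ?thesis using cy[OF that] True by (simp add: gy_def mult.commute)
    next
      case False
      have "4 * (1 - ly) / real N \<le> M / real N"
        using M(1) ly(1) N by (intro divide_right_mono) auto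
      then show ?thesis using cy[OF that] False by (simp add: gy_def)
    qed
    have sub: "x \<in> {-1..1}" if "k < 2 * N" "x \<in> {p k..p (Suc k)}" for k x
      using grid_bounds[OF p, of k] grid_bounds[OF p, of "Suc k"] that by auto
    have suby: "y \<in> {-1..1}" if "l < N" "y \<in> {q l..q (Suc l)}" for l y
      using grid_bounds[OF q, of l] grid_bounds[OF q, of "Suc l"] that by auto
    show "\<bar>b1 a (x, y)\<bar> * gx k \<le> M * (if fx k then P else 1)"
      if k: "k < 2 * N" "x \<in> {p k..p (Suc k)}" "y \<in> {-1..1}" for k x y
    proof -
      have aM: "\<bar>a (x, y)\<bar> \<le> M" using M(2)[of "(x, y)"] sub[OF k(1,2)] k(3) by simp
      have x1: "\<bar>x\<bar> \<le> 1" using sub[OF k(1,2)] by auto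
      have "\<bar>x\<bar> * gx k \<le> (if fx k then P else 1)"
      proof (cases "fx k")
        case True
        \<comment> \<open>The turning point at work: on fine cells the factor x of
          \<open>b1 a\<close> is at most \<epsilon> P and cancels \<open>gx k\<close> =
          1/\<epsilon>.\<close>
        then have "\<bar>x\<bar> \<le> lx" using cx[OF k(1)] k(2) by (simp add: abs_le_iff)
        also have "\<dots> \<le> \<epsilon> * P" by (rule lxP)
        finally show ?thesis
          using True \<epsilon> by (simp add: gx_def pos_divide_le_eq mult.commute)
      qed (use x1 in \<open>simp add: gx_def\<close>)
      then have "\<bar>a (x, y)\<bar> * (\<bar>x\<bar> * gx k) \<le> M * (if fx k then P else 1)"
        using aM M(1) \<epsilon> by (intro mult_mono) (auto simp: gx_def)
      then show ?thesis by (simp add: b1_def abs_mult mult.assoc mult.left_commute)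
    qed
    show "\<bar>pdx u (x, y)\<bar> \<le> 26 * C\<^sub>0 * gx k \<and> \<bar>pdy u (x, y)\<bar> \<le> 26 * C\<^sub>0 * gy l \<and>
        \<bar>pdx (pdx u) (x, y)\<bar> \<le> 26 * C\<^sub>0 * (gx k)\<^sup>2 \<and> \<bar>pdx (pdy u) (x, y)\<bar> \<le> 26 * C\<^sub>0 * gx k * gy l \<and>
        \<bar>pdx (pdy u) (x, y)\<bar> \<le> 26 * C\<^sub>0 * gy l * (1 + exp (- \<alpha> * \<bar>x\<bar> / \<epsilon>) / \<epsilon>)"
      if kl: "k < 2 * N" "l < N" "x \<in> {p k..p (Suc k)}" "y \<in> {q l..q (Suc l)}" for k l x y
    proof (rule cell_bounds[OF dec \<epsilon> \<alpha> \<beta> sub[OF kl(1,3)] suby[OF kl(2,4)] _ _ gx_def gy_def refl])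
      show "lambda_x \<alpha> \<epsilon> \<le> \<bar>x\<bar>" if "\<not> fx k"
        using cx[OF kl(1)] that kl(3) unfolding lx_def[symmetric] by auto
      show "\<bar>y\<bar> \<le> 1 - lambda_y \<beta> \<epsilon>" if "\<not> fy l"
        using cy[OF kl(2)] that kl(4) unfolding ly_def[symmetric] by (auto simp: abs_le_iff)
    qed
  qed auto
qed

theorem mainTheorem2:
  fixes a c f :: "real \<times> real \<Rightarrow> real"
    and \<alpha> \<beta> \<gamma> C\<^sub>0 :: real
  assumes "\<alpha> \<ge> 5 / 2"
    and "\<beta> \<in> {2 / 3..1}"
    and "\<gamma> > 0"
    and "C_k 1 a" and "C_k 1 c" and "C_k_hoelder 3 \<beta> f"
    and "\<forall>z\<in>Omega_bar. \<bar>a z\<bar> \<ge> \<alpha>"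
    and "\<forall>z\<in>Omega_bar. \<bar>c z\<bar> \<ge> 0"
    and "\<forall>z\<in>Omega_bar. c z - 1 / 2 * pdx (b1 a) z \<ge> \<gamma>"
    and "f (-1, -1) = 0" and "f (1, 1) = 0" and "f (1, -1) = 0" and "f (-1, 1) = 0"
  shows "\<exists>C>0. \<forall>\<epsilon>. 0 < \<epsilon> \<and> \<epsilon> < 1 \<longrightarrow>
    (\<forall>N::nat. N \<ge> 4 \<and> 4 dvd N \<longrightarrow>
    (\<forall>u uh. weak_solution \<epsilon> a c f u \<longrightarrow>
       solution_decomposition C\<^sub>0 \<alpha> \<beta> \<epsilon> u \<longrightarrow>
       FE_solution N (lambda_x \<alpha> \<epsilon>) (lambda_y \<beta> \<epsilon>) \<epsilon> a c f uh \<longrightarrow>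
       (\<forall>m\<in>{- int N..int N}. \<forall>n\<in>{0..N}.
          (let z = (x_node N (lambda_x \<alpha> \<epsilon>) m, y_node N (lambda_y \<beta> \<epsilon>) n)
           in z \<in> Omega_c (lambda_x \<alpha> \<epsilon>) (lambda_y \<beta> \<epsilon>) \<longrightarrow> \<bar>u z - uh z\<bar> \<le> C))))"
proof -
  have \<beta>: "2 / 3 \<le> \<beta>" "\<beta> \<le> 1" using assms(2) by auto
  have a: "C_k (Suc 0) a" using assms(4) by (simp only: One_nat_def)
  have cont: "continuous_on Omega_bar a" "continuous_on Omega_bar c" "continuous_on Omega_bar f"
    using C_k_continuous[OF assms(4)] C_k_continuous[OF assms(5)] assms(6) C_k_continuous
    unfolding C_k_hoelder_def by blast+
  \<comment> \<open>The product rule form, which puts \<open>b1 a\<close> into the class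
    \<open>X1\<close>; it agrees with \<open>pdx (b1 a)\<close> on \<open>Omega\<close>, where
    coercivity is needed.\<close>
  define bx where "bx = (\<lambda>z. a z + fst z * pdx a z)"
  have b: "X1 (b1 a) bx"
    using X1_mult[OF X1_affine[of 0 1] X1_C_k[OF a]] by (simp add: b1_def[abs_def] bx_def)
  have "pdx (b1 a) z = bx z" if "z \<in> Omega" for z
  proof -
    obtain x y where z: "z = (x, y)" "x \<in> {-1..1}" "y \<in> {-1..1}"
      using \<open>z \<in> Omega\<close> by (cases z) auto
    have "((\<lambda>t. b1 a (t, y)) has_real_derivative bx (x, y)) (at x within {-1..1})"
      unfolding b1_def bx_def using pdx_deriv[OF a z(2,3)] by (auto intro!: derivative_eq_intros)
    then show ?thesis using pdx_eqI z by simp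
  qed
  then have coercive: "\<gamma> \<le> c z - 1 / 2 * bx z" if "z \<in> Omega" for z
    using assms(9) that Omega_subset_bar by (metis subsetD)
  have bm: "BM c" "BM f" using cont by (auto intro: BM_continuous)
  obtain Ma where Ma: "0 \<le> Ma" "\<And>z. z \<in> Omega_bar \<Longrightarrow> \<bar>a z\<bar> \<le> Ma"
    by (rule bounded_on_square[OF cont(1)]) blast
  obtain Mc where Mc: "0 \<le> Mc" "\<And>z. z \<in> Omega_bar \<Longrightarrow> \<bar>c z\<bar> \<le> Mc"
    by (rule bounded_on_square[OF cont(2)]) blast
  define M where "M = 20 + Ma + Mc"
  have M1: "20 \<le> M" using Ma(1) Mc(1) by (simp add: M_def)
  have M2: "\<bar>a z\<bar> \<le> M" "\<bar>c z\<bar> \<le> M" if "z \<in> Omega_bar" for z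
    using Ma(1) Mc(1) Ma(2)[OF that] Mc(2)[OF that] unfolding M_def by linarith+
  \<comment> \<open>\<open>S\<close> depends only on \<open>C\<^sub>0\<close>,
    \<open>\<gamma>\<close> and bounds for \<open>a\<close> and \<open>c\<close>, and is fixed
    before \<epsilon> and N; this is the required uniformity.\<close>
  define S where "S = (26 * C\<^sub>0 * M)\<^sup>2 * (16 * (1 + 10 ^ 6) + 64 * M\<^sup>2 * (1 + 10 ^ 6)\<^sup>2 / \<gamma>)"
  have S: "0 \<le> S"
    unfolding S_def using assms(3) by (intro mult_nonneg_nonneg add_nonneg_nonneg divide_nonneg_pos) auto
  \<comment> \<open>From (w - uh)^2 <= 16 S/\<gamma> at the node and |t| <= 1 + t^2; the summand 1
    also makes \<open>C\<close> positive.\<close>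
  define C where "C = 1 + 16 * S / \<gamma>"
  have C: "1 \<le> C" using S assms(3) by (simp add: C_def)
  have main: "\<bar>u z - uh z\<bar> \<le> C"
    if \<epsilon>: "0 < \<epsilon>" "\<epsilon> < 1" and N: "4 \<le> N" "4 dvd N"
      and ws: "weak_solution \<epsilon> a c f u" and dec: "solution_decomposition C\<^sub>0 \<alpha> \<beta> \<epsilon> u"
      and fe: "FE_solution N (lambda_x \<alpha> \<epsilon>) (lambda_y \<beta> \<epsilon>) \<epsilon> a c f uh"
      and m: "m \<in> {- int N..int N}" and n: "n \<in> {0..N}"
      and z: "z = (x_node N (lambda_x \<alpha> \<epsilon>) m, y_node N (lambda_y \<beta> \<epsilon>) n)"
      and zc: "z \<in> Omega_c (lambda_x \<alpha> \<epsilon>) (lambda_y \<beta> \<epsilon>)"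
    for \<epsilon> N u uh m n z
  proof -
    define lx where "lx = lambda_x \<alpha> \<epsilon>"
    define ly where "ly = lambda_y \<beta> \<epsilon>"
    define p where "p = px N lx"
    define q where "q = y_node N ly"
    note lx = lambda_x_facts[OF \<epsilon> assms(1), folded lx_def]
    note ly = lambda_y_facts[OF \<epsilon> \<beta>, folded ly_def]
    have lx1: "lx < 1" and ly1: "ly < 1" using lx(2) ly(2) by auto
    have N0: "0 < N" and N2: "even N" using N by auto
    have p: "grid p (2 * N)" and q: "grid q N"
      unfolding p_def q_def by (rule grid_px[OF N2 N0 lx(1) lx1], rule grid_y_node[OF N(2) N0 ly(1) ly1])
    have uh: "uh \<in> FES p (2 * N) q N" "\<And>v. v \<in> FES p (2 * N) q N \<Longrightarrow> B_form \<epsilon> a c uh v = ip f v"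
      using fe unfolding FE_solution_def FE_space_FES p_def q_def lx_def ly_def by auto
    have u2: "C_k 2 u" by (rule decomposition_bounds(1)[OF dec \<epsilon>(1)])
    have u: "C_k (Suc (Suc 0)) u" using u2 by (simp only: numeral_2_eq_2)
    have ub: "u z = 0" if "z \<in> frontier Omega" for z
      using ws that by (intro H10_boundary[OF _ u]) (auto simp: weak_solution_def)
    define w where "w = Ix p (2 * N) (Iy q N u)"
    have w: "w \<in> FES p (2 * N) q N"
      unfolding w_def by (rule FES_interpolant[OF p q C_k_continuous[OF u] ub])
    have L2: "\<gamma> * J (\<lambda>z. (w z - uh z)\<^sup>2) \<le> S / (real N)\<^sup>2"
      unfolding w_def S_def p_def q_def lx_def ly_def
      by (rule shishkin_L2_bound[OF assms(1) \<beta> assms(3) b bm coercive M1 M2 \<epsilon> N(2) N0 ws dec])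
         (use uh in \<open>auto simp: p_def q_def lx_def ly_def\<close>)
    have zc': "lx \<le> x_node N lx m" "-1 + ly \<le> q n" "q n \<le> 1 - ly"
      using zc unfolding z Omega_c_def lx_def ly_def q_def by auto
    define k where "k = nat (m + int N)"
    have k: "int k - int N = m" "k \<le> 2 * N" using m by (auto simp: k_def)
    have zk: "z = (p k, q n)"
      unfolding z p_def q_def px_def k(1) lx_def ly_def ..
    \<comment> \<open>Interpolation reproduces nodal values, so at a mesh point the error is
      \<open>w - uh\<close>, a finite element function.\<close>
    have wz: "w z = u z"
      unfolding w_def zk Ix_def Iy_def fst_conv snd_conv using interp_node[OF p k(2)] interp_node[OF q, of n] n by simp
    show ?thesis
    \<comment> \<open>The argument uses the cell to the right of the node. For m = N there is none,
      but that node lies on the boundary, where both functions vanish.\<close>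
    proof (cases "m = int N")
      case True
      then have "k = 2 * N" using k by simp
      then have "z \<in> frontier Omega"
        using p grid_bounds[OF q, of n] n unfolding zk frontier_Omega by (auto simp: grid_def)
      then show ?thesis using ub FES_frontier[OF uh(1)] C by simp
    next
      case False
      then have m': "- int N \<le> m" "m < int N" using m by auto
      have k': "k < 2 * N" using k m' by auto
      \<comment> \<open>A node at or beyond \<open>lx\<close> has index at least N/2, so the cell to
        its right is coarse.\<close>
      have "\<not> (2 * m < int N)"
      proof
        assume *: "2 * m < int N"
        have pos: "0 < 2 * lx / real N" "0 < 2 * (1 - lx) / real N" using lx(1) lx1 N0 by simp_all
        show False
        proof (cases "0 \<le> m")
          case True
          then have "x_node N lx (m + 1) - x_node N lx m = 2 * lx / real N" "x_node N lx (m + 1) \<le> lx"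
            using x_cell_pos[OF N2 N0 lx(1) lx1 True m'(2)] * by simp_all
          then show False using zc'(1) pos(1) by linarith
        next
          case False
          then have "0 \<le> - m - 1" "- m - 1 < int N" using m' by auto
          from x_cell_pos[OF N2 N0 lx(1) lx1 this]
          have "x_node N lx (- m) - x_node N lx (- m - 1) \<in> {2 * lx / real N, 2 * (1 - lx) / real N}"
              "0 \<le> x_node N lx (- m - 1)" using lx(1) by (auto split: if_splits)
          then have "0 \<le> x_node N lx (- m)" using pos by auto
          then show False using zc'(1) lx(1) by (simp add: x_node_minus)
        qed
      qed
      then have hx: "p (Suc k) - p k = 2 * (1 - lx) / real N"
        using x_cell[OF N2 N0 lx(1) lx1 m'] unfolding p_def px_Suc k(1) by (simp add: px_def k(1))
      have n1: "N \<le> 4 * n" "4 * n \<le> 3 * N"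
      proof -
        show "N \<le> 4 * n"
        proof (rule ccontr)
          assume "\<not> ?thesis"
          then have n': "4 * n < N" "n < N" by auto
          then have "q (Suc n) - q n = 4 * ly / real N \<and> (q (Suc n) \<le> -1 + ly \<or> 1 - ly \<le> q n)"
            using y_cell[OF N(2) N0 ly(1) ly1 n'(2)] unfolding q_def by simp
          moreover have "0 < 4 * ly / real N" using ly(1) N0 by simp
          moreover have "q n \<le> q (Suc n)" using n' by (intro grid_mono[OF q]) auto
          moreover have "q n = -1 + real n * (4 * ly / real N)"
            unfolding q_def using n' by (intro y_node_lower) auto
          moreover have "real n * (4 * ly / real N) < real N / 4 * (4 * ly / real N)"
            using n' ly(1) N0 by (intro mult_strict_right_mono) auto
          moreover have "real N / 4 * (4 * ly / real N) = ly" using N0 by simp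
          ultimately show False using zc'(2) by linarith
        qed
        show "4 * n \<le> 3 * N"
        proof (rule ccontr)
          assume "\<not> ?thesis"
          then have n': "3 * N < 4 * n" by auto
          then have "q n = 1 - ly + (real n - 3 * real N / 4) * (4 * ly / real N)"
            unfolding q_def using N0 by (intro y_node_upper) auto
          moreover have "0 < (real n - 3 * real N / 4) * (4 * ly / real N)"
            using n' ly(1) N0 by (intro mult_pos_pos) auto
          ultimately show False using zc'(3) by linarith
        qed
      qed
      \<comment> \<open>In \<open>y\<close> the cell above the node is taken, except at the upper
        transition n = 3N/4, where that cell is fine and the one below is taken.\<close>
      obtain l where l: "l < N" "n = l \<or> n = Suc l" "N \<le> 4 * l" "4 * l < 3 * N"
      proof (cases "4 * n = 3 * N")
        case True
        then obtain n' where "n = Suc n'" using N0 by (cases n) auto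
        then show ?thesis using True N n by (intro that[of n']) auto
      next
        case False
        then show ?thesis using n1 N0 by (intro that[of n]) auto
      qed
      have hy: "q (Suc l) - q l = 4 * (1 - ly) / real N"
        using y_cell[OF N(2) N0 ly(1) ly1 l(1)] l(3,4) unfolding q_def by simp
      \<comment> \<open>lx <= 1/2 and ly <= 1/4 bound the sides of the cell below by 1/N and 3/N,
        however small \<epsilon> is.\<close>
      have "3 / (real N)\<^sup>2 \<le> (p (Suc k) - p k) * (q (Suc l) - q l)"
      proof -
        have "1 / real N * (3 / real N) \<le> 2 * (1 - lx) / real N * (4 * (1 - ly) / real N)"
          using lx(2) ly(2) N0 by (intro mult_mono divide_right_mono) auto
        then show ?thesis
          unfolding hx hy by (simp add: power2_eq_square)
      qed
      then have "3 / (real N)\<^sup>2 * (w z - uh z)\<^sup>2 \<le> (p (Suc k) - p k) * (q (Suc l) - q l) * (w z - uh z)\<^sup>2"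
        by (intro mult_right_mono) auto
      also have "\<dots> \<le> 16 * J (\<lambda>z. (w z - uh z)\<^sup>2)"
        unfolding zk using nodal_bound[OF p k' q l(1) FES_diff[OF w uh(1)], of "p k" "q n"] l(2) by auto
      finally have "\<gamma> * (3 / (real N)\<^sup>2 * (w z - uh z)\<^sup>2) \<le> \<gamma> * (16 * J (\<lambda>z. (w z - uh z)\<^sup>2))"
        using assms(3) by (intro mult_left_mono) auto
      also have "\<dots> \<le> 16 * (S / (real N)\<^sup>2)" using L2 by simp
      finally have "\<gamma> * (3 * (w z - uh z)\<^sup>2) \<le> 16 * S"
        using N0 by (simp add: field_simps)
      moreover have "0 \<le> \<gamma> * (w z - uh z)\<^sup>2" using assms(3) by simp
      ultimately have "\<gamma> * (w z - uh z)\<^sup>2 \<le> 16 * S" by linarith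
      then have "(w z - uh z)\<^sup>2 \<le> 16 * S / \<gamma>"
        using assms(3) by (simp add: pos_le_divide_eq mult.commute)
      moreover have "\<bar>t\<bar> \<le> 1 + t\<^sup>2" for t :: real
        using sum_squares_bound[of "\<bar>t\<bar>" 1] by (simp add: power2_eq_square)
      ultimately have "\<bar>w z - uh z\<bar> \<le> C"
        unfolding C_def by (meson add_left_mono order_trans)
      then show ?thesis by (simp add: wz)
    qed
  qed
  show ?thesis
    unfolding Let_def by (rule exI[of _ C]) (use C main in auto)
qed

end
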